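(* Let $\lambda\in\mathbb{C}\setminus\mathbb{R}_-$ be a Floquet multiplier of algebraic multiplicity $m_\lambda$ with $\sigma$ its associated Floquet exponent ($\lambda=e^{\sigma T}$). Then there exist $\varphi_i\in C_T^{k+1}(\mathbb{R},X)$ satisfying $$(\mathcal{A}-\sigma I)\varphi_i=\begin{cases}0,& i=0,\\ \varphi_{i-1},& i=1,\dots,m_\lambda-1,\end{cases}$$ such that the set of functions $\{\varphi_0(\tau),\dots,\varphi_{m_\lambda-1}(\tau)\}$ is an ordered basis of $E_\lambda(\tau)$. If the functions $q_i\in C_T^{k+1}(\mathbb{R},\mathbb{C}^n)$, $i=0,\dots,m_\lambda-1$, satisfy the periodic linear delay differential equations $$\sum_{l=0}^i\frac1{l!}\Delta^{(l)}(\sigma)q_{i-l}=0,$$ then the (generalized) eigenfunctions $\varphi_i$ are given by $$\varphi_i(\tau)(\theta)=e^{\sigma\theta}\sum_{l=0}^i\frac{\theta^l}{l!}q_{i-l}(\tau+\theta),\qquad\tau\in\mathbb{R},\ \theta\in[-h,0].$$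
   Context: Let $0<h<\infty$, $X=C([-h,0],\mathbb{R}^n)$ with the supremum norm, $x_t(\theta)=x(t+\theta)$, $k\ge1$ an integer, $F:X\to\mathbb{R}^n$ a $C^{k+1}$-smooth map, and $\gamma$ a $T$-periodic ($T>0$) solution of $\dot x(t)=F(x_t)$ with nonhyperbolic periodic orbit. Put $L(t)=DF(\gamma_t)$, represented as $L(t)\varphi=\int_0^hd_2\zeta(t,\theta)\varphi(-\theta)$ (Riemann–Stieltjes integral in the second variable), where $\zeta:\mathbb{R}\times[0,h]\to\mathbb{R}^{n\times n}$ is $T$-periodic in $t$, $\zeta(t,\cdot)$ is of bounded variation, right-continuous on $(0,h)$ and $\zeta(t,0)=0$. All spaces and operators are complexified, without change of notation. $U(t,s)$, $t\ge s$, is given by $U(t,s)\varphi=y_t$ where $\dot y(t)=L(t)y_t$ for $t\ge s$, $y_s=\varphi$. Floquet multipliers are the nonzero eigenvalues $\lambda$ of the monodromy operator $U(s+T,s)$ (independent of $s$); $\sigma$ with $\lambda=e^{\sigma T}$ is a Floquet exponent. $E_\lambda(s)=\mathcal{N}((\lambda I-U(s+T,s))^{k_\lambda})$ is the (generalized) eigenspace at time $s$, where $k_\lambda$ is the order of the pole $\mu=\lambda$ of $\mu\mapsto(\mu I-U(s+T,s))^{-1}$; its dimension $m_\lambda$ is the algebraic multiplicity. $\mathbb{R}_-$ denotes the negative reals. $C_T^l(\mathbb{R},E)$ is the Banach space of $T$-periodic $C^l$ functions $\mathbb{R}\to E$. $A(s)\varphi=\varphi'$ with $\mathcal{D}(A(s))=\{\varphi\in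 C^1([-h,0],\mathbb{R}^n):\varphi'(0)=L(s)\varphi\}$. The operator $\mathcal{A}$ on $C_T(\mathbb{R},X)$ is $(\mathcal{A}\varphi)(\tau)=A(\tau)\varphi(\tau)-\dot\varphi(\tau)$ with $\mathcal{D}(\mathcal{A})=\{\varphi\in C_T^1(\mathbb{R},X):\varphi(\tau)\in\mathcal{D}(A(\tau))\ \forall\tau\in\mathbb{R}\}$. The characteristic operator is $(\Delta(z)q)(\tau)=\dot q(\tau)+zq(\tau)-\int_0^hd_2\zeta(\tau,\theta)e^{-z\theta}q(\tau-\theta)$, $q\in\mathcal{D}(\Delta(z))=C_T^1(\mathbb{R},\mathbb{C}^n)$, and $\Delta^{(l)}(z)$ is its $l$-th derivative with respect to $z$.
   Formalization: The Floquet multiplier λ is assumed to have geometric multiplicity one (otherwise no single chain of length m_λ can be a basis of E_λ(τ)), and the functions φ_i built from given q_i are claimed to form a basis only if q_0 is not identically zero. *)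

theory Defs
  imports "HOL-Analysis.Analysis"
begin

section \<open>The state space\<close>

text \<open>
  \<open>C([-h,0],E)\<close> is represented by the closed subspace of the bounded continuous functions
  \<open>real \<Rightarrow>\<^sub>C E\<close> that are constant to the left of \<open>-h\<close> and to the right of \<open>0\<close>. Restriction to
  \<open>[-h,0]\<close> is an isometric isomorphism of this subspace onto \<open>C([-h,0],E)\<close> with the supremum
  norm; its inverse extends a function by its boundary values. The space \<open>X\<close> is
  \<open>state_space h\<close> with \<open>E = real^'n\<close>, and its complexification the one with \<open>E = complex^'n\<close>.
\<close>

definition state_space :: "real \<Rightarrow> (real \<Rightarrow>\<^sub>C 'e::metric_space) set" where
  "state_space h = {\<phi> :: real \<Rightarrow>\<^sub>C 'e. \<forall>\<theta>. apply_bcontfun \<phi> \<theta> = apply_bcontfun \<phi> (clamp (-h) 0 \<theta>)}"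

text \<open>The history segment \<open>x\<^sub>t\<close>; \<open>x\<close> has to be continuous on \<open>[t-h,t]\<close>.\<close>

definition segment :: "real \<Rightarrow> (real \<Rightarrow> 'e::metric_space) \<Rightarrow> real \<Rightarrow> (real \<Rightarrow>\<^sub>C 'e)" where
  "segment h x t = Bcontfun (\<lambda>\<theta>. x (t + clamp (-h) 0 \<theta>))"

definition scaleC_bcf :: "complex \<Rightarrow> (real \<Rightarrow>\<^sub>C (complex^'n)) \<Rightarrow> (real \<Rightarrow>\<^sub>C (complex^'n))"
    (infixr \<open>*\<^sub>C\<close> 75) where
  "c *\<^sub>C \<phi> = Bcontfun (\<lambda>\<theta>. c *s \<phi> \<theta>)"

lemma apply_scaleC_bcf: "apply_bcontfun (c *\<^sub>C \<phi>) \<theta> = c *s apply_bcontfun \<phi> \<theta>"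
  for \<phi> :: "real \<Rightarrow>\<^sub>C (complex^'n)"
proof -
  have bl: "bounded_linear (\<lambda>v::complex^'n. c *s v)"
    unfolding linear_conv_bounded_linear[symmetric]
    by (rule linearI) (simp_all add: vec_eq_iff algebra_simps)
  have "range (\<lambda>\<theta>. c *s apply_bcontfun \<phi> \<theta>) = (\<lambda>v. c *s v) ` range (apply_bcontfun \<phi>)"
    by auto
  then have "(\<lambda>\<theta>. c *s apply_bcontfun \<phi> \<theta>) \<in> bcontfun"
    using bounded_linear.continuous_on[OF bl continuous_on_apply_bcontfun]
      bounded_linear_image[OF bounded_apply_bcontfun bl]
    by (auto simp: bcontfun_def)
  then show ?thesis
    unfolding scaleC_bcf_def by (simp add: Bcontfun_inverse)
qed

interpretation bcf: vector_space "scaleC_bcf :: complex \<Rightarrow> (real \<Rightarrow>\<^sub>C (complex^'n)) \<Rightarrow> _"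
  by unfold_locales (rule bcontfun_eqI; simp add: apply_scaleC_bcf vec_eq_iff algebra_simps)+

definition ordered_basis ::
    "(real \<Rightarrow>\<^sub>C (complex^'n)) set \<Rightarrow> nat \<Rightarrow> (nat \<Rightarrow> (real \<Rightarrow>\<^sub>C (complex^'n))) \<Rightarrow> bool" where
  "ordered_basis E m b \<longleftrightarrow>
     inj_on b {..<m} \<and> bcf.independent (b ` {..<m}) \<and> bcf.span (b ` {..<m}) = E"

text \<open>Complex-linear extension of a real-linear map defined on the real state space.\<close>

definition complexify ::
    "((real \<Rightarrow>\<^sub>C (real^'n)) \<Rightarrow> real^'n) \<Rightarrow> (real \<Rightarrow>\<^sub>C (complex^'n)) \<Rightarrow> complex^'n" where
  "complexify M \<phi> = (\<chi> i. Complex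
      (M (Bcontfun (\<lambda>\<theta>. \<chi> j. Re (\<phi> \<theta> $ j))) $ i)
      (M (Bcontfun (\<lambda>\<theta>. \<chi> j. Im (\<phi> \<theta> $ j))) $ i))"

section \<open>Smoothness\<close>

text \<open>
  A bounded \<open>j\<close>-linear map on the subspace \<open>V\<close> is a function on the lists of length \<open>j\<close> over
  \<open>V\<close>.
\<close>

definition bounded_multilinear_on ::
    "'a::real_normed_vector set \<Rightarrow> nat \<Rightarrow> ('a list \<Rightarrow> 'b::real_normed_vector) \<Rightarrow> bool" where
  "bounded_multilinear_on V j A \<longleftrightarrow>
     (\<forall>vs\<in>lists V. length vs = j \<longrightarrow> (\<forall>i<j. \<forall>u\<in>V. \<forall>w\<in>V. \<forall>c::real.
        A (vs[i := u + w]) = A (vs[i := u]) + A (vs[i := w]) \<and>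
        A (vs[i := c *\<^sub>R u]) = c *\<^sub>R A (vs[i := u]))) \<and>
     (\<exists>C. \<forall>vs\<in>lists V. length vs = j \<longrightarrow> norm (A vs) \<le> C * prod_list (map norm vs))"

text \<open>
  \<open>f\<close> is \<open>m\<close> times continuously Frechet differentiable on the normed space \<open>V\<close> (a linear
  subspace of the ambient type; values of \<open>f\<close> outside of \<open>V\<close> are irrelevant). Here \<open>D x\<close>
  restricted to lists of length \<open>j\<close> is the \<open>j\<close>-th derivative at \<open>x\<close>: the third conjunct is
  Frechet differentiability of the \<open>j\<close>-th derivative in the norm of \<open>j\<close>-linear maps, the fourth
  one continuity of the \<open>m\<close>-th derivative in the norm of \<open>m\<close>-linear maps.
\<close>

definition smooth_map_on ::
    "nat \<Rightarrow> 'a::real_normed_vector set \<Rightarrow> ('a \<Rightarrow> 'b::real_normed_vector) \<Rightarrow> bool" where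
  "smooth_map_on m V f \<longleftrightarrow> (\<exists>D :: 'a \<Rightarrow> 'a list \<Rightarrow> 'b.
     (\<forall>x\<in>V. D x [] = f x) \<and>
     (\<forall>x\<in>V. \<forall>j\<le>m. bounded_multilinear_on V j (D x)) \<and>
     (\<forall>x\<in>V. \<forall>j<m. \<forall>\<epsilon>>0. \<exists>\<delta>>0. \<forall>u\<in>V. norm u < \<delta> \<longrightarrow>
        (\<forall>vs\<in>lists V. length vs = j \<longrightarrow>
           norm (D (x + u) vs - D x vs - D x (u # vs)) \<le> \<epsilon> * norm u * prod_list (map norm vs))) \<and>
     (\<forall>x\<in>V. \<forall>\<epsilon>>0. \<exists>\<delta>>0. \<forall>u\<in>V. norm u < \<delta> \<longrightarrow>
        (\<forall>vs\<in>lists V. length vs = m \<longrightarrow>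
           norm (D (x + u) vs - D x vs) \<le> \<epsilon> * prod_list (map norm vs))))"

text \<open>\<open>C\<^sub>T\<^sup>l(\<real>,E)\<close>; the function \<open>D j\<close> is the \<open>j\<close>-th derivative.\<close>

definition CT :: "real \<Rightarrow> nat \<Rightarrow> 'e::real_normed_vector set \<Rightarrow> (real \<Rightarrow> 'e) set" where
  "CT T l E = {f. range f \<subseteq> E \<and> (\<forall>t. f (t + T) = f t) \<and>
     (\<exists>D :: nat \<Rightarrow> real \<Rightarrow> 'e. D 0 = f \<and>
        (\<forall>j<l. \<forall>t. (D j has_vector_derivative D (Suc j) t) (at t)) \<and>
        continuous_on UNIV (D l))}"

section \<open>Riemann--Stieltjes integration\<close>

definition bounded_variation_on :: "real \<Rightarrow> real \<Rightarrow> (real \<Rightarrow> 'e::real_normed_vector) \<Rightarrow> bool" where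
  "bounded_variation_on a b g \<longleftrightarrow>
     (\<exists>C. \<forall>d. d division_of {a..b} \<longrightarrow> (\<Sum>K\<in>d. norm (g (Sup K) - g (Inf K))) \<le> C)"

text \<open>A real matrix acting on real or complex vectors.\<close>

definition matrix_act :: "real^'n^'m \<Rightarrow> 'a::real_vector^'n \<Rightarrow> 'a^'m" where
  "matrix_act A v = (\<chi> i. \<Sum>j\<in>UNIV. (A $ i $ j) *\<^sub>R (v $ j))"

text \<open>
  \<open>\<integral>\<^sub>a\<^sup>b dG(\<theta>) f(\<theta>)\<close> as limit of the Riemann--Stieltjes sums when the mesh of the partition tends
  to \<open>0\<close>.
\<close>

definition has_RS_integral ::
    "real \<Rightarrow> real \<Rightarrow> (real \<Rightarrow> real^'n^'m) \<Rightarrow> (real \<Rightarrow> 'a::real_normed_vector^'n) \<Rightarrow> 'a^'m \<Rightarrow> bool"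
  where
  "has_RS_integral a b G f I \<longleftrightarrow>
     (\<forall>\<epsilon>>0. \<exists>\<delta>>0. \<forall>p. p tagged_division_of {a..b} \<and> (\<forall>(x, K)\<in>p. Sup K - Inf K < \<delta>) \<longrightarrow>
        norm ((\<Sum>(x, K)\<in>p. matrix_act (G (Sup K) - G (Inf K)) (f x)) - I) < \<epsilon>)"

definition RS_integral ::
    "real \<Rightarrow> real \<Rightarrow> (real \<Rightarrow> real^'n^'m) \<Rightarrow> (real \<Rightarrow> 'a::real_normed_vector^'n) \<Rightarrow> 'a^'m" where
  "RS_integral a b G f = (THE I. has_RS_integral a b G f I)"

section \<open>The evolution family and Floquet theory\<close>

text \<open>
  Throughout, \<open>L t\<close> is the (real) operator \<open>L(t)\<close>; only its values on the state space matter.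
\<close>

definition solves_linear_DDE ::
    "real \<Rightarrow> (real \<Rightarrow> (real \<Rightarrow>\<^sub>C (real^'n)) \<Rightarrow> real^'n) \<Rightarrow> real \<Rightarrow> (real \<Rightarrow>\<^sub>C (complex^'n))
      \<Rightarrow> (real \<Rightarrow> complex^'n) \<Rightarrow> bool" where
  "solves_linear_DDE h L s \<phi> y \<longleftrightarrow>
     continuous_on {s-h..} y \<and> (\<forall>\<theta>\<in>{-h..0}. y (s + \<theta>) = \<phi> \<theta>) \<and>
     (\<forall>t\<ge>s. (y has_vector_derivative complexify (L t) (segment h y t)) (at t within {s..}))"

definition evolution ::
    "real \<Rightarrow> (real \<Rightarrow> (real \<Rightarrow>\<^sub>C (real^'n)) \<Rightarrow> real^'n) \<Rightarrow> real \<Rightarrow> real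
      \<Rightarrow> (real \<Rightarrow>\<^sub>C (complex^'n)) \<Rightarrow> (real \<Rightarrow>\<^sub>C (complex^'n))" where
  "evolution h L t s \<phi> = (THE \<psi>. \<exists>y. solves_linear_DDE h L s \<phi> y \<and> \<psi> = segment h y t)"

definition monodromy ::
    "real \<Rightarrow> (real \<Rightarrow> (real \<Rightarrow>\<^sub>C (real^'n)) \<Rightarrow> real^'n) \<Rightarrow> real \<Rightarrow> real
      \<Rightarrow> (real \<Rightarrow>\<^sub>C (complex^'n)) \<Rightarrow> (real \<Rightarrow>\<^sub>C (complex^'n))" where
  "monodromy h L T s = evolution h L (s + T) s"

definition floquet_multiplier ::
    "real \<Rightarrow> (real \<Rightarrow> (real \<Rightarrow>\<^sub>C (real^'n)) \<Rightarrow> real^'n) \<Rightarrow> real \<Rightarrow> real \<Rightarrow> complex \<Rightarrow> bool" where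
  "floquet_multiplier h L T s \<mu> \<longleftrightarrow>
     \<mu> \<noteq> 0 \<and> (\<exists>\<phi>\<in>state_space h. \<phi> \<noteq> 0 \<and> monodromy h L T s \<phi> = \<mu> *\<^sub>C \<phi>)"

definition eigenspace ::
    "real \<Rightarrow> (real \<Rightarrow> (real \<Rightarrow>\<^sub>C (real^'n)) \<Rightarrow> real^'n) \<Rightarrow> real \<Rightarrow> real \<Rightarrow> complex
      \<Rightarrow> (real \<Rightarrow>\<^sub>C (complex^'n)) set" where
  "eigenspace h L T s \<mu> = {\<phi>\<in>state_space h. \<mu> *\<^sub>C \<phi> - monodromy h L T s \<phi> = 0}"

definition geometric_multiplicity ::
    "real \<Rightarrow> (real \<Rightarrow> (real \<Rightarrow>\<^sub>C (real^'n)) \<Rightarrow> real^'n) \<Rightarrow> real \<Rightarrow> real \<Rightarrow> complex \<Rightarrow> nat" where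
  "geometric_multiplicity h L T s \<mu> = bcf.dim (eigenspace h L T s \<mu>)"

definition in_resolvent_set ::
    "(real \<Rightarrow>\<^sub>C (complex^'n)) set \<Rightarrow> ((real \<Rightarrow>\<^sub>C (complex^'n)) \<Rightarrow> (real \<Rightarrow>\<^sub>C (complex^'n))) \<Rightarrow> complex \<Rightarrow> bool"
  where
  "in_resolvent_set V S \<mu> \<longleftrightarrow> bij_betw (\<lambda>\<phi>. \<mu> *\<^sub>C \<phi> - S \<phi>) V V \<and>
     (\<exists>C. \<forall>\<phi>\<in>V. norm \<phi> \<le> C * norm (\<mu> *\<^sub>C \<phi> - S \<phi>))"

definition resolvent ::
    "(real \<Rightarrow>\<^sub>C (complex^'n)) set \<Rightarrow> ((real \<Rightarrow>\<^sub>C (complex^'n)) \<Rightarrow> (real \<Rightarrow>\<^sub>C (complex^'n))) \<Rightarrow> complex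
      \<Rightarrow> (real \<Rightarrow>\<^sub>C (complex^'n)) \<Rightarrow> (real \<Rightarrow>\<^sub>C (complex^'n))" where
  "resolvent V S \<mu> = inv_into V (\<lambda>\<phi>. \<mu> *\<^sub>C \<phi> - S \<phi>)"

text \<open>
  The resolvent of \<open>S\<close> on \<open>V\<close> has a pole of order \<open>p\<close> at \<open>lam\<close>: near \<open>lam\<close> it is defined, and
  \<open>(\<mu> - lam)\<^sup>p (\<mu> I - S)\<^sup>-\<^sup>1\<close> converges in operator norm to a nonzero operator \<open>B\<close>, the leading
  coefficient of the Laurent expansion.
\<close>

definition has_resolvent_pole ::
    "(real \<Rightarrow>\<^sub>C (complex^'n)) set \<Rightarrow> ((real \<Rightarrow>\<^sub>C (complex^'n)) \<Rightarrow> (real \<Rightarrow>\<^sub>C (complex^'n))) \<Rightarrow> complex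
      \<Rightarrow> nat \<Rightarrow> bool" where
  "has_resolvent_pole V S lam p \<longleftrightarrow> p \<ge> 1 \<and>
     (\<forall>\<^sub>F \<mu> in at lam. in_resolvent_set V S \<mu>) \<and>
     (\<exists>B. (\<exists>\<psi>\<in>V. B \<psi> \<noteq> 0) \<and>
        (\<forall>\<epsilon>>0. \<forall>\<^sub>F \<mu> in at lam. \<forall>\<psi>\<in>V.
           norm ((\<mu> - lam) ^ p *\<^sub>C resolvent V S \<mu> \<psi> - B \<psi>) \<le> \<epsilon> * norm \<psi>))"

definition resolvent_pole_order ::
    "(real \<Rightarrow>\<^sub>C (complex^'n)) set \<Rightarrow> ((real \<Rightarrow>\<^sub>C (complex^'n)) \<Rightarrow> (real \<Rightarrow>\<^sub>C (complex^'n))) \<Rightarrow> complex \<Rightarrow> nat"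
  where
  "resolvent_pole_order V S lam = (THE p. has_resolvent_pole V S lam p)"

definition gen_eigenspace ::
    "real \<Rightarrow> (real \<Rightarrow> (real \<Rightarrow>\<^sub>C (real^'n)) \<Rightarrow> real^'n) \<Rightarrow> real \<Rightarrow> real \<Rightarrow> complex
      \<Rightarrow> (real \<Rightarrow>\<^sub>C (complex^'n)) set" where
  "gen_eigenspace h L T s \<mu> = {\<phi>\<in>state_space h.
     ((\<lambda>\<psi>. \<mu> *\<^sub>C \<psi> - monodromy h L T s \<psi>) ^^
        resolvent_pole_order (state_space h) (monodromy h L T s) \<mu>) \<phi> = 0}"

definition algebraic_multiplicity ::
    "real \<Rightarrow> (real \<Rightarrow> (real \<Rightarrow>\<^sub>C (real^'n)) \<Rightarrow> real^'n) \<Rightarrow> real \<Rightarrow> real \<Rightarrow> complex \<Rightarrow> nat" where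
  "algebraic_multiplicity h L T s \<mu> = bcf.dim (gen_eigenspace h L T s \<mu>)"

text \<open>
  A periodic orbit is hyperbolic if the trivial multiplier \<open>1\<close> is (algebraically) simple and is
  the only Floquet multiplier on the unit circle.
\<close>

definition nonhyperbolic ::
    "real \<Rightarrow> (real \<Rightarrow> (real \<Rightarrow>\<^sub>C (real^'n)) \<Rightarrow> real^'n) \<Rightarrow> real \<Rightarrow> real \<Rightarrow> bool" where
  "nonhyperbolic h L T s \<longleftrightarrow>
     (\<exists>\<mu>. floquet_multiplier h L T s \<mu> \<and> cmod \<mu> = 1 \<and>
        (\<mu> \<noteq> 1 \<or> algebraic_multiplicity h L T s \<mu> \<noteq> 1))"

section \<open>The operators \<open>A(s)\<close>, \<open>\<A>\<close> and \<open>\<Delta>(z)\<close>\<close>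

text \<open>\<open>\<psi> = \<phi>'\<close> in \<open>C([-h,0],\<complex>\<^sup>n)\<close>, with one-sided derivatives at the end points.\<close>

definition has_state_derivative ::
    "real \<Rightarrow> (real \<Rightarrow>\<^sub>C (complex^'n)) \<Rightarrow> (real \<Rightarrow>\<^sub>C (complex^'n)) \<Rightarrow> bool" where
  "has_state_derivative h \<phi> \<psi> \<longleftrightarrow> \<psi> \<in> state_space h \<and>
     (\<forall>\<theta>\<in>{-h..0}. (\<phi> has_vector_derivative \<psi> \<theta>) (at \<theta> within {-h..0}))"

definition A_dom ::
    "real \<Rightarrow> (real \<Rightarrow> (real \<Rightarrow>\<^sub>C (real^'n)) \<Rightarrow> real^'n) \<Rightarrow> real \<Rightarrow> (real \<Rightarrow>\<^sub>C (complex^'n)) set" where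
  "A_dom h L s = {\<phi>\<in>state_space h. \<exists>\<psi>. has_state_derivative h \<phi> \<psi> \<and> \<psi> 0 = complexify (L s) \<phi>}"

text \<open>The action \<open>\<phi> \<mapsto> \<phi>'\<close> of \<open>A(s)\<close>, which does not depend on \<open>s\<close>.\<close>

definition A_op :: "real \<Rightarrow> (real \<Rightarrow>\<^sub>C (complex^'n)) \<Rightarrow> (real \<Rightarrow>\<^sub>C (complex^'n))" where
  "A_op h \<phi> = (THE \<psi>. has_state_derivative h \<phi> \<psi>)"

definition calA_dom ::
    "real \<Rightarrow> real \<Rightarrow> (real \<Rightarrow> (real \<Rightarrow>\<^sub>C (real^'n)) \<Rightarrow> real^'n) \<Rightarrow> (real \<Rightarrow> (real \<Rightarrow>\<^sub>C (complex^'n))) set"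
  where
  "calA_dom h T L = {\<Phi>\<in>CT T 1 (state_space h). \<forall>\<tau>. \<Phi> \<tau> \<in> A_dom h L \<tau>}"

definition calA :: "real \<Rightarrow> (real \<Rightarrow> (real \<Rightarrow>\<^sub>C (complex^'n))) \<Rightarrow> real \<Rightarrow> (real \<Rightarrow>\<^sub>C (complex^'n))" where
  "calA h \<Phi> \<tau> = A_op h (\<Phi> \<tau>) - vector_derivative \<Phi> (at \<tau>)"

definition Delta ::
    "real \<Rightarrow> (real \<Rightarrow> real \<Rightarrow> real^'n^'n) \<Rightarrow> complex \<Rightarrow> (real \<Rightarrow> complex^'n) \<Rightarrow> real \<Rightarrow> complex^'n" where
  "Delta h \<zeta> z q \<tau> = vector_derivative q (at \<tau>) + z *s q \<tau>
     - RS_integral 0 h (\<zeta> \<tau>) (\<lambda>\<theta>. exp (- z * of_real \<theta>) *s q (\<tau> - \<theta>))"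

text \<open>\<open>\<Delta>\<^sup>(\<^sup>l\<^sup>)(z)q\<close>, differentiating the components of \<open>(\<Delta>(z)q)(\<tau>)\<close> with respect to \<open>z\<close>.\<close>

definition Delta_deriv ::
    "nat \<Rightarrow> real \<Rightarrow> (real \<Rightarrow> real \<Rightarrow> real^'n^'n) \<Rightarrow> complex \<Rightarrow> (real \<Rightarrow> complex^'n) \<Rightarrow> real
      \<Rightarrow> complex^'n" where
  "Delta_deriv l h \<zeta> z q \<tau> = (\<chi> i. (deriv ^^ l) (\<lambda>w. Delta h \<zeta> w q \<tau> $ i) z)"

end

theory Submission
  imports Defs
begin

text \<open>
  Since \<open>\<gamma>\<close> is as smooth as \<open>F\<close> allows, \<open>L\<close> is \<open>C\<^sup>k\<close> along smooth curves. A function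
  \<open>y\<^sub>i(t) = e\<^bsup>\<sigma>(t-\<tau>)\<^esup> \<Sum>\<^sub>l (t-\<tau>)\<^sup>l / l! q\<^sub>i\<^sub>-\<^sub>l(t)\<close> with \<open>T\<close>-periodic \<open>q\<^sub>i\<close> solves the delay
  equation iff the \<open>q\<^sub>i\<close> solve the triangular periodic system of the theorem; its segment at \<open>\<tau>\<close>
  is \<open>\<phi>\<^sub>i(\<tau>)\<close>, so \<open>U(\<tau>+T,\<tau>) \<phi>\<^sub>i(\<tau>) = \<lambda> \<Sum>\<^sub>l T\<^sup>l / l! \<phi>\<^sub>i\<^sub>-\<^sub>l(\<tau>)\<close>. Conversely, as the eigenspace
  is one-dimensional, a chain with this monodromy action can be constructed in the generalized
  eigenspace, and undoing the formula gives periodic \<open>q\<^sub>i\<close>. No spectral theory of compact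
  operators is needed: the monodromy operators at two times are products \<open>B A\<close> and \<open>A B\<close>, hence
  have the same resolvent poles away from \<open>0\<close>, and kernels of the powers of \<open>\<lambda> I - U(\<tau>+T,\<tau>)\<close>
  have the same dimensions.
\<close>


text \<open>One chain can span an m-dimensional generalized eigenspace only if the eigenspace is a
  line; this is where geometric multiplicity one enters. On the phi_i the operator lambda I -
  U(tau+T,tau) is not in Jordan form but strictly triangular, with all powers of T present. What
  matters is its subdiagonal coefficient -lambda T, which never vanishes, so independence and
  counting are carried out for triangular chains rather than Jordan chains. The powers of T are
  handled through the exponentials exp(t (sigma + S)) with S the nilpotent index shift, whose group
  law replaces binomial computations. Two obstacles shape the rest. Pole order and multiplicity are
  given at one time s, while the basis is demanded at every tau, so both must be transported. Delay
  equations are solved forward only, so the coefficients recovered from a chain live on a half-line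
  and need a periodic continuation before they can be called q_i. The kernel zeta is met only
  through L: the Stieltjes integral is identified with L applied to a state, and derivatives in z
  are taken under L by boundedness.\<close>

section \<open>Curves of class C^l\<close>

primrec Ck :: "nat \<Rightarrow> (real \<Rightarrow> 'e::real_normed_vector) \<Rightarrow> bool" where
  "Ck 0 f \<longleftrightarrow> continuous_on UNIV f"
| "Ck (Suc j) f \<longleftrightarrow> (\<exists>f'. (\<forall>t. (f has_vector_derivative f' t) (at t)) \<and> Ck j f')"

lemma Ck_SucI:
  assumes "\<And>t. (f has_vector_derivative f' t) (at t)" "Ck j f'"
  shows "Ck (Suc j) f"
  using assms by auto

lemma Ck_continuous: "Ck j f \<Longrightarrow> continuous_on UNIV f"
  by (cases j) (auto intro!: continuous_at_imp_continuous_on intro: has_vector_derivative_continuous)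

lemma Ck_SucD: "Ck (Suc j) f \<Longrightarrow> Ck j f"
proof (induction j arbitrary: f)
  case 0
  then show ?case using Ck_continuous[of "Suc 0" f] by simp
next
  case (Suc j)
  then show ?case by (metis Ck.simps(2))
qed

lemma Ck_add: "Ck j f \<Longrightarrow> Ck j g \<Longrightarrow> Ck j (\<lambda>t. f t + g t)"
proof (induction j arbitrary: f g)
  case (Suc j)
  then obtain f' g' where "\<forall>t. (f has_vector_derivative f' t) (at t)" "Ck j f'"
    "\<forall>t. (g has_vector_derivative g' t) (at t)" "Ck j g'" by auto
  then show ?case
    by (intro Ck_SucI[of _ "\<lambda>t. f' t + g' t"] Suc.IH has_vector_derivative_add) auto
qed (auto intro: continuous_on_add)

lemma Ck_bounded_linear:
  assumes "bounded_linear A"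
  shows "Ck j f \<Longrightarrow> Ck j (\<lambda>t. A (f t))"
proof (induction j arbitrary: f)
  case (Suc j)
  then obtain f' where "\<forall>t. (f has_vector_derivative f' t) (at t)" "Ck j f'" by auto
  then show ?case
    by (intro Ck_SucI[of _ "\<lambda>t. A (f' t)"] Suc.IH bounded_linear.has_vector_derivative[OF assms]) auto
qed (auto intro: bounded_linear.continuous_on[OF assms])

lemma Ck_const: "Ck j (\<lambda>_. c)"
  by (induction j arbitrary: c) (auto intro!: exI[of _ "\<lambda>_. 0"])

lemma Ck_sum: "(\<And>i. i \<in> I \<Longrightarrow> Ck j (f i)) \<Longrightarrow> Ck j (\<lambda>t. \<Sum>i\<in>I. f i t)"
  by (induction I rule: infinite_finite_induct) (auto intro: Ck_add Ck_const)

lemma Ck_minus: "Ck j f \<Longrightarrow> Ck j g \<Longrightarrow> Ck j (\<lambda>t. f t - g t)"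
  using Ck_add[of j f "\<lambda>t. - g t"] Ck_bounded_linear[OF bounded_linear_minus[OF bounded_linear_ident], of j g]
  by simp

lemma Ck_derivatives:
  assumes "Ck l f"
  obtains D where "D 0 = f" "\<And>j t. j < l \<Longrightarrow> (D j has_vector_derivative D (Suc j) t) (at t)"
    "continuous_on UNIV (D l)"
proof -
  have "\<exists>D. D 0 = f \<and> (\<forall>j<l. \<forall>t. (D j has_vector_derivative D (Suc j) t) (at t))
    \<and> continuous_on UNIV (D l)" using assms
  proof (induction l arbitrary: f)
    case 0
    then show ?case by (intro exI[of _ "\<lambda>_. f"]) auto
  next
    case (Suc l)
    then obtain f' where f': "\<forall>t. (f has_vector_derivative f' t) (at t)" "Ck l f'" by auto
    from Suc.IH[OF f'(2)] obtain D where "D 0 = f'"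
      "\<forall>j<l. \<forall>t. (D j has_vector_derivative D (Suc j) t) (at t)" "continuous_on UNIV (D l)"
      by auto
    with f' show ?case
      by (intro exI[of _ "case_nat f D"]) (auto split: nat.split)
  qed
  then show ?thesis using that by blast
qed

lemma Ck_of_derivatives:
  assumes "\<And>j t. j < l \<Longrightarrow> (D j has_vector_derivative D (Suc j) t) (at t)"
    "continuous_on UNIV (D l)"
  shows "Ck l (D 0)"
  using assms
proof (induction l arbitrary: D)
  case (Suc l)
  have "Ck l (D (Suc 0))"
    using Suc.IH[of "\<lambda>j. D (Suc j)"] Suc.prems by auto
  then show ?case using Suc.prems(1)[of 0] by (intro Ck_SucI) auto
qed auto

text \<open>Links the family of derivatives in \<open>CT\<close> with the recursive
  \<open>Ck\<close>; the recursion on the order is what the later inductions on smoothness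
  follow.\<close>

lemma CT_iff: "f \<in> CT T l E \<longleftrightarrow> range f \<subseteq> E \<and> (\<forall>t. f (t + T) = f t) \<and> Ck l f"
  unfolding CT_def by (auto elim: Ck_derivatives intro: Ck_of_derivatives)
    (metis Ck_derivatives)

text \<open>Derivatives of curves in V are handled as limits of difference quotients, because a
  quotient can be fed into a slot of a multilinear map that is controlled only on V.\<close>

lemma has_vector_derivative_iff_quotient:
  "(f has_vector_derivative D) (at t) \<longleftrightarrow> ((\<lambda>s. (f s - f t) /\<^sub>R (s - t)) \<longlongrightarrow> D) (at t)"
proof -
  have *: "norm (f s - (f t + (s - t) *\<^sub>R D)) / \<bar>s - t\<bar> = norm ((f s - f t) /\<^sub>R (s - t) - D)"
    if "s \<noteq> t" for s
  proof -
    have "(f s - f t) /\<^sub>R (s - t) - D = (f s - (f t + (s - t) *\<^sub>R D)) /\<^sub>R (s - t)"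
      using that by (simp add: scaleR_diff_right scaleR_add_right)
    then show ?thesis by (simp add: divide_inverse_commute)
  qed
  show ?thesis
    unfolding has_vector_derivative_def has_derivative_within
    apply (subst tendsto_norm_zero_iff[symmetric])
    apply (subst (2) LIM_zero_iff[symmetric])
    apply (subst (2) tendsto_norm_zero_iff[symmetric])
    apply (simp add: bounded_linear_scaleR_left)
    apply (intro filterlim_cong refl)
    using * by (auto simp: eventually_at_filter simp del: scaleR_right_diff_distrib norm_scaleR)
qed

text \<open>The difference quotients lie in V and V is closed. Derivatives of curves in V thus
  remain admissible entries for the multilinear maps.\<close>

lemma has_vector_derivative_in_closed_subspace:
  assumes "subspace V" "closed V" "\<And>t. f t \<in> V" "(f has_vector_derivative D) (at t)"
  shows "D \<in> V"
proof (rule Lim_in_closed_set[OF assms(2)])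
  show "\<forall>\<^sub>F s in at t. (f s - f t) /\<^sub>R (s - t) \<in> V"
    using assms(1,3) by (simp add: subspace_diff subspace_scale)
qed (use assms(4) has_vector_derivative_iff_quotient in auto)

section \<open>Multilinear maps along curves\<close>

lemma bounded_multilinear_onD:
  assumes "bounded_multilinear_on V j A" "vs \<in> lists V" "length vs = j" "i < j" "u \<in> V" "w \<in> V"
  shows "A (vs[i := u + w]) = A (vs[i := u]) + A (vs[i := w])"
    "A (vs[i := c *\<^sub>R u]) = c *\<^sub>R A (vs[i := u])"
  using assms unfolding bounded_multilinear_on_def by blast+

lemma bounded_multilinear_on_bound:
  assumes "bounded_multilinear_on V j A"
  obtains C where "0 \<le> C"
    "\<And>vs. vs \<in> lists V \<Longrightarrow> length vs = j \<Longrightarrow> norm (A vs) \<le> C * prod_list (map norm vs)"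
proof -
  obtain C where C: "\<forall>vs\<in>lists V. length vs = j \<longrightarrow> norm (A vs) \<le> C * prod_list (map norm vs)"
    using assms unfolding bounded_multilinear_on_def by blast
  have nn: "0 \<le> prod_list (map norm vs)" for vs :: "'a list"
    by (induction vs) auto
  show ?thesis
  proof (rule that[of "max C 0"])
    fix vs assume "vs \<in> lists V" "length vs = j"
    then have "norm (A vs) \<le> C * prod_list (map norm vs)" using C by blast
    also have "\<dots> \<le> max C 0 * prod_list (map norm vs)"
      by (intro mult_right_mono nn) auto
    finally show "norm (A vs) \<le> max C 0 * prod_list (map norm vs)" .
  qed auto
qed

lemma bounded_multilinear_on_Cons:
  assumes A: "bounded_multilinear_on V (Suc j) A" and v: "v \<in> V"
  shows "bounded_multilinear_on V j (\<lambda>vs. A (v # vs))"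
proof -
  obtain C where C: "0 \<le> C"
    "\<And>vs. vs \<in> lists V \<Longrightarrow> length vs = Suc j \<Longrightarrow> norm (A vs) \<le> C * prod_list (map norm vs)"
    using bounded_multilinear_on_bound[OF A] by blast
  show ?thesis
    unfolding bounded_multilinear_on_def
  proof (intro conjI ballI impI allI)
    fix vs i u w and c :: real assume *: "vs \<in> lists V" "length vs = j" "i < j" "u \<in> V" "w \<in> V"
    then have "v # vs \<in> lists V" using v by auto
    from bounded_multilinear_onD[OF A this, of "Suc i" u w] *
    show "A (v # vs[i := u + w]) = A (v # vs[i := u]) + A (v # vs[i := w])"
      "A (v # vs[i := c *\<^sub>R u]) = c *\<^sub>R A (v # vs[i := u])" by auto
  next
    show "\<exists>C. \<forall>vs\<in>lists V. length vs = j \<longrightarrow> norm (A (v # vs)) \<le> C * prod_list (map norm vs)"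
    proof (intro exI[of _ "C * norm v"] ballI impI)
      fix vs assume "vs \<in> lists V" "length vs = j"
      then show "norm (A (v # vs)) \<le> C * norm v * prod_list (map norm vs)"
        using C(2)[of "v # vs"] v by (auto simp: mult.assoc)
    qed
  qed
qed

lemma bounded_multilinear_on_Cons_linear:
  assumes "bounded_multilinear_on V (Suc j) A" "vs \<in> lists V" "length vs = j" "u \<in> V" "w \<in> V" "subspace V"
  shows "A ((u + w) # vs) = A (u # vs) + A (w # vs)" "A ((c *\<^sub>R u) # vs) = c *\<^sub>R A (u # vs)"
    "A ((u - w) # vs) = A (u # vs) - A (w # vs)"
proof -
  have add: "A ((u + w) # vs) = A (u # vs) + A (w # vs)" if "u \<in> V" "w \<in> V" for u w
    using bounded_multilinear_onD(1)[OF assms(1), of "u # vs" 0 u w] assms that by auto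
  show "A ((u + w) # vs) = A (u # vs) + A (w # vs)" using add assms by auto
  show "A ((c *\<^sub>R u) # vs) = c *\<^sub>R A (u # vs)"
    using bounded_multilinear_onD(2)[OF assms(1), of "u # vs" 0 u u c] assms by auto
  show "A ((u - w) # vs) = A (u # vs) - A (w # vs)"
    using add[of "u - w" w] assms by (auto simp: subspace_diff)
qed

lemma tendsto_prod_list_norm:
  assumes "list_all2 (\<lambda>v w. (v \<longlongrightarrow> w) F) vs ws"
  shows "((\<lambda>t. prod_list (map norm (map (\<lambda>v. v t) vs))) \<longlongrightarrow> prod_list (map norm ws)) F"
  using assms by (induction rule: list_all2_induct) (auto intro!: tendsto_intros)

text \<open>Replacing the first slot by its limit costs a term bounded by a null factor times
  convergent ones; with that slot frozen the map is multilinear in one slot fewer and the induction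
  takes over.\<close>

lemma multilinear_tendsto:
  assumes V: "subspace V"
    and "list_all2 (\<lambda>v w. (v \<longlongrightarrow> w) F) vs ws"
    and "bounded_multilinear_on V (length vs) A"
    and "\<And>v t. v \<in> set vs \<Longrightarrow> v t \<in> V" and "ws \<in> lists V"
  shows "((\<lambda>t. A (map (\<lambda>v. v t) vs)) \<longlongrightarrow> A ws) F"
  using assms(2-)
proof (induction arbitrary: A rule: list_all2_induct)
  case Nil
  then show ?case by simp
next
  case (Cons v vs w ws)
  let ?m = "\<lambda>t. map (\<lambda>v. v t) vs"
  have w: "w \<in> V" "ws \<in> lists V" and v: "\<And>t. v t \<in> V" and vs: "\<And>t. ?m t \<in> lists V"
    using Cons.prems by auto
  have A: "bounded_multilinear_on V (Suc (length vs)) A" using Cons.prems by simp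
  obtain C where C: "0 \<le> C"
    "\<And>vs'. vs' \<in> lists V \<Longrightarrow> length vs' = Suc (length vs) \<Longrightarrow> norm (A vs') \<le> C * prod_list (map norm vs')"
    using bounded_multilinear_on_bound[OF A] by blast
  have "((\<lambda>t. A ((v t - w) # ?m t)) \<longlongrightarrow> 0) F"
  proof (rule Lim_null_comparison)
    show "\<forall>\<^sub>F t in F. norm (A ((v t - w) # ?m t)) \<le> C * (norm (v t - w) * prod_list (map norm (?m t)))"
      using C(2)[of "(v _ - w) # ?m _"] v w vs V by (intro always_eventually) (auto simp: subspace_diff)
    have "((\<lambda>t. C * (norm (v t - w) * prod_list (map norm (?m t)))) \<longlongrightarrow> C * (norm (w - w) * prod_list (map norm ws))) F"
      using Cons.hyps tendsto_prod_list_norm[of F vs ws] by (intro tendsto_intros) auto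
    then show "((\<lambda>t. C * (norm (v t - w) * prod_list (map norm (?m t)))) \<longlongrightarrow> 0) F" by simp
  qed
  moreover have "((\<lambda>t. A (w # ?m t)) \<longlongrightarrow> A (w # ws)) F"
    by (rule Cons.IH[OF bounded_multilinear_on_Cons[OF A w(1)]]) (use Cons.prems in auto)
  ultimately have "((\<lambda>t. A ((v t - w) # ?m t) + A (w # ?m t)) \<longlongrightarrow> 0 + A (w # ws)) F"
    by (rule tendsto_add)
  moreover have "A ((v t - w) # ?m t) + A (w # ?m t) = A (v t # ?m t)" for t
    using bounded_multilinear_on_Cons_linear(3)[OF A vs _ v w(1) V] by simp
  ultimately show ?case by simp
qed

text \<open>Product rule by induction on the slots: the increment splits into one where the first
  slot moves while the others already sit at time s, and one where the first slot is frozen at time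
  t.\<close>

lemma multilinear_has_vector_derivative:
  assumes V: "subspace V"
    and "list_all2 (\<lambda>v w. (v has_vector_derivative w) (at t)) vs ws"
    and "bounded_multilinear_on V (length vs) A"
    and "\<And>v t. v \<in> set vs \<Longrightarrow> v t \<in> V" and "ws \<in> lists V"
  shows "((\<lambda>t. A (map (\<lambda>v. v t) vs)) has_vector_derivative
     (\<Sum>i<length vs. A ((map (\<lambda>v. v t) vs)[i := ws ! i]))) (at t)"
  using assms(2-)
proof (induction arbitrary: A rule: list_all2_induct)
  case Nil
  then show ?case by simp
next
  case (Cons v vs w ws)
  let ?m = "\<lambda>t. map (\<lambda>v. v t) vs"
  have w: "w \<in> V" "ws \<in> lists V" and v: "\<And>t. v t \<in> V" and vs: "\<And>t. ?m t \<in> lists V"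
    using Cons.prems by auto
  have A: "bounded_multilinear_on V (Suc (length vs)) A" using Cons.prems by simp
  have cont: "list_all2 (\<lambda>v w. (v \<longlongrightarrow> w) (at t)) vs (?m t)"
    using Cons.hyps(2)
    by (auto simp: list_all2_conv_all_nth isCont_def[symmetric] intro!: has_vector_derivative_continuous)
  \<comment> \<open>The quotient itself is put into the first slot; at \<open>s = t\<close> it is 0
    because \<open>inverse 0 = 0\<close>, so it lies in V for every s.\<close>
  have "((\<lambda>s. A (map (\<lambda>f. f s) ((\<lambda>s. (v s - v t) /\<^sub>R (s - t)) # vs))) \<longlongrightarrow> A (w # ?m t)) (at t)"
    by (rule multilinear_tendsto[OF V])
      (use Cons v w vs V cont A in \<open>auto simp: has_vector_derivative_iff_quotient[symmetric] subspace_diff subspace_scale\<close>)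
  moreover have "A (map (\<lambda>f. f s) ((\<lambda>s. (v s - v t) /\<^sub>R (s - t)) # vs)) = (A (v s # ?m s) - A (v t # ?m s)) /\<^sub>R (s - t)" for s
    using bounded_multilinear_on_Cons_linear(3)[OF A vs _ v v V]
    bounded_multilinear_on_Cons_linear(2)[OF A vs _ _ _ V, where w = 0 and u = "v s - v t"] v V by (simp add: subspace_diff subspace_0)
  ultimately have "((\<lambda>s. (A (v s # ?m s) - A (v t # ?m s)) /\<^sub>R (s - t)) \<longlongrightarrow> A (w # ?m t)) (at t)"
    by simp
  moreover have "((\<lambda>s. A (v t # ?m s)) has_vector_derivative
     (\<Sum>i<length vs. A (v t # ((?m t)[i := ws ! i])))) (at t)"
    by (rule Cons.IH[OF bounded_multilinear_on_Cons[OF A v]]) (use Cons.prems in auto)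
  ultimately have "((\<lambda>s. (A (v s # ?m s) - A (v t # ?m s)) /\<^sub>R (s - t) + (A (v t # ?m s) - A (v t # ?m t)) /\<^sub>R (s - t))
     \<longlongrightarrow> A (w # ?m t) + (\<Sum>i<length vs. A (v t # ((?m t)[i := ws ! i])))) (at t)"
    unfolding has_vector_derivative_iff_quotient by (intro tendsto_add)
  then show ?case
    unfolding has_vector_derivative_iff_quotient sum.lessThan_Suc_shift length_Cons
    by (simp add: scaleR_add_right[symmetric])
qed


section \<open>Derivative families of a smooth map and their behaviour along curves\<close>

lemma prod_list_norm_nonneg: "0 \<le> prod_list (map norm vs)"
  by (induction vs) auto

text \<open>The conditions on the witness in \<open>smooth_map_on\<close>, detached from the map
  itself. All orders sit in one function on lists, so differentiating in the base point means
  prepending an entry.\<close>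

definition derivative_family ::
    "nat \<Rightarrow> 'a::real_normed_vector set \<Rightarrow> ('a \<Rightarrow> 'a list \<Rightarrow> 'b::real_normed_vector) \<Rightarrow> bool" where
  "derivative_family m V D \<longleftrightarrow>
     (\<forall>x\<in>V. \<forall>j\<le>m. bounded_multilinear_on V j (D x)) \<and>
     (\<forall>x\<in>V. \<forall>j<m. \<forall>\<epsilon>>0. \<exists>\<delta>>0. \<forall>u\<in>V. norm u < \<delta> \<longrightarrow>
        (\<forall>vs\<in>lists V. length vs = j \<longrightarrow>
           norm (D (x + u) vs - D x vs - D x (u # vs)) \<le> \<epsilon> * norm u * prod_list (map norm vs))) \<and>
     (\<forall>x\<in>V. \<forall>\<epsilon>>0. \<exists>\<delta>>0. \<forall>u\<in>V. norm u < \<delta> \<longrightarrow>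
        (\<forall>vs\<in>lists V. length vs = m \<longrightarrow>
           norm (D (x + u) vs - D x vs) \<le> \<epsilon> * prod_list (map norm vs)))"

lemma derivative_familyD:
  assumes "derivative_family m V D" "x \<in> V"
  shows "j \<le> m \<Longrightarrow> bounded_multilinear_on V j (D x)"
    and "j < m \<Longrightarrow> \<epsilon> > 0 \<Longrightarrow> \<exists>\<delta>>0. \<forall>u\<in>V. norm u < \<delta> \<longrightarrow> (\<forall>vs\<in>lists V. length vs = j \<longrightarrow>
      norm (D (x + u) vs - D x vs - D x (u # vs)) \<le> \<epsilon> * norm u * prod_list (map norm vs))"
    and "\<epsilon> > 0 \<Longrightarrow> \<exists>\<delta>>0. \<forall>u\<in>V. norm u < \<delta> \<longrightarrow> (\<forall>vs\<in>lists V. length vs = m \<longrightarrow>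
      norm (D (x + u) vs - D x vs) \<le> \<epsilon> * prod_list (map norm vs))"
  using assms unfolding derivative_family_def by simp_all

text \<open>At the top order this is the last defining condition. Below it, the increment is the
  next derivative, which is bounded, plus a remainder for which tolerance 1 suffices.\<close>

lemma derivative_family_continuous:
  assumes D: "derivative_family m V D"
    and x: "x \<in> V" and r: "r \<le> m" and e: "\<epsilon> > 0"
  shows "\<exists>\<delta>>0. \<forall>u\<in>V. norm u < \<delta> \<longrightarrow>
        (\<forall>vs\<in>lists V. length vs = r \<longrightarrow>
           norm (D (x + u) vs - D x vs) \<le> \<epsilon> * prod_list (map norm vs))"
proof (cases "r = m")
  case True
  then show ?thesis using derivative_familyD(3)[OF D x e] by simp
next
  case False
  then have r: "r < m" using r by simp
  obtain C where C: "0 \<le> C"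
    "\<And>vs. vs \<in> lists V \<Longrightarrow> length vs = Suc r \<Longrightarrow> norm (D x vs) \<le> C * prod_list (map norm vs)"
    using bounded_multilinear_on_bound[OF derivative_familyD(1)[OF D x Suc_leI[OF r]]] by blast
  obtain \<delta> where \<delta>: "\<delta> > 0" "\<And>u vs. u \<in> V \<Longrightarrow> norm u < \<delta> \<Longrightarrow> vs \<in> lists V \<Longrightarrow> length vs = r \<Longrightarrow>
      norm (D (x + u) vs - D x vs - D x (u # vs)) \<le> norm u * prod_list (map norm vs)"
    using derivative_familyD(2)[OF D x r, of 1] by auto
  show ?thesis
  \<comment> \<open>Within radius \<delta> the increment is at most \<open>(1 + C) * norm u\<close>
    times the product of the norms.\<close>
  proof (intro exI[of _ "min \<delta> (\<epsilon> / (1 + C))"] conjI ballI impI)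
    show "0 < min \<delta> (\<epsilon> / (1 + C))" using \<delta> C e by simp
    fix u vs assume u: "u \<in> V" "norm u < min \<delta> (\<epsilon> / (1 + C))" and vs: "vs \<in> lists V" "length vs = r"
    have "norm (D (x + u) vs - D x vs) \<le> norm (D (x + u) vs - D x vs - D x (u # vs)) + norm (D x (u # vs))"
      by (metis diff_add_cancel norm_triangle_ineq)
    also have "\<dots> \<le> norm u * prod_list (map norm vs) + C * (norm u * prod_list (map norm vs))"
      using \<delta>(2)[OF u(1) _ vs] C(2)[of "u # vs"] u vs by (intro add_mono) auto
    also have "\<dots> = ((1 + C) * norm u) * prod_list (map norm vs)" by (simp add: algebra_simps)
    also have "\<dots> \<le> \<epsilon> * prod_list (map norm vs)"
      using u(2) C(1) by (intro mult_right_mono prod_list_norm_nonneg) (auto simp: field_simps)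
    finally show "norm (D (x + u) vs - D x vs) \<le> \<epsilon> * prod_list (map norm vs)" .
  qed
qed

text \<open>Differentiating along a curve lowers j by one and either prepends the entry x' or
  replaces one entry by its derivative. The induction therefore runs over arbitrary lists of curves,
  and \<open>length vs + j\<close> bounds the order of the derivatives it consumes.\<close>

lemma Ck_derivative_along_curves:
  assumes V: "subspace V" "closed V" and D: "derivative_family m V D"
    and "Ck j x" "\<And>t. x t \<in> V" "\<And>v. v \<in> set vs \<Longrightarrow> Ck j v" "\<And>v t. v \<in> set vs \<Longrightarrow> v t \<in> V"
      "length vs + j \<le> m"
  shows "Ck j (\<lambda>t. D (x t) (map (\<lambda>v. v t) vs))"
  using assms(4-)
proof (induction j arbitrary: vs)
  case 0
  let ?m = "\<lambda>t. map (\<lambda>v. v t) vs"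
  have m: "?m t \<in> lists V" for t using 0 by auto
  have "((\<lambda>t. D (x t) (?m t)) \<longlongrightarrow> D (x t0) (?m t0)) (at t0)" for t0
  proof -
    have lim: "list_all2 (\<lambda>v w. (v \<longlongrightarrow> w) (at t0)) vs (?m t0)"
      using 0(3) by (auto simp: list_all2_conv_all_nth isCont_def[symmetric] continuous_on_eq_continuous_at)
    have xlim: "(x \<longlongrightarrow> x t0) (at t0)"
      using 0(1) by (auto simp: isCont_def[symmetric] continuous_on_eq_continuous_at)
    define B where "B = prod_list (map norm (?m t0))"
    have B: "((\<lambda>t. prod_list (map norm (?m t))) \<longlongrightarrow> B) (at t0)" "0 \<le> B"
      unfolding B_def by (rule tendsto_prod_list_norm[OF lim], rule prod_list_norm_nonneg)
    \<comment> \<open>Base point and entries are moved separately. Here only the base point changes,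
      while the product of the norms of the moving entries stays below \<open>B + 1\<close>.\<close>
    have "((\<lambda>t. D (x t) (?m t) - D (x t0) (?m t)) \<longlongrightarrow> 0) (at t0)"
      unfolding tendsto_iff dist_norm diff_zero
    proof (intro allI impI)
      fix e :: real assume e: "e > 0"
      have r: "length vs \<le> m" and e': "e / (2 * (B + 1)) > 0" using 0 e B by auto
      have "\<exists>\<delta>>0. \<forall>u\<in>V. norm u < \<delta> \<longrightarrow> (\<forall>ws\<in>lists V. length ws = length vs \<longrightarrow>
         norm (D (x t0 + u) ws - D (x t0) ws) \<le> e / (2 * (B + 1)) * prod_list (map norm ws))"
        by (rule derivative_family_continuous[OF D 0(2) r e'])
      then obtain \<delta> where \<delta>: "\<delta> > 0" "\<And>u ws. u \<in> V \<Longrightarrow> norm u < \<delta> \<Longrightarrow> ws \<in> lists V \<Longrightarrow> length ws = length vs \<Longrightarrow>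
         norm (D (x t0 + u) ws - D (x t0) ws) \<le> e / (2 * (B + 1)) * prod_list (map norm ws)"
        by blast
      have "\<forall>\<^sub>F t in at t0. dist (x t) (x t0) < \<delta>" using xlim \<delta>(1) by (rule tendstoD)
      moreover have "\<forall>\<^sub>F t in at t0. prod_list (map norm (?m t)) < B + 1"
        using B(1) by (rule order_tendstoD) simp
      ultimately show "\<forall>\<^sub>F t in at t0. norm (D (x t) (?m t) - D (x t0) (?m t)) < e"
      proof eventually_elim
        case (elim t)
        have "norm (D (x t0 + (x t - x t0)) (?m t) - D (x t0) (?m t)) \<le> e / (2 * (B + 1)) * prod_list (map norm (?m t))"
          using elim(1) m V(1) 0(2) by (intro \<delta>(2)) (auto simp: dist_norm subspace_diff)
        also have "\<dots> \<le> e / (2 * (B + 1)) * (B + 1)"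
          using elim(2) e' by (intro mult_left_mono) auto
        also have "\<dots> < e" using e B(2) by (simp add: field_simps add_pos_nonneg)
        finally show ?case by simp
      qed
    qed
    moreover have "((\<lambda>t. D (x t0) (?m t)) \<longlongrightarrow> D (x t0) (?m t0)) (at t0)"
      by (rule multilinear_tendsto[OF V(1) lim derivative_familyD(1)[OF D]]) (use 0 m in auto)
    ultimately have "((\<lambda>t. (D (x t) (?m t) - D (x t0) (?m t)) + D (x t0) (?m t)) \<longlongrightarrow> 0 + D (x t0) (?m t0)) (at t0)"
      by (rule tendsto_add)
    then show ?thesis by simp
  qed
  then show ?case by (simp add: continuous_on_def)
next
  case (Suc j)
  let ?m = "\<lambda>t. map (\<lambda>v. v t) vs"
  have m: "?m t \<in> lists V" for t using Suc.prems by auto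
  obtain x' where x': "\<And>t. (x has_vector_derivative x' t) (at t)" "Ck j x'" using Suc.prems(1) by auto
  have "\<forall>v\<in>set vs. \<exists>v'. (\<forall>t. (v has_vector_derivative v' t) (at t)) \<and> Ck j v'"
    using Suc.prems(3) by auto
  then obtain d where d: "\<And>v t. v \<in> set vs \<Longrightarrow> (v has_vector_derivative d v t) (at t)"
    "\<And>v. v \<in> set vs \<Longrightarrow> Ck j (d v)" by metis
  have x'V: "x' t \<in> V" for t
    using has_vector_derivative_in_closed_subspace[OF V Suc.prems(2) x'(1)] .
  have dV: "d v t \<in> V" if "v \<in> set vs" for v t
    using has_vector_derivative_in_closed_subspace[OF V _ d(1)[OF that]] Suc.prems(4)[OF that] by blast
  have r: "length vs < m" using Suc.prems by simp
  show ?case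
  proof (rule Ck_SucI)
    fix t
    let ?ws = "map (\<lambda>v. d v t) vs"
    have lim: "list_all2 (\<lambda>v w. (v \<longlongrightarrow> w) (at t)) vs (?m t)"
      by (auto simp: list_all2_conv_all_nth isCont_def[symmetric] intro: has_vector_derivative_continuous[OF d(1)])
    define B where "B = prod_list (map norm (?m t))"
    have B: "((\<lambda>s. prod_list (map norm (?m s))) \<longlongrightarrow> B) (at t)" "0 \<le> B"
      unfolding B_def by (rule tendsto_prod_list_norm[OF lim], rule prod_list_norm_nonneg)
    let ?q = "\<lambda>s. (x s - x t) /\<^sub>R (s - t)"
    have q: "(?q \<longlongrightarrow> x' t) (at t)" using x'(1) by (simp add: has_vector_derivative_iff_quotient)
    have xlim: "(x \<longlongrightarrow> x t) (at t)"
      using has_vector_derivative_continuous[OF x'(1)] by (simp add: isCont_def)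
    \<comment> \<open>Frechet remainder divided by \<open>s - t\<close>. The remainder estimate is
      uniform over lists, so moving entries are harmless: the quotient of x and the product of norms
      stay below the two factors of \<open>?K\<close>.\<close>
    have 1: "((\<lambda>s. (D (x s) (?m s) - D (x t) (?m s) - D (x t) ((x s - x t) # ?m s)) /\<^sub>R (s - t)) \<longlongrightarrow> 0) (at t)"
      unfolding tendsto_iff dist_norm diff_zero
    proof (intro allI impI)
      fix e :: real assume e: "e > 0"
      let ?K = "(norm (x' t) + 1) * (B + 1)"
      have K: "?K > 0" using B by (intro mult_pos_pos) (auto intro: add_nonneg_pos)
      have e': "e / (2 * ?K) > 0" using e K by simp
      obtain \<delta> where \<delta>: "\<delta> > 0" "\<And>u ws. u \<in> V \<Longrightarrow> norm u < \<delta> \<Longrightarrow> ws \<in> lists V \<Longrightarrow> length ws = length vs \<Longrightarrow>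
         norm (D (x t + u) ws - D (x t) ws - D (x t) (u # ws)) \<le> e / (2 * ?K) * norm u * prod_list (map norm ws)"
        using derivative_familyD(2)[OF D Suc.prems(2)[of t] r e'] by meson
      have "\<forall>\<^sub>F s in at t. dist (x s) (x t) < \<delta>" using xlim \<delta>(1) by (rule tendstoD)
      moreover have "\<forall>\<^sub>F s in at t. prod_list (map norm (?m s)) < B + 1"
        using B(1) by (rule order_tendstoD) simp
      moreover have "\<forall>\<^sub>F s in at t. norm (?q s) < norm (x' t) + 1"
        using tendsto_norm[OF q] by (rule order_tendstoD) simp
      ultimately show "\<forall>\<^sub>F s in at t. norm ((D (x s) (?m s) - D (x t) (?m s) - D (x t) ((x s - x t) # ?m s)) /\<^sub>R (s - t)) < e"
      proof eventually_elim
        case (elim s)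
        have "norm (D (x t + (x s - x t)) (?m s) - D (x t) (?m s) - D (x t) ((x s - x t) # ?m s))
           \<le> e / (2 * ?K) * norm (x s - x t) * prod_list (map norm (?m s))"
          using elim(1) m V(1) Suc.prems(2) by (intro \<delta>(2)) (auto simp: dist_norm subspace_diff)
        moreover have "x t + (x s - x t) = x s" by simp
        ultimately have "norm ((D (x s) (?m s) - D (x t) (?m s) - D (x t) ((x s - x t) # ?m s)) /\<^sub>R (s - t))
            \<le> inverse \<bar>s - t\<bar> * (e / (2 * ?K) * norm (x s - x t) * prod_list (map norm (?m s)))"
          unfolding norm_scaleR abs_inverse by (intro mult_left_mono) (simp_all only:, simp)
        also have "\<dots> = e / (2 * ?K) * (norm (?q s) * prod_list (map norm (?m s)))"
          by simp
        also have "\<dots> \<le> e / (2 * ?K) * ?K"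
          using elim(2,3) e' B
          by (intro mult_left_mono mult_mono) (auto intro: prod_list_norm_nonneg simp del: map_map)
        also have "\<dots> = e / 2"
          using nonzero_mult_div_cancel_right[OF less_imp_neq[OF K, symmetric], of "e / 2"] by simp
        also have "\<dots> < e" using e by simp
        finally show ?case .
      qed
    qed
    have Mx: "bounded_multilinear_on V (Suc (length vs)) (D (x t))"
      "bounded_multilinear_on V (length vs) (D (x t))"
      using derivative_familyD(1)[OF D Suc.prems(2)] r by auto
    have 2: "((\<lambda>s. D (x t) (map (\<lambda>f. f s) (?q # vs))) \<longlongrightarrow> D (x t) (x' t # ?m t)) (at t)"
      by (rule multilinear_tendsto[OF V(1)])
        (use lim q Mx Suc.prems x'V m V(1) in \<open>auto simp: subspace_diff subspace_scale\<close>)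
    have 2: "((\<lambda>s. D (x t) ((x s - x t) # ?m s) /\<^sub>R (s - t)) \<longlongrightarrow> D (x t) (x' t # ?m t)) (at t)"
      using 2 bounded_multilinear_on_Cons_linear(2)[OF Mx(1) m _ _ _ V(1), where w = 0 and u = "x _ - x t"]
        Suc.prems(2) V(1) by (simp add: subspace_diff subspace_0)
    have 3: "((\<lambda>s. D (x t) (?m s)) has_vector_derivative
       (\<Sum>i<length vs. D (x t) ((?m t)[i := ?ws ! i]))) (at t)"
      by (rule multilinear_has_vector_derivative[OF V(1) _ Mx(2)])
        (use d dV Suc.prems in \<open>auto simp: list_all2_conv_all_nth\<close>)
    from tendsto_add[OF tendsto_add[OF 1 2] 3[unfolded has_vector_derivative_iff_quotient]]
    have "((\<lambda>t. D (x t) (?m t)) has_vector_derivative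
       0 + D (x t) (x' t # ?m t) + (\<Sum>i<length vs. D (x t) ((?m t)[i := ?ws ! i]))) (at t)"
      unfolding has_vector_derivative_iff_quotient
      by (simp add: scaleR_add_right[symmetric])
    moreover have "(?m t)[i := ?ws ! i] = map (\<lambda>v. v t) (vs[i := d (vs ! i)])" if "i < length vs" for i
      using that by (simp add: map_update)
    ultimately show "((\<lambda>t. D (x t) (?m t)) has_vector_derivative
       D (x t) (map (\<lambda>v. v t) (x' # vs)) + (\<Sum>i<length vs. D (x t) (map (\<lambda>v. v t) (vs[i := d (vs ! i)])))) (at t)"
      by simp
  next
    show "Ck j (\<lambda>t. D (x t) (map (\<lambda>v. v t) (x' # vs)) + (\<Sum>i<length vs. D (x t) (map (\<lambda>v. v t) (vs[i := d (vs ! i)]))))"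
    proof (intro Ck_add Ck_sum Suc.IH)
      show "Ck j x" "\<And>t. x t \<in> V" using Suc.prems Ck_SucD by blast+
      show "Ck j x" by fact
      show "Ck j v" if "v \<in> set (x' # vs)" for v
        using that x'(2) Suc.prems(3) by (auto simp del: Ck.simps intro: Ck_SucD)
      show "v t \<in> V" if "v \<in> set (x' # vs)" for v t
        using that x'V Suc.prems(4) by auto
      show "length (x' # vs) + j \<le> m" using Suc.prems by simp
      fix i assume i: "i \<in> {..<length vs}"
      then have "d (vs ! i) \<in> d ` set vs" by auto
      then have s: "set (vs[i := d (vs ! i)]) \<subseteq> set vs \<union> d ` set vs"
        using set_update_subset_insert[of vs i "d (vs ! i)"] by auto
      show "Ck j v" if "v \<in> set (vs[i := d (vs ! i)])" for v
        using that s d(2) Suc.prems(3) Ck_SucD by blast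
      show "v t \<in> V" if "v \<in> set (vs[i := d (vs ! i)])" for v t
        using that s dV Suc.prems(4) by blast
      show "length (vs[i := d (vs ! i)]) + j \<le> m" using Suc.prems by simp
    qed (use Suc.prems in auto)
  qed
qed

section \<open>History segments\<close>

lemma clamp_real: "(h::real) \<ge> 0 \<Longrightarrow> clamp (-h) 0 \<theta> = max (-h) (min 0 \<theta>)"
  by (cases "\<theta> < - h"; cases "\<theta> \<le> 0") (simp_all add: clamp_def)

lemma clamp_bounds: "(h::real) \<ge> 0 \<Longrightarrow> - h \<le> clamp (-h) 0 \<theta>" "(h::real) \<ge> 0 \<Longrightarrow> clamp (-h) 0 \<theta> \<le> 0"
  and clamp_idem: "(h::real) \<ge> 0 \<Longrightarrow> - h \<le> \<theta> \<Longrightarrow> \<theta> \<le> 0 \<Longrightarrow> clamp (-h) 0 \<theta> = \<theta>"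
  by (auto simp: clamp_real)

text \<open>Composition with \<open>clamp\<close> turns continuity on the compact interval into a
  bounded continuous function on the line, so \<open>Bcontfun\<close> is applied inside the domain
  where it is inverse to evaluation.\<close>

lemma apply_Bcontfun_clamp:
  fixes f :: "real \<Rightarrow> 'e::metric_space"
  assumes "continuous_on {-h..0} f"
  shows "apply_bcontfun (Bcontfun (\<lambda>\<theta>. f (clamp (-h) 0 \<theta>))) \<theta> = f (clamp (-h) 0 \<theta>)"
proof -
  have "continuous_on (cbox (-h) 0) f" using assms by simp
  then obtain g :: "real \<Rightarrow>\<^sub>C 'e" where g: "\<And>x. g x = f (clamp (-h) 0 x)"
    using continuous_on_cbox_bcontfunE by metis
  then have "(\<lambda>\<theta>. f (clamp (-h) 0 \<theta>)) = apply_bcontfun g" by auto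
  then have "Bcontfun (\<lambda>\<theta>. f (clamp (-h) 0 \<theta>)) = g" by (metis apply_bcontfun_inverse)
  with g show ?thesis by simp
qed

lemma apply_segment:
  fixes x :: "real \<Rightarrow> 'e::metric_space"
  assumes "continuous_on {t-h..t} x"
  shows "apply_bcontfun (segment h x t) \<theta> = x (t + clamp (-h) 0 \<theta>)"
  unfolding segment_def
  by (rule apply_Bcontfun_clamp[where f = "\<lambda>\<theta>. x (t + \<theta>)"])
    (auto intro!: continuous_on_compose2[OF assms] continuous_intros)

lemma state_space_clamp: "\<phi> \<in> state_space h \<Longrightarrow> apply_bcontfun \<phi> (clamp (-h) 0 \<theta>) = apply_bcontfun \<phi> \<theta>"
  unfolding state_space_def by (metis (mono_tags, lifting) mem_Collect_eq)

lemma clamp_clamp: "(h::real) \<ge> 0 \<Longrightarrow> clamp (-h) 0 (clamp (-h) 0 \<theta>) = clamp (-h) 0 \<theta>"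
  by (simp add: clamp_real)

lemma segment_in_state_space:
  assumes "continuous_on {t-h..t} x" "h \<ge> 0"
  shows "segment h x t \<in> state_space h"
  unfolding state_space_def using assms by (simp add: apply_segment clamp_clamp)

lemma state_space_eqI:
  assumes "\<phi> \<in> state_space h" "\<psi> \<in> state_space h" "h \<ge> 0"
    "\<And>\<theta>. -h \<le> \<theta> \<Longrightarrow> \<theta> \<le> 0 \<Longrightarrow> apply_bcontfun \<phi> \<theta> = apply_bcontfun \<psi> \<theta>"
  shows "\<phi> = \<psi>"
  by (rule bcontfun_eqI) (metis assms clamp_bounds state_space_clamp)

lemma subspace_state_space: "subspace (state_space h :: (real \<Rightarrow>\<^sub>C 'e::real_normed_vector) set)"
  unfolding subspace_def state_space_def by (auto; metis)

lemma closed_state_space: "closed (state_space h :: (real \<Rightarrow>\<^sub>C 'e::real_normed_vector) set)"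
  unfolding closed_sequential_limits
proof (intro allI impI, elim conjE)
  fix f :: "nat \<Rightarrow> real \<Rightarrow>\<^sub>C 'e" and l assume f: "\<forall>n. f n \<in> state_space h" "f \<longlonglongrightarrow> l"
  have lim: "(\<lambda>n. f n \<theta>) \<longlonglongrightarrow> l \<theta>" for \<theta>
    by (rule tendsto_uniform_limitI[OF tendsto_bcontfun_uniform_limit[OF f(2)]]) simp
  have "f n (clamp (-h) 0 \<theta>) = f n \<theta>" for n \<theta> using f(1) state_space_clamp by blast
  then have "l (clamp (-h) 0 \<theta>) = l \<theta>" for \<theta>
    using LIMSEQ_unique[OF lim[of \<theta>]] lim[of "clamp (-h) 0 \<theta>"] by simp
  then show "l \<in> state_space h" by (simp add: state_space_def)
qed

text \<open>Pointwise smoothness becomes smoothness in the supremum norm because y, respectively y',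
  is uniformly continuous on a compact window around [t-h, t]; segments of y' are the derivative,
  which drives the induction.\<close>

lemma Ck_segment:
  fixes y :: "real \<Rightarrow> 'e::real_normed_vector"
  assumes h: "h \<ge> 0"
  shows "Ck j y \<Longrightarrow> Ck j (segment h y)"
proof (induction j arbitrary: y)
  case 0
  then have c: "continuous_on UNIV y" by simp
  have ap: "segment h y t \<theta> = y (t + clamp (-h) 0 \<theta>)" for t \<theta>
    by (intro apply_segment continuous_on_subset[OF c]) auto
  have "isCont (segment h y) t" for t
    unfolding continuous_at_eps_delta
  proof (intro allI impI)
    fix e :: real assume e: "e > 0"
    \<comment> \<open>The margin 1 on both sides of the delay window matches the radius
      \<open>min d 1\<close> used below.\<close>
    have "uniformly_continuous_on {t-h-1..t+1} y"
      by (intro compact_uniformly_continuous continuous_on_subset[OF c]) auto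
    then obtain d where d: "d > 0" "\<And>a b. a \<in> {t-h-1..t+1} \<Longrightarrow> b \<in> {t-h-1..t+1} \<Longrightarrow> dist a b < d \<Longrightarrow> dist (y a) (y b) < e / 2"
      unfolding uniformly_continuous_on_def using half_gt_zero[OF e] by blast
    show "\<exists>d>0. \<forall>x'. dist x' t < d \<longrightarrow> dist (segment h y x') (segment h y t) < e"
    proof (intro exI[of _ "min d 1"] conjI allI impI)
      fix s assume s: "dist s t < min d 1"
      have "dist (segment h y s) (segment h y t) \<le> e / 2"
      proof (rule dist_bound)
        fix \<theta>
        show "dist (segment h y s \<theta>) (segment h y t \<theta>) \<le> e / 2"
          unfolding ap using clamp_bounds[OF h, of \<theta>] s
          by (intro less_imp_le d(2)) (auto simp: dist_real_def)
      qed
      then show "dist (segment h y s) (segment h y t) < e" using e by simp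
    qed (use d in simp)
  qed
  then show ?case by (simp add: continuous_at_imp_continuous_on)
next
  case (Suc j)
  then obtain y' where y': "\<And>t. (y has_vector_derivative y' t) (at t)" "Ck j y'" by auto
  have c: "continuous_on UNIV y" "continuous_on UNIV y'" using Suc.prems y' Ck_continuous by blast+
  have ap: "segment h y t \<theta> = y (t + clamp (-h) 0 \<theta>)" "segment h y' t \<theta> = y' (t + clamp (-h) 0 \<theta>)" for t \<theta>
    by (intro apply_segment continuous_on_subset[OF c(1)] continuous_on_subset[OF c(2)]; auto)+
  have "(segment h y has_vector_derivative segment h y' t) (at t)" for t
    unfolding has_vector_derivative_def has_derivative_at_alt
  proof (intro conjI allI impI)
    show "bounded_linear (\<lambda>x. x *\<^sub>R segment h y' t)" by (rule bounded_linear_scaleR_left)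
    fix e :: real assume e: "e > 0"
    have "uniformly_continuous_on {t-h-1..t+1} y'"
      by (intro compact_uniformly_continuous continuous_on_subset[OF c(2)]) auto
    then obtain d where d: "d > 0" "\<And>a b. a \<in> {t-h-1..t+1} \<Longrightarrow> b \<in> {t-h-1..t+1} \<Longrightarrow> dist a b < d \<Longrightarrow> dist (y' a) (y' b) < e"
      unfolding uniformly_continuous_on_def using e by blast
    show "\<exists>d>0. \<forall>x. norm (x - t) < d \<longrightarrow>
       norm (segment h y x - segment h y t - (x - t) *\<^sub>R segment h y' t) \<le> e * norm (x - t)"
    proof (intro exI[of _ "min d 1"] conjI allI impI)
      fix s assume s: "norm (s - t) < min d 1"
      show "norm (segment h y s - segment h y t - (s - t) *\<^sub>R segment h y' t) \<le> e * norm (s - t)"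
      proof (rule norm_bound)
        fix \<theta>
        let ?c = "clamp (-h) 0 \<theta>"
        have cb: "-h \<le> ?c" "?c \<le> 0" using clamp_bounds[OF h] by auto
        \<comment> \<open>Mean value estimate for y minus its linear part at \<open>t + ?c\<close>;
          the oscillation bound e on y' does not depend on \<theta>.\<close>
        have "norm (y (s + ?c) - y (t + ?c) - ((s + ?c) - (t + ?c)) *\<^sub>R y' (t + ?c)) \<le> norm ((s + ?c) - (t + ?c)) * e"
        proof (rule vector_differentiable_bound_linearization[where S = "closed_segment (t + ?c) (s + ?c)"])
          fix r assume r: "r \<in> closed_segment (t + ?c) (s + ?c)"
          show "(y has_vector_derivative y' r) (at r within closed_segment (t + ?c) (s + ?c))"
            using y'(1) has_vector_derivative_at_within by blast
          have "dist (y' r) (y' (t + ?c)) < e"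
            using r s cb by (intro d(2)) (auto simp: closed_segment_eq_real_ivl dist_real_def split: if_splits)
          then show "norm (y' r - y' (t + ?c)) \<le> e" by (simp add: dist_norm)
        qed auto
        then show "norm ((segment h y s - segment h y t - (s - t) *\<^sub>R segment h y' t) \<theta>) \<le> e * norm (s - t)"
          by (simp add: ap mult.commute)
      qed
    qed (use d in simp)
  qed
  then show ?case using Suc.IH[OF y'(2)] by (intro Ck_SucI)
qed


section \<open>Pointwise operators on the state space\<close>

lemma norm_vector_smult: "norm (c *s (v :: complex^'n)) = cmod c * norm v"
  unfolding norm_vec_def L2_set_def
  by (simp add: norm_mult power_mult_distrib sum_distrib_left[symmetric] real_sqrt_mult)

lemma bounded_linear_vector_smult: "bounded_linear (\<lambda>v::complex^'n. c *s v)"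
  unfolding linear_conv_bounded_linear[symmetric]
  by (rule linearI) (simp_all add: vec_eq_iff algebra_simps)

lemma vector_smult_of_real: "of_real r *s v = r *\<^sub>R (v :: complex^'n)"
  by (simp add: vec_eq_iff) (simp add: scaleR_conv_of_real)

lemma norm_scaleC_bcf_le: "norm (c *\<^sub>C \<phi>) \<le> cmod c * norm \<phi>"
  by (rule norm_bound) (auto simp: apply_scaleC_bcf norm_vector_smult intro!: mult_left_mono norm_bounded)

lemma norm_scaleC_bcf: "norm (c *\<^sub>C \<phi>) = cmod c * norm \<phi>"
proof (cases "c = 0")
  case False
  have "norm (inverse c *\<^sub>C (c *\<^sub>C \<phi>)) \<le> cmod (inverse c) * norm (c *\<^sub>C \<phi>)"
    by (rule norm_scaleC_bcf_le)
  with False have "cmod c * norm \<phi> \<le> norm (c *\<^sub>C \<phi>)" by (simp add: norm_divide field_simps)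
  then show ?thesis using norm_scaleC_bcf_le[of c \<phi>] by simp
qed simp

lemma scaleC_of_real: "of_real r *\<^sub>C \<phi> = r *\<^sub>R \<phi>"
  by (rule bcontfun_eqI) (simp add: apply_scaleC_bcf vector_smult_of_real)

lemma scaleC_scaleR: "c *\<^sub>C (r *\<^sub>R \<phi>) = r *\<^sub>R (c *\<^sub>C \<phi>)"
  unfolding scaleC_of_real[symmetric] by (simp add: mult.commute)

lemma bounded_linear_scaleC: "bounded_linear (\<lambda>\<phi>. c *\<^sub>C \<phi>)"
  by (rule bounded_linear_intro[of _ "cmod c"])
    (auto simp: bcf.scale_right_distrib norm_scaleC_bcf scaleC_scaleR mult.commute)

lemma state_space_scaleC: "\<phi> \<in> state_space h \<Longrightarrow> c *\<^sub>C \<phi> \<in> state_space h"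
  unfolding state_space_def by (simp add: apply_scaleC_bcf)

lemma bcf_subspace_state_space: "bcf.subspace (state_space h)"
  unfolding bcf.subspace_def
  using subspace_state_space[of h] state_space_scaleC by (auto simp: subspace_def)

definition map_bcf :: "('a::real_normed_vector \<Rightarrow> 'b::real_normed_vector) \<Rightarrow> (real \<Rightarrow>\<^sub>C 'a) \<Rightarrow> (real \<Rightarrow>\<^sub>C 'b)" where
  "map_bcf f \<phi> = Bcontfun (\<lambda>\<theta>. f (\<phi> \<theta>))"

lemma apply_map_bcf:
  assumes f: "bounded_linear f"
  shows "map_bcf f \<phi> \<theta> = f (\<phi> \<theta>)"
proof -
  have "(\<lambda>\<theta>. f (apply_bcontfun \<phi> \<theta>)) \<in> bcontfun"
    using bounded_linear.continuous_on[OF f continuous_on_apply_bcontfun]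
      bounded_linear_image[OF bounded_apply_bcontfun[of \<phi>] f]
    by (auto simp: bcontfun_def image_comp)
  then show ?thesis by (simp add: map_bcf_def Bcontfun_inverse)
qed

lemma bounded_linear_map_bcf:
  assumes f: "bounded_linear f"
  shows "bounded_linear (map_bcf f)"
proof (rule bounded_linear_intro[of _ "onorm f"])
  interpret bounded_linear f by fact
  show "map_bcf f (x + y) = map_bcf f x + map_bcf f y" "map_bcf f (r *\<^sub>R x) = r *\<^sub>R map_bcf f x" for x y r
    by (rule bcontfun_eqI; simp add: apply_map_bcf[OF f] add scaleR)+
  show "norm (map_bcf f x) \<le> norm x * onorm f" for x
  proof (rule norm_bound)
    fix \<theta>
    have "norm (f (x \<theta>)) \<le> onorm f * norm (x \<theta>)" by (rule onorm[OF f])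
    also have "\<dots> \<le> onorm f * norm x" by (intro mult_left_mono norm_bounded onorm_pos_le[OF f])
    finally show "norm (map_bcf f x \<theta>) \<le> norm x * onorm f" by (simp add: apply_map_bcf[OF f] mult.commute)
  qed
qed

lemma map_bcf_in_state_space: "bounded_linear f \<Longrightarrow> \<phi> \<in> state_space h \<Longrightarrow> map_bcf f \<phi> \<in> state_space h"
  unfolding state_space_def by (simp add: apply_map_bcf)

section \<open>Real and imaginary parts, complexified operators\<close>

definition Re_vec :: "complex^'n \<Rightarrow> real^'n" where "Re_vec v = (\<chi> j. Re (v $ j))"
definition Im_vec :: "complex^'n \<Rightarrow> real^'n" where "Im_vec v = (\<chi> j. Im (v $ j))"
definition of_real_vec :: "real^'n \<Rightarrow> complex^'n" where "of_real_vec v = (\<chi> j. of_real (v $ j))"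

lemma bounded_linear_Re_vec: "bounded_linear Re_vec"
  and bounded_linear_Im_vec: "bounded_linear Im_vec"
  and bounded_linear_of_real_vec: "bounded_linear of_real_vec"
  unfolding linear_conv_bounded_linear[symmetric] Re_vec_def Im_vec_def of_real_vec_def
  by (rule linearI; simp add: vec_eq_iff; simp add: scaleR_conv_of_real)+

lemma norm_Re_vec_le: "norm (Re_vec v) \<le> norm v"
  and norm_Im_vec_le: "norm (Im_vec v) \<le> norm v"
  and norm_of_real_vec: "norm (of_real_vec u) = norm u"
  unfolding norm_vec_def Re_vec_def Im_vec_def of_real_vec_def
  by (auto intro!: L2_set_mono abs_Re_le_cmod abs_Im_le_cmod)

definition re_bcf :: "(real \<Rightarrow>\<^sub>C (complex^'n)) \<Rightarrow> (real \<Rightarrow>\<^sub>C (real^'n))" where "re_bcf = map_bcf Re_vec"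
definition im_bcf :: "(real \<Rightarrow>\<^sub>C (complex^'n)) \<Rightarrow> (real \<Rightarrow>\<^sub>C (real^'n))" where "im_bcf = map_bcf Im_vec"

lemma apply_re_bcf: "re_bcf \<phi> \<theta> = Re_vec (\<phi> \<theta>)"
  and apply_im_bcf: "im_bcf \<phi> \<theta> = Im_vec (\<phi> \<theta>)"
  by (simp_all add: re_bcf_def im_bcf_def apply_map_bcf bounded_linear_Re_vec bounded_linear_Im_vec)

lemma bounded_linear_re_bcf: "bounded_linear re_bcf"
  and bounded_linear_im_bcf: "bounded_linear im_bcf"
  by (simp_all add: re_bcf_def im_bcf_def bounded_linear_map_bcf bounded_linear_Re_vec bounded_linear_Im_vec)

lemma norm_re_bcf_le: "norm (re_bcf \<phi>) \<le> norm \<phi>"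
  and norm_im_bcf_le: "norm (im_bcf \<phi>) \<le> norm \<phi>"
  by (rule norm_bound; metis apply_re_bcf apply_im_bcf norm_Re_vec_le norm_Im_vec_le norm_bounded order_trans)+

lemma re_bcf_in_state_space: "\<phi> \<in> state_space h \<Longrightarrow> re_bcf \<phi> \<in> state_space h"
  and im_bcf_in_state_space: "\<phi> \<in> state_space h \<Longrightarrow> im_bcf \<phi> \<in> state_space h"
  by (simp_all add: re_bcf_def im_bcf_def map_bcf_in_state_space bounded_linear_Re_vec bounded_linear_Im_vec)

lemma complexify_eq:
  "complexify M \<phi> = of_real_vec (M (re_bcf \<phi>)) + \<i> *s of_real_vec (M (im_bcf \<phi>))"
  by (simp add: complexify_def re_bcf_def im_bcf_def map_bcf_def Re_vec_def Im_vec_def of_real_vec_def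
      vec_eq_iff complex_eq_iff)

lemma re_bcf_scaleC: "re_bcf (c *\<^sub>C \<phi>) = Re c *\<^sub>R re_bcf \<phi> - Im c *\<^sub>R im_bcf \<phi>"
  and im_bcf_scaleC: "im_bcf (c *\<^sub>C \<phi>) = Re c *\<^sub>R im_bcf \<phi> + Im c *\<^sub>R re_bcf \<phi>"
  by (rule bcontfun_eqI; simp add: apply_re_bcf apply_im_bcf apply_scaleC_bcf Re_vec_def Im_vec_def vec_eq_iff)+

lemma complexify_add:
  assumes "linear M"
  shows "complexify M (\<phi> + \<psi>) = complexify M \<phi> + complexify M \<psi>"
  unfolding complexify_eq linear_add[OF bounded_linear.linear[OF bounded_linear_re_bcf]]
    linear_add[OF bounded_linear.linear[OF bounded_linear_im_bcf]] linear_add[OF assms]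
  by (simp add: vec_eq_iff of_real_vec_def algebra_simps)

lemma complexify_scaleC:
  assumes "linear M"
  shows "complexify M (c *\<^sub>C \<phi>) = c *s complexify M \<phi>"
  unfolding complexify_eq re_bcf_scaleC im_bcf_scaleC linear_diff[OF assms] linear_add[OF assms]
    linear_scale[OF assms]
  by (simp add: vec_eq_iff of_real_vec_def complex_eq_iff algebra_simps)

text \<open>Real and imaginary parts are each bounded by the norm of the complex state, and adding
  the two estimates produces the factor 2.\<close>

lemma norm_complexify_le:
  assumes "\<And>\<psi>. \<psi> \<in> state_space h \<Longrightarrow> norm (M \<psi>) \<le> K * norm \<psi>" "0 \<le> K" "\<phi> \<in> state_space h"
  shows "norm (complexify M \<phi>) \<le> 2 * K * norm \<phi>"
proof -
  have "norm (complexify M \<phi>) \<le> norm (M (re_bcf \<phi>)) + norm (M (im_bcf \<phi>))"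
    unfolding complexify_eq
    by (rule order_trans[OF norm_triangle_ineq]) (simp add: norm_vector_smult norm_of_real_vec)
  also have "\<dots> \<le> K * norm \<phi> + K * norm \<phi>"
    by (intro add_mono order_trans[OF assms(1)] mult_left_mono norm_re_bcf_le norm_im_bcf_le
      re_bcf_in_state_space im_bcf_in_state_space assms)
  finally show ?thesis by simp
qed

section \<open>The linearization along a solution\<close>

text \<open>Bootstrapping: if gamma is C^j, so is F along its segments, hence gamma is C^(j+1), up
  to order k+1. The first derivative of F has one order less to spend, so L is C^k along curves. The
  uniform bound comes from periodicity and compactness of one period.\<close>

lemma linearization_along_solution:
  fixes F :: "(real \<Rightarrow>\<^sub>C (real^'n)) \<Rightarrow> real^'n"
  assumes h: "0 < h" and F: "smooth_map_on (k + 1) (state_space h) F"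
    and T: "0 < T" and per: "\<And>t. \<gamma> (t + T) = \<gamma> t"
    and sol: "\<And>t. (\<gamma> has_vector_derivative F (segment h \<gamma> t)) (at t)"
    and L: "\<And>t. (F has_derivative L t) (at (segment h \<gamma> t) within state_space h)"
  shows "\<And>t \<phi>. \<phi> \<in> state_space h \<Longrightarrow> L (t + T) \<phi> = L t \<phi>"
    and "\<And>j x. j \<le> k \<Longrightarrow> Ck j x \<Longrightarrow> (\<And>t. x t \<in> state_space h) \<Longrightarrow> Ck j (\<lambda>t. L t (x t))"
    and "\<exists>K>0. \<forall>t. \<forall>\<phi>\<in>state_space h. norm (L t \<phi>) \<le> K * norm \<phi>"
proof -
  let ?V = "state_space h :: (real \<Rightarrow>\<^sub>C (real^'n)) set"
  note V = subspace_state_space[of h, where 'e = "real^'n"] closed_state_space[of h, where 'e = "real^'n"]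
  have "\<exists>D. (\<forall>x\<in>?V. D x [] = F x) \<and> derivative_family (k + 1) ?V D"
    using F unfolding smooth_map_on_def derivative_family_def .
  then obtain D where D0: "\<And>x. x \<in> ?V \<Longrightarrow> D x [] = F x" and D: "derivative_family (k + 1) ?V D"
    by blast
  note mult = derivative_familyD(1)[OF D] and along = Ck_derivative_along_curves[OF V D]
  define g where "g = segment h \<gamma>"
  have "Ck 0 \<gamma>" using sol by (auto intro!: continuous_at_imp_continuous_on intro: has_vector_derivative_continuous)
  have gV: "g t \<in> ?V" for t
    unfolding g_def using \<open>Ck 0 \<gamma>\<close> h
    by (intro segment_in_state_space) (auto intro: continuous_on_subset[of UNIV])
  have \<gamma>: "Ck j \<gamma>" if "j \<le> k + 1" for j using that
  proof (induction j)
    case 0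
    show ?case by fact
  next
    case (Suc j)
    then have "Ck j \<gamma>" by simp
    \<comment> \<open>The empty list of entries stands for F itself.\<close>
    then have "Ck j (\<lambda>t. D (g t) (map (\<lambda>v. v t) []))"
      unfolding g_def using gV[unfolded g_def] Suc.prems h
      by (intro along Ck_segment) auto
    then have "Ck j (\<lambda>t. F (g t))" using D0[OF gV] by simp
    then show ?case using sol unfolding g_def by (intro Ck_SucI) auto
  qed
  have g: "Ck j g" if "j \<le> k + 1" for j unfolding g_def using \<gamma>[OF that] h by (intro Ck_segment) auto
  \<comment> \<open>Both \<open>L t\<close> and the first-order part of D linearize F at
    \<open>g t\<close> relative to the state space, so they agree there; they are compared on small
    multiples of u.\<close>
  have LD: "L t u = D (g t) [u]" if u: "u \<in> ?V" for t u
  proof -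
    have mult1: "bounded_multilinear_on ?V (Suc 0) (D (g t))" using mult[OF gV, of "Suc 0"] by simp
    have Lin: "linear (L t)" by (rule has_derivative_linear[OF L])
    have le: "norm (L t u - D (g t) [u]) \<le> 2 * e * norm u" if e: "e > 0" for e
    proof -
      obtain d1 where d1: "d1 > 0" "\<And>y. y \<in> ?V \<Longrightarrow> norm (y - g t) < d1 \<Longrightarrow> norm (F y - F (g t) - L t (y - g t)) \<le> e * norm (y - g t)"
        using L[of t] e unfolding has_derivative_within_alt g_def by blast
      obtain d2 where d2: "d2 > 0" "\<And>u. u \<in> ?V \<Longrightarrow> norm u < d2 \<Longrightarrow> norm (D (g t + u) [] - D (g t) [] - D (g t) [u]) \<le> e * norm u"
        using derivative_familyD(2)[OF D gV, of 0 e t] e by auto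
      \<comment> \<open>Scales u below both radii; the summand 1 in the denominator covers u =
        0.\<close>
      define c where "c = min d1 d2 / (2 * (norm u + 1))"
      have c: "c > 0" unfolding c_def using d1 d2 by (intro divide_pos_pos) (auto intro: add_nonneg_pos)
      have "c * norm u < min d1 d2"
      proof -
        have "c * norm u \<le> c * (norm u + 1)" using c by simp
        also have "\<dots> = min d1 d2 / 2"
          unfolding c_def by (simp add: field_simps add_nonneg_eq_0_iff)
        also have "\<dots> < min d1 d2" using d1(1) d2(1) by (simp add: min_def)
        finally show ?thesis .
      qed
      then have small: "norm (c *\<^sub>R u) < d1" "norm (c *\<^sub>R u) < d2" using c by auto
      have cu: "c *\<^sub>R u \<in> ?V" using u V(1) by (simp add: subspace_scale)
      have "norm (F (g t + c *\<^sub>R u) - F (g t) - L t (c *\<^sub>R u)) \<le> e * norm (c *\<^sub>R u)"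
        using d1(2)[of "g t + c *\<^sub>R u"] small gV cu V(1) by (simp add: subspace_add)
      moreover have "norm (F (g t + c *\<^sub>R u) - F (g t) - D (g t) [c *\<^sub>R u]) \<le> e * norm (c *\<^sub>R u)"
        using d2(2)[OF cu small(2)] gV cu V(1) by (simp add: D0 subspace_add)
      ultimately have "norm (L t (c *\<^sub>R u) - D (g t) [c *\<^sub>R u]) \<le> 2 * (e * norm (c *\<^sub>R u))"
        using norm_triangle_ineq4[of "F (g t + c *\<^sub>R u) - F (g t) - D (g t) [c *\<^sub>R u]" "F (g t + c *\<^sub>R u) - F (g t) - L t (c *\<^sub>R u)"]
        by (simp add: algebra_simps)
      moreover have "L t (c *\<^sub>R u) - D (g t) [c *\<^sub>R u] = c *\<^sub>R (L t u - D (g t) [u])"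
        using bounded_multilinear_on_Cons_linear(2)[OF mult1 _ _ u u V(1), of "[]" c] linear_scale[OF Lin]
        by (simp add: scaleR_diff_right)
      ultimately have "norm (c *\<^sub>R (L t u - D (g t) [u])) \<le> 2 * (e * norm (c *\<^sub>R u))"
        by (simp only:)
      then have "c * norm (L t u - D (g t) [u]) \<le> c * (2 * e * norm u)"
        using c by (simp add: mult.left_commute)
      then show ?thesis using c by simp
    qed
    have "norm (L t u - D (g t) [u]) \<le> 0"
    proof (rule field_le_epsilon)
      fix e :: real assume "e > 0"
      define P where "P = norm u + 1"
      have p: "P > 0" "norm u \<le> P" unfolding P_def by (auto intro: add_nonneg_pos)
      then have "norm (L t u - D (g t) [u]) \<le> 2 * (e / 2 / P) * norm u"
        using \<open>e > 0\<close> by (intro le) simp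
      also have "\<dots> = e * (norm u / P)" by simp
      also have "\<dots> \<le> e * 1" using p \<open>e > 0\<close> by (intro mult_left_mono) auto
      finally show "norm (L t u - D (g t) [u]) \<le> 0 + e" by simp
    qed
    then show ?thesis by simp
  qed
  have gT: "g (t + T) = g t" for t
    unfolding g_def segment_def using per by (metis (no_types, opaque_lifting) add.assoc add.commute)
  show per': "L (t + T) \<phi> = L t \<phi>" if "\<phi> \<in> ?V" for t \<phi>
    using LD[OF that] gT by simp
  show "Ck j (\<lambda>t. L t (x t))" if "j \<le> k" "Ck j x" "\<And>t. x t \<in> ?V" for j x
  proof -
    have "Ck j (\<lambda>t. D (g t) (map (\<lambda>v. v t) [x]))"
      using that g gV by (intro along) auto
    then show ?thesis using LD[OF that(3)] by simp
  qed
  \<comment> \<open>A local bound: for s near t, \<open>D (g s)\<close> differs from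
    \<open>D (g t)\<close> by at most 1 on single entries, so the constant at t grows to
    \<open>C + 1\<close>.\<close>
  have "\<exists>\<delta> C. \<delta> > 0 \<and> C > 0 \<and> (\<forall>s. dist t s < \<delta> \<longrightarrow> (\<forall>u\<in>?V. norm (L s u) \<le> C * norm u))" for t
  proof -
    obtain C where C: "0 \<le> C" "\<And>vs. vs \<in> lists ?V \<Longrightarrow> length vs = 1 \<Longrightarrow> norm (D (g t) vs) \<le> C * prod_list (map norm vs)"
      using bounded_multilinear_on_bound[OF mult[OF gV[of t], of 1]] by auto
    have "\<exists>\<delta>>0. \<forall>u\<in>?V. norm u < \<delta> \<longrightarrow> (\<forall>vs\<in>lists ?V. length vs = 1 \<longrightarrow>
         norm (D (g t + u) vs - D (g t) vs) \<le> 1 * prod_list (map norm vs))"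
      by (rule derivative_family_continuous[OF D gV]) auto
    then obtain \<delta> where \<delta>: "\<delta> > 0" "\<And>u vs. u \<in> ?V \<Longrightarrow> norm u < \<delta> \<Longrightarrow> vs \<in> lists ?V \<Longrightarrow> length vs = 1 \<Longrightarrow>
         norm (D (g t + u) vs - D (g t) vs) \<le> prod_list (map norm vs)" by auto
    have "isCont g t" using g[of 0] by (simp add: continuous_on_eq_continuous_at)
    then obtain d where d: "d > 0" "\<And>s. dist s t < d \<Longrightarrow> dist (g s) (g t) < \<delta>"
      using \<delta>(1) unfolding continuous_at_eps_delta by blast
    have "norm (L s u) \<le> (C + 1) * norm u" if "dist t s < d" "u \<in> ?V" for s u
    proof -
      have "norm (D (g t + (g s - g t)) [u] - D (g t) [u]) \<le> norm u"
        using \<delta>(2)[of "g s - g t" "[u]"] that d(2)[of s] gV V(1) by (simp add: dist_commute dist_norm subspace_diff)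
      moreover have "norm (D (g t) [u]) \<le> C * norm u" using C(2)[of "[u]"] that by simp
      moreover have "norm (D (g s) [u]) \<le> norm (D (g s) [u] - D (g t) [u]) + norm (D (g t) [u])"
        by (metis diff_add_cancel norm_triangle_ineq)
      ultimately show ?thesis by (simp add: LD[OF that(2)] algebra_simps)
    qed
    then show ?thesis using d(1) C(1) by (intro exI[of _ d] exI[of _ "C + 1"]) auto
  qed
  then obtain \<delta> C where \<delta>: "\<And>t. \<delta> t > 0" "\<And>t. C t > 0" "\<And>t s u. dist t s < \<delta> t \<Longrightarrow> u \<in> ?V \<Longrightarrow> norm (L s u) \<le> C t * norm u"
    by metis
  obtain B where B: "B \<subseteq> {0..T}" "finite B" "{0..T} \<subseteq> (\<Union>t\<in>B. ball t (\<delta> t))"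
  proof (rule compactE_image[of "{0..T}" "{0..T}" "\<lambda>t. ball t (\<delta> t)"])
    show "{0..T} \<subseteq> (\<Union>t\<in>{0..T}. ball t (\<delta> t))" using \<delta>(1) by force
  qed auto
  \<comment> \<open>The sum over the finite cover dominates every local constant, and the summand 1
    makes it positive.\<close>
  define K where "K = (\<Sum>t\<in>B. C t) + 1"
  have "K > 0" unfolding K_def using \<delta>(2) by (intro add_nonneg_pos sum_nonneg) (auto intro: less_imp_le)
  have K1: "norm (L s u) \<le> K * norm u" if s: "s \<in> {0..T}" and u: "u \<in> ?V" for s u
  proof -
    obtain t where t: "t \<in> B" "dist t s < \<delta> t" using B s by auto
    have "C t \<le> K" unfolding K_def using member_le_sum[OF t(1), of C] \<delta>(2) B(2) by (force intro: less_imp_le)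
    then show ?thesis using \<delta>(3)[OF t(2) u] by (meson mult_right_mono norm_ge_zero order_trans)
  qed
  have shift: "L (t + of_int n * T) u = L t u" if "u \<in> ?V" for t n u
  proof (induction n rule: int_induct[where k = 0])
    case (step1 i)
    then show ?case using per'[OF that, of "t + of_int i * T"] by (simp add: algebra_simps)
  next
    case (step2 i)
    then show ?case using per'[OF that, of "t + of_int (i - 1) * T"] by (simp add: algebra_simps)
  qed simp
  have "norm (L t u) \<le> K * norm u" if u: "u \<in> ?V" for t u
  proof -
    let ?n = "\<lfloor>t / T\<rfloor>"
    have "of_int ?n * T \<le> t" "t \<le> (of_int ?n + 1) * T"
      using T by (simp_all add: pos_le_divide_eq[symmetric] pos_divide_le_eq[symmetric])
    then have "t + of_int (- ?n) * T \<in> {0..T}" by (simp add: algebra_simps)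
    then have "norm (L (t + of_int (- ?n) * T) u) \<le> K * norm u" by (rule K1[OF _ u])
    then show ?thesis unfolding shift[OF u] .
  qed
  with \<open>K > 0\<close> show "\<exists>K>0. \<forall>t. \<forall>\<phi>\<in>?V. norm (L t \<phi>) \<le> K * norm \<phi>" by blast
qed


section \<open>Linear periodic delay equations\<close>

lemma segment_cong:
  assumes "\<And>r. t - h \<le> r \<Longrightarrow> r \<le> t \<Longrightarrow> x r = y r" "h \<ge> 0"
  shows "segment h x t = segment h y t"
proof -
  have "(\<lambda>\<theta>. x (t + clamp (-h) 0 \<theta>)) = (\<lambda>\<theta>. y (t + clamp (-h) 0 \<theta>))"
    using clamp_bounds[OF assms(2)] assms(1) by (auto simp: fun_eq_iff)
  then show ?thesis by (simp add: segment_def)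
qed

lemma segment_shift: "segment h (\<lambda>r. x (r + a)) t = segment h x (t + a)"
  by (simp add: segment_def algebra_simps)

lemma norm_segment_le:
  fixes x :: "real \<Rightarrow> 'e::real_normed_vector"
  assumes "continuous_on {t-h..t} x" "h \<ge> 0" "\<And>r. t - h \<le> r \<Longrightarrow> r \<le> t \<Longrightarrow> norm (x r) \<le> B"
  shows "norm (segment h x t) \<le> B"
  using clamp_bounds[OF assms(2)] assms(3) by (intro norm_bound) (simp add: apply_segment[OF assms(1)])

lemma segment_combine:
  assumes x: "continuous_on {t-h..t} x" and y: "continuous_on {t-h..t} y"
  shows "segment h (\<lambda>r. a *s x r + y r) t = a *\<^sub>C segment h x t + segment h y t"
proof -
  have "continuous_on {t-h..t} (\<lambda>r. a *s x r + y r)"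
    by (intro continuous_intros bounded_linear.continuous_on[OF bounded_linear_vector_smult] x y)
  then show ?thesis
    by (intro bcontfun_eqI) (simp add: apply_segment x y apply_scaleC_bcf)
qed

lemma at_within_atLeast: "s < t \<Longrightarrow> at t within {s..} = at (t::real)"
  by (rule at_within_interior) (auto intro: interiorI[of "{s<..}"])

text \<open>The primitive lives on the whole line, so its two-sided derivatives restrict to the
  one-sided one required at the initial time s.\<close>

lemma continuous_has_antiderivative:
  fixes g :: "real \<Rightarrow> 'e::euclidean_space"
  assumes "continuous_on UNIV g"
  shows "\<exists>G. G s = 0 \<and> (\<forall>t. (G has_vector_derivative g t) (at t))"
proof -
  have "\<exists>F. \<forall>t. -\<infinity> < ereal t \<longrightarrow> ereal t < \<infinity> \<longrightarrow> (F has_vector_derivative g t) (at t)"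
    by (rule einterval_antiderivative) (use assms in \<open>auto simp: continuous_on_eq_continuous_at\<close>)
  then obtain F where F: "\<And>t. (F has_vector_derivative g t) (at t)" by auto
  have "((\<lambda>u. F u - F s) has_vector_derivative g t - 0) (at t)" for t
    by (intro has_vector_derivative_diff F has_vector_derivative_const)
  then show ?thesis by (intro exI[of _ "\<lambda>u. F u - F s"]) simp
qed

text \<open>The exponential rate is twice the bound K, so integration gains a factor 1/2. This makes
  the fixed point map a contraction and lets half of a weighted supremum be absorbed in the growth
  estimate.\<close>

lemma exponential_growth_bound:
  fixes f :: "real \<Rightarrow> 'e::real_normed_vector"
  assumes "s \<le> u" "0 < K" "continuous_on {s..u} f"
    "\<And>r. s < r \<Longrightarrow> r < u \<Longrightarrow> (f has_vector_derivative f' r) (at r)"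
    "\<And>r. s < r \<Longrightarrow> r < u \<Longrightarrow> norm (f' r) \<le> K * (N * exp (2 * K * (r - s)))"
  shows "norm (f u - f s) \<le> N / 2 * exp (2 * K * (u - s)) - N / 2"
proof (cases "s = u")
  case False
  then have "s < u" using assms by simp
  have "norm (f u - f s) \<le> N / 2 * exp (2 * K * (u - s)) - N / 2 * exp (2 * K * (s - s))"
  proof (rule differentiable_bound_general[OF \<open>s < u\<close> assms(3) _ assms(4) _ assms(5)])
    show "continuous_on {s..u} (\<lambda>r. N / 2 * exp (2 * K * (r - s)))" by (intro continuous_intros)
    show "((\<lambda>r. N / 2 * exp (2 * K * (r - s))) has_vector_derivative K * (N * exp (2 * K * (r - s)))) (at r)" for r
      unfolding has_real_derivative_iff_has_vector_derivative[symmetric]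
      by (auto intro!: derivative_eq_intros)
  qed
  then show ?thesis by simp
qed simp

text \<open>What the Floquet argument takes from the linearization, separated from F and gamma. K
  bounds the complexified operators, and smoothness is stated along curves in the state space
  because no operator norm on the ambient type is available there.\<close>

locale periodic_DDE =
  fixes h T K :: real and k :: nat and L :: "real \<Rightarrow> (real \<Rightarrow>\<^sub>C (real^'n)) \<Rightarrow> real^'n"
  assumes h_pos: "0 < h" and T_pos: "0 < T" and K_pos: "0 < K"
    and linear_L: "linear (L t)"
    and L_bound: "\<phi> \<in> state_space h \<Longrightarrow> norm (complexify (L t) \<phi>) \<le> K * norm \<phi>"
    and L_periodic: "\<phi> \<in> state_space h \<Longrightarrow> complexify (L (t + T)) \<phi> = complexify (L t) \<phi>"
    and L_Ck: "j \<le> k \<Longrightarrow> Ck j x \<Longrightarrow> (\<And>t. x t \<in> state_space h) \<Longrightarrow> Ck j (\<lambda>t. complexify (L t) (x t))"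
begin

abbreviation "Lc t \<equiv> complexify (L t)"
abbreviation "solves \<equiv> solves_linear_DDE h L"
abbreviation "U t s \<equiv> evolution h L t s"

lemmas Lc_add = complexify_add[OF linear_L]
lemmas Lc_scaleC = complexify_scaleC[OF linear_L]

lemma Lc_zero: "Lc t 0 = 0"
  using Lc_scaleC[of t 0 0] by simp

lemma Lc_diff: "Lc t (\<phi> - \<psi>) = Lc t \<phi> - Lc t \<psi>"
  using Lc_add[of t "\<phi> - \<psi>" \<psi>] by simp

lemma Lc_sum: "Lc t (\<Sum>i\<in>I. f i) = (\<Sum>i\<in>I. Lc t (f i))"
  by (induction I rule: infinite_finite_induct) (auto simp: Lc_zero Lc_add)

lemma solvesD:
  assumes "solves s \<phi> y"
  shows "continuous_on {s-h..} y" "-h \<le> \<theta> \<Longrightarrow> \<theta> \<le> 0 \<Longrightarrow> y (s + \<theta>) = \<phi> \<theta>"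
    "s \<le> t \<Longrightarrow> (y has_vector_derivative Lc t (segment h y t)) (at t within {s..})"
    "s \<le> t \<Longrightarrow> continuous_on {t-h..t} y"
  using assms unfolding solves_linear_DDE_def by (auto intro: continuous_on_subset)

lemma solves_combine:
  assumes x: "solves s \<phi> x" and y: "solves s \<psi> y"
  shows "solves s (a *\<^sub>C \<phi> + \<psi>) (\<lambda>t. a *s x t + y t)"
  unfolding solves_linear_DDE_def
proof (intro conjI ballI allI impI)
  show "continuous_on {s-h..} (\<lambda>t. a *s x t + y t)"
    by (intro continuous_intros bounded_linear.continuous_on[OF bounded_linear_vector_smult] solvesD(1)[OF x] solvesD(1)[OF y])
  show "a *s x (s + \<theta>) + y (s + \<theta>) = (a *\<^sub>C \<phi> + \<psi>) \<theta>" if "\<theta> \<in> {-h..0}" for \<theta>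
    using that by (simp add: apply_scaleC_bcf solvesD(2)[OF x] solvesD(2)[OF y])
  show "((\<lambda>t. a *s x t + y t) has_vector_derivative Lc t (segment h (\<lambda>t. a *s x t + y t) t)) (at t within {s..})"
    if "s \<le> t" for t
    unfolding segment_combine[OF solvesD(4)[OF x that] solvesD(4)[OF y that]] Lc_add Lc_scaleC
    by (intro has_vector_derivative_add bounded_linear.has_vector_derivative[OF bounded_linear_vector_smult]
        solvesD(3)[OF x that] solvesD(3)[OF y that])
qed

text \<open>Gronwall through the maximum N of \<open>norm (y r) / E r\<close>. If it is attained
  after s, the integrated equation returns at most half of the weighted value, and this half is
  absorbed.\<close>

lemma solves_growth:
  assumes y: "solves s \<phi> y" and t: "s - h \<le> t"
  shows "norm (y t) \<le> 2 * norm \<phi> * exp (2 * K * max 0 (t - s))"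
proof -
  \<comment> \<open>The weight is 1 on the history interval and monotone, so over a delay window it
    is largest at the right end.\<close>
  define E where "E r = exp (2 * K * max 0 (r - s))" for r
  have E1: "E r \<ge> 1" for r unfolding E_def using K_pos by simp
  have Emono: "E r \<le> E r'" if "r \<le> r'" for r r'
    unfolding E_def using K_pos that by (auto simp: max_def)
  have Es: "E r = exp (2 * K * (r - s))" if "s \<le> r" for r using that by (simp add: E_def max_def)
  define t1 where "t1 = max s t"
  have cont: "continuous_on {s-h..t1} (\<lambda>r. norm (y r) / E r)"
    unfolding E_def by (intro continuous_intros continuous_on_subset[OF solvesD(1)[OF y]]) auto
  obtain r0 where r0: "r0 \<in> {s-h..t1}" "\<And>r. r \<in> {s-h..t1} \<Longrightarrow> norm (y r) / E r \<le> norm (y r0) / E r0"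
  proof -
    have "{s-h..t1} \<noteq> {}" using h_pos t unfolding t1_def by simp
    from continuous_attains_sup[OF compact_Icc this cont] show ?thesis using that by blast
  qed
  define N where "N = norm (y r0) / E r0"
  have yN: "norm (y r) \<le> N * E r" if "s - h \<le> r" "r \<le> t1" for r
    using r0(2)[of r] that E1[of r] unfolding N_def[symmetric] by (simp add: pos_divide_le_eq)
  have N0: "N \<ge> 0" unfolding N_def using E1[of r0] by simp
  have init: "norm (y r) \<le> norm \<phi>" if "s - h \<le> r" "r \<le> s" for r
    using solvesD(2)[OF y, of "r - s"] that norm_bounded[of \<phi> "r - s"] by simp
  have "N \<le> 2 * norm \<phi>"
  proof (cases "r0 \<le> s")
    case True
    then have "N \<le> norm \<phi>" using init[of r0] r0(1) unfolding N_def E_def by simp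
    then show ?thesis using norm_ge_zero[of \<phi>] by linarith
  next
    case False
    have "norm (y r0 - y s) \<le> N / 2 * exp (2 * K * (r0 - s)) - N / 2"
    proof (rule exponential_growth_bound[OF _ K_pos])
      show "s \<le> r0" using False by simp
      show "continuous_on {s..r0} y"
        using h_pos by (intro continuous_on_subset[OF solvesD(1)[OF y]]) auto
      fix r assume r: "s < r" "r < r0"
      show "(y has_vector_derivative Lc r (segment h y r)) (at r)"
        using solvesD(3)[OF y, of r] r at_within_atLeast[of s r] by simp
      have "norm (segment h y r) \<le> N * E r"
      proof (rule norm_segment_le[OF solvesD(4)[OF y]])
        fix r' assume "r - h \<le> r'" "r' \<le> r"
        then show "norm (y r') \<le> N * E r"
          using yN[of r'] r r0(1) mult_left_mono[OF Emono[of r' r] N0] by simp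
      qed (use r h_pos in auto)
      then have "K * norm (segment h y r) \<le> K * (N * E r)" using K_pos by simp
      moreover have "norm (Lc r (segment h y r)) \<le> K * norm (segment h y r)"
        using r h_pos by (intro L_bound segment_in_state_space solvesD(4)[OF y]) auto
      ultimately show "norm (Lc r (segment h y r)) \<le> K * (N * exp (2 * K * (r - s)))"
        using Es[of r] r by simp
    qed
    moreover have "norm (y r0) \<le> norm (y r0 - y s) + norm (y s)"
      by (metis diff_add_cancel norm_triangle_ineq)
    moreover have "norm (y s) \<le> norm \<phi>" using init[of s] h_pos by simp
    moreover have "norm (y r0) = N * exp (2 * K * (r0 - s))"
      using False E1[of r0] Es[of r0] unfolding N_def by simp
    moreover have "N * exp (2 * K * (r0 - s)) \<ge> N * 1"
      using False K_pos N0 by (intro mult_left_mono) auto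
    ultimately show ?thesis using norm_ge_zero[of \<phi>] by linarith
  qed
  then have "N * E t \<le> (2 * norm \<phi>) * E t"
    using E1[of t] by (intro mult_right_mono) auto
  then have "norm (y t) \<le> (2 * norm \<phi>) * E t"
    using yN[of t] t unfolding t1_def by simp
  then show ?thesis by (simp add: E_def)
qed

text \<open>The difference of the solutions has history 0, and the growth estimate is homogeneous in
  the history.\<close>

lemma solves_unique:
  assumes x: "solves s \<phi> x" and y: "solves s \<phi> y" and t: "s - h \<le> t"
  shows "x t = y t"
proof -
  have "solves s ((-1) *\<^sub>C \<phi> + \<phi>) (\<lambda>t. (-1) *s x t + y t)" by (rule solves_combine[OF x y])
  from solves_growth[OF this t] show ?thesis by (simp add: vec_eq_iff)
qed

text \<open>A fixed point argument on all later times at once. The unknown is z = y / E, which makes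
  the bounded continuous functions the complete space and integration of the equation a contraction
  with constant 1/2.\<close>

lemma solves_exists: "\<exists>y. solves s \<phi> y"
proof -
  define E where "E r = exp (2 * K * max 0 (r - s))" for r
  have E1: "E r \<ge> 1" for r unfolding E_def using K_pos by simp
  have Emono: "E r \<le> E r'" if "r \<le> r'" for r r'
    unfolding E_def using K_pos that by (auto simp: max_def)
  have Es: "E r = exp (2 * K * (r - s))" if "s \<le> r" for r using that by (simp add: E_def max_def)
  have Ec: "continuous_on S E" for S unfolding E_def by (intro continuous_intros)
  define Y :: "(real \<Rightarrow>\<^sub>C (complex^'n)) \<Rightarrow> real \<Rightarrow> complex^'n" where "Y z r = E r *\<^sub>R z r" for z r
  have Yc: "continuous_on S (Y z)" for S z unfolding Y_def by (intro continuous_intros Ec) auto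
  have YV: "segment h (Y z) r \<in> state_space h" for z r
    using h_pos by (intro segment_in_state_space Yc) auto
  have Ydiff: "segment h (Y z) r - segment h (Y z') r = segment h (Y (z - z')) r" for z z' r
    by (rule bcontfun_eqI) (simp add: apply_segment[OF Yc], simp add: Y_def scaleR_diff_right)
  define g where "g z r = Lc r (segment h (Y z) r)" for z r
  have "continuous_on UNIV (g z)" for z
    unfolding g_def using L_Ck[of 0 "segment h (Y z)"] Ck_segment[of h 0 "Y z"] YV Yc h_pos by simp
  then have "\<exists>G. G s = 0 \<and> (\<forall>t. (G has_vector_derivative g z t) (at t))" for z
    by (rule continuous_has_antiderivative)
  then obtain G where G: "\<And>z. G z s = 0" "\<And>z t. (G z has_vector_derivative g z t) (at t)" by metis
  have Gc: "continuous_on S (G z)" for S z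
    by (intro continuous_at_imp_continuous_on ballI has_vector_derivative_continuous[OF G(2)])
  have gbound: "norm (g z r) \<le> K * (norm z * exp (2 * K * (r - s)))" if "s \<le> r" for z r
  proof -
    have "norm (segment h (Y z) r) \<le> norm z * E r"
    proof (rule norm_segment_le[OF Yc])
      fix r' assume "r - h \<le> r'" "r' \<le> r"
      then show "norm (Y z r') \<le> norm z * E r"
        unfolding Y_def using Emono[of r' r] E1[of r'] norm_bounded[of z r']
        by (simp add: mult.commute[of "norm z"] mult_mono)
    qed (use h_pos in auto)
    moreover have "norm (g z r) \<le> K * norm (segment h (Y z) r)" unfolding g_def by (rule L_bound[OF YV])
    ultimately show ?thesis using K_pos Es[OF that] by (metis less_imp_le mult_left_mono order_trans)
  qed
  have gdiff: "g z r - g z' r = g (z - z') r" for z z' r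
    unfolding g_def Lc_diff[symmetric] Ydiff ..
  have Gdiff: "norm (G z u - G z' u) \<le> norm (z - z') / 2 * exp (2 * K * (u - s))" if "s \<le> u" for z z' u
  proof -
    have "norm ((G z u - G z' u) - (G z s - G z' s)) \<le> norm (z - z') / 2 * exp (2 * K * (u - s)) - norm (z - z') / 2"
    proof (rule exponential_growth_bound[OF that K_pos])
      show "continuous_on {s..u} (\<lambda>u. G z u - G z' u)" by (intro continuous_intros Gc)
      fix r assume r: "s < r"
      show "((\<lambda>u. G z u - G z' u) has_vector_derivative g (z - z') r) (at r)"
        unfolding gdiff[symmetric] by (intro has_vector_derivative_diff G)
      show "norm (g (z - z') r) \<le> K * (norm (z - z') * exp (2 * K * (r - s)))"
        using r by (intro gbound) simp
    qed
    then have "norm (G z u - G z' u) \<le> norm (z - z') / 2 * exp (2 * K * (u - s)) - norm (z - z') / 2"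
      using G(1) by simp
    then show ?thesis using norm_ge_zero[of "z - z'"] by linarith
  qed
  have g0: "g 0 r = 0" for r using gdiff[of 0 r 0] by simp
  \<comment> \<open>Bounds \<open>R 0\<close>, from which boundedness of every \<open>R z\<close>
    follows by the Lipschitz estimate.\<close>
  have G0: "G 0 u = 0" if "s \<le> u" for u
    using Gdiff[OF that, of 0 0] exponential_growth_bound[OF that K_pos Gc G(2), of 0 0] g0 G(1) by simp
  \<comment> \<open>The clamp freezes the history to the left of \<open>s - h\<close> and at its
    final value after s; \<open>max s t\<close> switches the integral off before s.\<close>
  define R where "R z t = (1 / E t) *\<^sub>R (\<phi> (clamp (-h) 0 (t - s)) + G z (max s t))" for z t
  have Rc: "continuous_on UNIV (R z)" for z
  proof -
    have "continuous_on UNIV (\<lambda>t. \<phi> (clamp (-h) 0 (t - s)))"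
      using h_pos unfolding clamp_real[OF less_imp_le[OF h_pos]]
      by (intro continuous_on_compose2[OF continuous_on_apply_bcontfun[of UNIV \<phi>]] continuous_intros) auto
    moreover have "continuous_on UNIV (\<lambda>t. G z (max s t))"
      by (intro continuous_on_compose2[OF Gc[of UNIV]] continuous_intros) auto
    moreover have "continuous_on UNIV (\<lambda>t. 1 / E t)"
      using E1 by (intro continuous_intros Ec) (metis not_one_le_zero)
    ultimately show ?thesis unfolding R_def by (intro continuous_on_scaleR continuous_on_add)
  qed
  have Rdiff: "norm (R z t - R z' t) \<le> norm (z - z') / 2" for z z' t
  proof -
    have "R z t - R z' t = (1 / E t) *\<^sub>R (G z (max s t) - G z' (max s t))"
      unfolding R_def by (simp add: scaleR_diff_right scaleR_add_right)
    then have "norm (R z t - R z' t) = norm (G z (max s t) - G z' (max s t)) / E t"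
      using E1[of t] by simp
    also have "\<dots> \<le> (norm (z - z') / 2 * E (max s t)) / E t"
      using Gdiff[of "max s t" z z'] E1[of t] Es[of "max s t"] by (intro divide_right_mono) auto
    also have "E (max s t) = E t" unfolding E_def by (simp add: max_def)
    finally show ?thesis using E1[of t] by simp
  qed
  have R0: "norm (R 0 t) \<le> norm \<phi>" for t
  proof -
    have "norm (R 0 t) = norm (\<phi> (clamp (-h) 0 (t - s))) / E t" unfolding R_def using G0 E1[of t] by simp
    also have "\<dots> \<le> norm (\<phi> (clamp (-h) 0 (t - s))) / 1" using E1[of t] by (intro divide_left_mono) auto
    also have "\<dots> \<le> norm \<phi>" by (simp add: norm_bounded)
    finally show ?thesis .
  qed
  have "norm (R z t) \<le> norm z / 2 + norm \<phi>" for z t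
    using Rdiff[of z t 0] R0[of t] norm_triangle_ineq[of "R z t - R 0 t" "R 0 t"] by simp
  then have Rb: "R z \<in> bcontfun" for z by (rule bcontfun_normI[OF Rc])
  define \<Gamma> where "\<Gamma> z = Bcontfun (R z)" for z
  have \<Gamma>: "\<Gamma> z t = R z t" for z t unfolding \<Gamma>_def by (simp add: Bcontfun_inverse[OF Rb])
  have "\<exists>!z. \<Gamma> z = z"
  proof (rule banach_fix_type[of "1/2"])
    show "\<forall>x y. dist (\<Gamma> x) (\<Gamma> y) \<le> 1 / 2 * dist x y"
    proof (intro allI)
      show "dist (\<Gamma> x) (\<Gamma> y) \<le> 1 / 2 * dist x y" for x y
        by (rule dist_bound) (use Rdiff[of x _ y] in \<open>simp add: \<Gamma> dist_norm\<close>)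
    qed
  qed auto
  then obtain z where z: "\<Gamma> z = z" by blast
  have y: "Y z t = \<phi> (clamp (-h) 0 (t - s)) + G z (max s t)" for t
    unfolding Y_def using \<Gamma>[of z t] E1[of t] unfolding z R_def by simp
  have "solves s \<phi> (Y z)"
    unfolding solves_linear_DDE_def
  proof (intro conjI ballI allI impI)
    show "Y z (s + \<theta>) = \<phi> \<theta>" if "\<theta> \<in> {-h..0}" for \<theta>
    proof -
      have "max s (s + \<theta>) = s" using that by simp
      then show ?thesis unfolding y using that h_pos G(1) by (simp add: clamp_idem)
    qed
    fix t assume t: "s \<le> t"
    have "((\<lambda>t. \<phi> 0 + G z t) has_vector_derivative 0 + g z t) (at t within {s..})"
      using G(2) by (intro has_vector_derivative_add has_vector_derivative_const) (rule has_vector_derivative_at_within)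
    then have "((\<lambda>t. \<phi> 0 + G z t) has_vector_derivative Lc t (segment h (Y z) t)) (at t within {s..})"
      by (simp add: g_def)
    then show "(Y z has_vector_derivative Lc t (segment h (Y z) t)) (at t within {s..})"
      by (rule has_vector_derivative_transform[rotated 2])
        (use t h_pos in \<open>auto simp: y clamp_real max_def\<close>)
  qed (rule Yc)
  then show ?thesis by blast
qed

subsection \<open>The evolution family\<close>

text \<open>Uniqueness lets the definite description in \<open>evolution\<close> be evaluated with
  whichever solution is at hand.\<close>

lemma evolution_eq:
  assumes y: "solves s \<phi> y" and t: "s \<le> t"
  shows "U t s \<phi> = segment h y t"
  unfolding evolution_def
proof (rule the_equality)
  show "\<exists>y'. solves s \<phi> y' \<and> segment h y t = segment h y' t" using y by blast
  show "\<psi> = segment h y t" if *: "\<exists>y'. solves s \<phi> y' \<and> \<psi> = segment h y' t" for \<psi>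
  proof -
    from * obtain y' where y': "solves s \<phi> y'" "\<psi> = segment h y' t" by blast
    show ?thesis unfolding y'(2) using h_pos t by (intro segment_cong solves_unique[OF y'(1) y]) auto
  qed
qed

lemma evolution_in_state_space: "s \<le> t \<Longrightarrow> U t s \<phi> \<in> state_space h"
  using solves_exists[of s \<phi>] h_pos by (auto simp: evolution_eq intro!: segment_in_state_space solvesD(4))

lemma evolution_combine:
  assumes t: "s \<le> t"
  shows "U t s (a *\<^sub>C \<phi> + \<psi>) = a *\<^sub>C U t s \<phi> + U t s \<psi>"
proof -
  obtain x y where x: "solves s \<phi> x" and y: "solves s \<psi> y" using solves_exists by meson
  show ?thesis
    unfolding evolution_eq[OF x t] evolution_eq[OF y t] evolution_eq[OF solves_combine[OF x y] t]
    by (rule segment_combine[OF solvesD(4)[OF x t] solvesD(4)[OF y t]])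
qed

lemma evolution_bound:
  assumes t: "s \<le> t"
  shows "norm (U t s \<phi>) \<le> 2 * exp (2 * K * (t - s)) * norm \<phi>"
proof -
  obtain y where y: "solves s \<phi> y" using solves_exists by meson
  show ?thesis unfolding evolution_eq[OF y t]
  proof (rule norm_segment_le[OF solvesD(4)[OF y t]])
    fix r assume r: "t - h \<le> r" "r \<le> t"
    have "norm (y r) \<le> 2 * norm \<phi> * exp (2 * K * max 0 (r - s))"
      using r t by (intro solves_growth[OF y]) simp
    also have "\<dots> \<le> 2 * norm \<phi> * exp (2 * K * (t - s))"
      using r t K_pos by (intro mult_left_mono) auto
    finally show "norm (y r) \<le> 2 * exp (2 * K * (t - s)) * norm \<phi>" by (simp add: mult_ac)
  qed (use h_pos in simp)
qed

lemma solves_restart: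
  assumes y: "solves s \<phi> y" and r: "s \<le> r"
  shows "solves r (segment h y r) y"
  unfolding solves_linear_DDE_def
proof (intro conjI ballI allI impI)
  show "continuous_on {r-h..} y" using r by (intro continuous_on_subset[OF solvesD(1)[OF y]]) auto
  show "y (r + \<theta>) = segment h y r \<theta>" if "\<theta> \<in> {-h..0}" for \<theta>
    using that h_pos by (simp add: apply_segment[OF solvesD(4)[OF y r]] clamp_idem)
  show "(y has_vector_derivative Lc t (segment h y t)) (at t within {r..})" if "r \<le> t" for t
    using that r by (intro has_vector_derivative_within_subset[OF solvesD(3)[OF y]]) auto
qed

lemma evolution_semigroup:
  assumes "s \<le> r" "r \<le> t"
  shows "U t r (U r s \<phi>) = U t s \<phi>"
proof -
  obtain y where y: "solves s \<phi> y" using solves_exists by meson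
  show ?thesis using evolution_eq[OF y] evolution_eq[OF solves_restart[OF y assms(1)] assms(2)] assms by simp
qed

lemma solves_shift:
  assumes y: "solves s \<phi> y"
  shows "solves (s + T) \<phi> (\<lambda>t. y (t - T))"
  unfolding solves_linear_DDE_def
proof (intro conjI ballI allI impI)
  show "continuous_on {s + T - h..} (\<lambda>t. y (t - T))"
    by (intro continuous_on_compose2[OF solvesD(1)[OF y]] continuous_intros) auto
  show "y (s + T + \<theta> - T) = \<phi> \<theta>" if "\<theta> \<in> {-h..0}" for \<theta>
    using that solvesD(2)[OF y, of \<theta>] by simp
  fix t assume t: "s + T \<le> t"
  have eq: "segment h (\<lambda>t. y (t - T)) t = segment h y (t - T)"
    using segment_shift[of h y "-T" t] by simp
  have "segment h y (t - T) \<in> state_space h"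
    using h_pos t by (intro segment_in_state_space solvesD(4)[OF y]) auto
  then have L: "Lc t (segment h y (t - T)) = Lc (t - T) (segment h y (t - T))"
    using L_periodic[of _ "t - T"] by simp
  have "((y \<circ> (\<lambda>t. t - T)) has_vector_derivative 1 *\<^sub>R Lc (t - T) (segment h y (t - T))) (at t within {s + T..})"
  proof (rule vector_diff_chain_within)
    show "((\<lambda>t. t - T) has_vector_derivative 1) (at t within {s + T..})"
      unfolding has_real_derivative_iff_has_vector_derivative[symmetric] by (auto intro!: derivative_eq_intros)
    show "(y has_vector_derivative Lc (t - T) (segment h y (t - T))) (at (t - T) within (\<lambda>t. t - T) ` {s + T..})"
      using t by (intro has_vector_derivative_within_subset[OF solvesD(3)[OF y]]) auto
  qed
  then show "((\<lambda>t. y (t - T)) has_vector_derivative Lc t (segment h (\<lambda>t. y (t - T)) t)) (at t within {s + T..})"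
    unfolding eq L by (simp add: o_def)
qed

lemma evolution_periodic:
  assumes "s \<le> t"
  shows "U (t + T) (s + T) \<phi> = U t s \<phi>"
proof -
  obtain y where y: "solves s \<phi> y" using solves_exists by meson
  have "U (t + T) (s + T) \<phi> = segment h (\<lambda>t. y (t - T)) (t + T)"
    using assms by (intro evolution_eq[OF solves_shift[OF y]]) simp
  also have "\<dots> = U t s \<phi>"
    using segment_shift[of h y "-T" "t + T"] evolution_eq[OF y assms] by simp
  finally show ?thesis .
qed

end


section \<open>Kernels of the powers of an endomorphism\<close>

context vector_space
begin

text \<open>\<open>dim\<close> is a cardinality and would be 0 for an infinite basis. The state
  space is infinite-dimensional, so every dimension count carries a finite spanning set B.\<close>

lemma finite_basis_exists:
  assumes "A \<subseteq> span B" "finite B"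
  obtains C where "C \<subseteq> A" "independent C" "A \<subseteq> span C" "finite C" "card C = dim A"
proof -
  obtain C where C: "C \<subseteq> A" "independent C" "A \<subseteq> span C" "card C = dim A" using basis_exists .
  moreover have "finite C" using independent_span_bound[OF assms(2) C(2)] C(1) assms(1) by blast
  ultimately show ?thesis using that by blast
qed

lemma independent_card_le_dim_finite:
  assumes "A \<subseteq> span B" "finite B" "C \<subseteq> A" "independent C"
  shows "finite C" "card C \<le> dim A"
proof -
  obtain D where D: "D \<subseteq> A" "independent D" "A \<subseteq> span D" "finite D" "card D = dim A"
    using finite_basis_exists[OF assms(1,2)] .
  then show "finite C" "card C \<le> dim A"
    using independent_span_bound[OF D(4) assms(4)] assms(3) by auto
qed

lemma dim_mono_finite:
  assumes "A \<subseteq> A'" "A' \<subseteq> span B" "finite B"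
  shows "dim A \<le> dim A'"
proof -
  obtain C where "C \<subseteq> A" "independent C" "A \<subseteq> span C" "finite C" "card C = dim A"
    by (rule finite_basis_exists[OF order_trans[OF assms(1,2)] assms(3)])
  then show ?thesis using independent_card_le_dim_finite(2)[OF assms(2,3), of C] assms(1) by auto
qed

lemma spans_if_card_ge_dim:
  assumes A: "A \<subseteq> span B" "finite B" and C: "C \<subseteq> A" "independent C" "dim A \<le> card C"
  shows "A \<subseteq> span C"
proof
  fix x assume x: "x \<in> A"
  show "x \<in> span C"
  proof (rule ccontr)
    assume n: "x \<notin> span C"
    then have "independent (insert x C)" using C(2) by (rule independent_insertI)
    then have "card (insert x C) \<le> dim A"
      using x C(1) by (intro independent_card_le_dim_finite[OF A]) auto
    moreover have "x \<notin> C" using n span_base by blast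
    ultimately show False using independent_card_le_dim_finite(1)[OF A C(1,2)] C(3) by simp
  qed
qed

lemma sequence_independent:
  fixes w :: "nat \<Rightarrow> 'b"
  assumes "\<And>i. i < n \<Longrightarrow> w i \<notin> span (w ` {..<i})"
  shows "inj_on w {..<n} \<and> independent (w ` {..<n})"
  using assms
proof (induction n)
  case (Suc n)
  then have IH: "inj_on w {..<n}" "independent (w ` {..<n})" and n: "w n \<notin> span (w ` {..<n})" by auto
  have "independent (insert (w n) (w ` {..<n}))" using n IH(2) by (rule independent_insertI)
  moreover have "w n \<notin> w ` {..<n}" using contrapos_nn[OF n span_base] .
  ultimately show ?case using IH(1) by (simp add: lessThan_Suc)
qed (simp add: independent_empty)

end

locale endomorphism = Vector_Spaces.linear scale scale N
  for scale :: "'a::field \<Rightarrow> 'b::ab_group_add \<Rightarrow> 'b" and N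
begin

definition kernel_pow :: "nat \<Rightarrow> 'b set" where
  "kernel_pow j = {x. (N ^^ j) x = 0}"

lemma kernel_pow_0: "kernel_pow 0 = {0}"
  by (auto simp: kernel_pow_def)

lemma kernel_pow_Suc: "x \<in> kernel_pow (Suc j) \<longleftrightarrow> N x \<in> kernel_pow j"
  by (simp add: kernel_pow_def funpow_swap1)

lemma subspace_kernel_pow: "vs1.subspace (kernel_pow j)"
proof (induction j)
  case 0
  then show ?case by (simp add: kernel_pow_0 vs1.subspace_single_0)
next
  case (Suc j)
  then show ?case
    by (auto simp: vs1.subspace_def kernel_pow_Suc add scale zero)
qed

lemma kernel_pow_Suc_mono: "kernel_pow j \<subseteq> kernel_pow (Suc j)"
  by (induction j) (auto simp: kernel_pow_0 kernel_pow_Suc zero)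

lemma kernel_pow_mono: "i \<le> j \<Longrightarrow> kernel_pow i \<subseteq> kernel_pow j"
  by (rule lift_Suc_mono_le[of kernel_pow]) (rule kernel_pow_Suc_mono)

lemma kernel_pow_stable:
  assumes "kernel_pow (Suc j) = kernel_pow j"
  shows "kernel_pow (j + i) = kernel_pow j"
proof (induction i)
  case (Suc i)
  have "x \<in> kernel_pow (j + Suc i) \<longleftrightarrow> x \<in> kernel_pow j" for x
  proof -
    have "x \<in> kernel_pow (j + Suc i) \<longleftrightarrow> N x \<in> kernel_pow (j + i)" by (simp add: kernel_pow_Suc)
    also have "\<dots> \<longleftrightarrow> x \<in> kernel_pow (Suc j)" by (simp only: Suc.IH kernel_pow_Suc)
    finally show ?thesis using assms by simp
  qed
  then show ?case by blast
qed simp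

text \<open>Rank and nullity in terms of spanning sets: the kernel of N is at most the line through
  v, so v together with preimages of a basis of the image spans.\<close>

lemma kernel_pow_step:
  assumes k1: "kernel_pow (Suc 0) \<subseteq> vs1.span {v}" and B: "kernel_pow j \<subseteq> vs1.span B" "finite B"
  shows "\<exists>B'. finite B' \<and> kernel_pow (Suc j) \<subseteq> vs1.span B' \<and>
    card B' \<le> Suc (vs1.dim (N ` kernel_pow (Suc j)))"
proof -
  have W: "N ` kernel_pow (Suc j) \<subseteq> kernel_pow j" by (auto simp: kernel_pow_Suc)
  obtain C where C: "C \<subseteq> N ` kernel_pow (Suc j)" "vs1.independent C"
    "N ` kernel_pow (Suc j) \<subseteq> vs1.span C" "finite C" "card C = vs1.dim (N ` kernel_pow (Suc j))"
    by (rule vs1.finite_basis_exists[OF order_trans[OF W B(1)] B(2)])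
  have "\<forall>c\<in>C. \<exists>x. x \<in> kernel_pow (Suc j) \<and> N x = c" using C(1) by blast
  then obtain g where g: "\<And>c. c \<in> C \<Longrightarrow> g c \<in> kernel_pow (Suc j)" "\<And>c. c \<in> C \<Longrightarrow> N (g c) = c"
    by metis
  have "x \<in> vs1.span (insert v (g ` C))" if "x \<in> kernel_pow (Suc j)" for x
  proof -
    have "N ` g ` C = C" using g(2) by (simp add: image_image)
    then have "N x \<in> N ` vs1.span (g ` C)"
      using subsetD[OF C(3) imageI[OF that]] span_image[of "g ` C"] by simp
    then obtain u where u: "u \<in> vs1.span (g ` C)" "N x = N u" by blast
    then have "x - u \<in> kernel_pow (Suc 0)" by (simp add: kernel_pow_Suc kernel_pow_0 diff)
    then have "x - u \<in> vs1.span {v}" using k1 by (rule subsetD[rotated])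
    then have "x - u \<in> vs1.span (insert v (g ` C))" by (rule subsetD[OF vs1.span_mono, rotated]) simp
    moreover have "u \<in> vs1.span (insert v (g ` C))" using u(1) by (rule subsetD[OF vs1.span_mono, rotated]) auto
    ultimately have "x - u + u \<in> vs1.span (insert v (g ` C))" by (rule vs1.span_add)
    then show ?thesis by simp
  qed
  then have "kernel_pow (Suc j) \<subseteq> vs1.span (insert v (g ` C))" by (rule subsetI)
  moreover have "card (insert v (g ` C)) \<le> Suc (vs1.dim (N ` kernel_pow (Suc j)))"
    using card_image_le[OF C(4), of g] C(4) unfolding C(5)[symmetric] by (simp add: card_insert_if)
  moreover have "finite (insert v (g ` C))" using C(4) by simp
  ultimately show ?thesis by (intro exI[of _ "insert v (g ` C)"] conjI)
qed

text \<open>Every further power adds at most one dimension, so finite-dimensionality of all these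
  kernels comes from the eigenspace being a line.\<close>

lemma kernel_pow_finite:
  assumes k1: "kernel_pow (Suc 0) \<subseteq> vs1.span {v}"
  shows "\<exists>B. finite B \<and> kernel_pow j \<subseteq> vs1.span B \<and> card B \<le> j"
proof (induction j)
  case 0
  then show ?case by (intro exI[of _ "{}"]) (simp add: kernel_pow_0)
next
  case (Suc j)
  then obtain B where B: "finite B" "kernel_pow j \<subseteq> vs1.span B" "card B \<le> j" by blast
  have "N ` kernel_pow (Suc j) \<subseteq> vs1.span B" using B(2) by (auto simp: kernel_pow_Suc)
  then have "vs1.dim (N ` kernel_pow (Suc j)) \<le> card B" by (rule vs1.dim_le_card[OF _ B(1)])
  then have j: "vs1.dim (N ` kernel_pow (Suc j)) \<le> j" using B(3) by simp
  obtain B' where B': "finite B'" "kernel_pow (Suc j) \<subseteq> vs1.span B'"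
    "card B' \<le> Suc (vs1.dim (N ` kernel_pow (Suc j)))"
    using kernel_pow_step[OF k1 B(2,1)] by blast
  have "card B' \<le> Suc j" using B'(3) j by simp
  with B'(1,2) show ?case by (intro exI[of _ B'] conjI)
qed

lemma dim_kernel_pow_le:
  assumes k1: "kernel_pow (Suc 0) \<subseteq> vs1.span {v}"
  shows "vs1.dim (kernel_pow j) \<le> j"
proof -
  obtain B where B: "finite B" "kernel_pow j \<subseteq> vs1.span B" "card B \<le> j"
    using kernel_pow_finite[OF k1, of j] by blast
  show ?thesis using vs1.dim_le_card[OF B(2,1)] B(3) by simp
qed

text \<open>If y is missed, the image of the larger kernel is a proper subspace of the smaller one,
  and the kernel line of N wins back only one dimension. Read contrapositively: while the dimensions
  grow, N x = y is solvable.\<close>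

lemma dim_kernel_pow_Suc_le:
  assumes k1: "kernel_pow (Suc 0) \<subseteq> vs1.span {v}"
    and y: "y \<in> kernel_pow j" "y \<notin> N ` kernel_pow (Suc j)"
  shows "vs1.dim (kernel_pow (Suc j)) \<le> vs1.dim (kernel_pow j)"
proof -
  let ?W = "N ` kernel_pow (Suc j)"
  obtain B where B: "finite B" "kernel_pow j \<subseteq> vs1.span B"
    using kernel_pow_finite[OF k1, of j] by blast
  have W: "?W \<subseteq> kernel_pow j" by (auto simp: kernel_pow_Suc)
  obtain C where C: "C \<subseteq> ?W" "vs1.independent C" "?W \<subseteq> vs1.span C" "finite C" "card C = vs1.dim ?W"
    by (rule vs1.finite_basis_exists[OF order_trans[OF W B(2)] B(1)])
  have "vs1.subspace ?W" by (rule subspace_image[OF subspace_kernel_pow])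
  then have "vs1.span C \<subseteq> ?W" by (rule vs1.span_minimal[OF C(1)])
  then have n: "y \<notin> vs1.span C" using y(2) by (rule contra_subsetD)
  then have "vs1.independent (insert y C)" using C(2) by (rule vs1.independent_insertI)
  moreover have "insert y C \<subseteq> kernel_pow j" using y(1) C(1) W by blast
  ultimately have "card (insert y C) \<le> vs1.dim (kernel_pow j)"
    by (rule vs1.independent_card_le_dim_finite(2)[OF B(2,1), rotated])
  moreover have "y \<notin> C" using n vs1.span_base[of y C] by blast
  ultimately have "Suc (vs1.dim ?W) \<le> vs1.dim (kernel_pow j)"
    by (simp only: card_insert_disjoint[OF C(4)] C(5) not_False_eq_True)
  moreover have "vs1.dim (kernel_pow (Suc j)) \<le> Suc (vs1.dim ?W)"
  proof -
    obtain B' where B': "finite B'" "kernel_pow (Suc j) \<subseteq> vs1.span B'" "card B' \<le> Suc (vs1.dim ?W)"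
      using kernel_pow_step[OF k1 B(2,1)] by blast
    show ?thesis by (rule order_trans[OF vs1.dim_le_card[OF B'(2,1)] B'(3)])
  qed
  ultimately show ?thesis by (rule order_trans[rotated])
qed

text \<open>A weakened Jordan chain: the monodromy formula expresses N of the i-th vector through
  all its predecessors, not only the last one.\<close>

definition triangular_chain :: "(nat \<Rightarrow> nat \<Rightarrow> 'a) \<Rightarrow> nat \<Rightarrow> (nat \<Rightarrow> 'b) \<Rightarrow> bool" where
  "triangular_chain a n w \<longleftrightarrow> (n > 0 \<longrightarrow> w 0 \<noteq> 0) \<and> (\<forall>i<n. N (w i) = (\<Sum>l<i. scale (a i l) (w l)))"

text \<open>The subdiagonal coefficient decides the level. Modulo \<open>kernel_pow j\<close> with
  \<open>i = Suc j\<close>, N sends \<open>w i\<close> to a nonzero multiple of \<open>w j\<close>,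
  so \<open>w i\<close> being one level too low would force the same for \<open>w j\<close>.\<close>

lemma triangular_chain_kernel:
  assumes a: "\<And>i. a (Suc i) i \<noteq> 0" and w: "triangular_chain a n w" and i: "i < n"
  shows "w i \<in> kernel_pow (Suc i) \<and> w i \<notin> kernel_pow i"
  using i
proof (induction i rule: less_induct)
  case (less i)
  have N: "N (w i) = (\<Sum>l<i. scale (a i l) (w l))" using w less.prems by (simp add: triangular_chain_def)
  have wl: "w l \<in> kernel_pow j" if "l < j" "j \<le> i" for l j
  proof -
    have "w l \<in> kernel_pow (Suc l)" using less.IH[of l] less.prems that by simp
    then show ?thesis using kernel_pow_mono[of "Suc l" j] that by auto
  qed
  have "N (w i) \<in> kernel_pow i"
    unfolding N using wl[of _ i]
    by (intro vs1.subspace_sum[OF subspace_kernel_pow] vs1.subspace_scale[OF subspace_kernel_pow]) auto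
  moreover have "w i \<notin> kernel_pow i"
  proof (cases i)
    case 0
    then show ?thesis using w less.prems by (simp add: triangular_chain_def kernel_pow_0)
  next
    case (Suc j)
    show ?thesis
    proof
      assume "w i \<in> kernel_pow i"
      then have "N (w i) \<in> kernel_pow j" unfolding Suc kernel_pow_Suc by simp
      moreover have "(\<Sum>l<j. scale (a i l) (w l)) \<in> kernel_pow j"
        using wl[of _ j] Suc
        by (intro vs1.subspace_sum[OF subspace_kernel_pow] vs1.subspace_scale[OF subspace_kernel_pow]) auto
      ultimately have "N (w i) - (\<Sum>l<j. scale (a i l) (w l)) \<in> kernel_pow j"
        by (rule vs1.subspace_diff[OF subspace_kernel_pow])
      then have "scale (a i j) (w j) \<in> kernel_pow j"
        unfolding Suc N[unfolded Suc] by simp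
      then have "scale (inverse (a i j)) (scale (a i j) (w j)) \<in> kernel_pow j"
        by (rule vs1.subspace_scale[OF subspace_kernel_pow])
      then have "w j \<in> kernel_pow j" using a[of j] Suc by simp
      then show False using less.IH[of j] less.prems Suc by simp
    qed
  qed
  ultimately show ?case by (simp add: kernel_pow_Suc)
qed

text \<open>Each vector lies outside a kernel that contains the span of all its
  predecessors.\<close>

lemma triangular_chain_independent:
  assumes a: "\<And>i. a (Suc i) i \<noteq> 0" and w: "triangular_chain a n w"
  shows "inj_on w {..<n}" "vs1.independent (w ` {..<n})" "w ` {..<n} \<subseteq> kernel_pow n"
proof -
  note k = triangular_chain_kernel[OF a w]
  have "w i \<notin> vs1.span (w ` {..<i})" if i: "i < n" for i
  proof -
    have "w ` {..<i} \<subseteq> kernel_pow i"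
    proof (rule image_subsetI)
      fix l assume l: "l \<in> {..<i}"
      then have "w l \<in> kernel_pow (Suc l)" using k[of l] i by simp
      then show "w l \<in> kernel_pow i" using kernel_pow_mono[of "Suc l" i] l by auto
    qed
    then have "vs1.span (w ` {..<i}) \<subseteq> kernel_pow i"
      by (rule vs1.span_minimal[OF _ subspace_kernel_pow])
    then show ?thesis using k[OF i] by blast
  qed
  then show "inj_on w {..<n}" "vs1.independent (w ` {..<n})" using vs1.sequence_independent by blast+
  show "w ` {..<n} \<subseteq> kernel_pow n"
  proof (rule image_subsetI)
    fix l assume l: "l \<in> {..<n}"
    then have "w l \<in> kernel_pow (Suc l)" using k[of l] by simp
    then show "w l \<in> kernel_pow n" using kernel_pow_mono[of "Suc l" n] l by auto
  qed
qed

lemma dim_1_span_single: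
  assumes "vs1.dim (kernel_pow (Suc 0)) = 1"
  obtains v where "v \<in> kernel_pow (Suc 0)" "v \<noteq> 0" "kernel_pow (Suc 0) \<subseteq> vs1.span {v}"
proof -
  obtain B where B: "B \<subseteq> kernel_pow (Suc 0)" "vs1.independent B" "kernel_pow (Suc 0) \<subseteq> vs1.span B"
    "card B = vs1.dim (kernel_pow (Suc 0))"
    using vs1.basis_exists .
  then obtain v where "B = {v}" using assms card_1_singletonE by metis
  then show ?thesis using B that[of v] vs1.dependent_single by auto
qed

text \<open>The chain length is the dimension of \<open>kernel_pow p\<close> and at most p, so the
  chain stays inside \<open>kernel_pow p\<close>; independence and counting do the rest.\<close>

lemma triangular_chain_basis:
  assumes k1: "vs1.dim (kernel_pow (Suc 0)) = 1" and a: "\<And>i. a (Suc i) i \<noteq> 0"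
    and w: "triangular_chain a (vs1.dim (kernel_pow p)) w"
  shows "vs1.span (w ` {..<vs1.dim (kernel_pow p)}) = kernel_pow p"
proof -
  let ?m = "vs1.dim (kernel_pow p)"
  obtain v where v: "kernel_pow (Suc 0) \<subseteq> vs1.span {v}" by (rule dim_1_span_single[OF k1])
  note ind = triangular_chain_independent[OF a w]
  have "?m \<le> p" by (rule dim_kernel_pow_le[OF v])
  then have sub: "w ` {..<?m} \<subseteq> kernel_pow p" using ind(3) kernel_pow_mono by blast
  obtain B where B: "finite B" "kernel_pow p \<subseteq> vs1.span B"
    using kernel_pow_finite[OF v, of p] by blast
  show ?thesis
  proof (rule subset_antisym[OF vs1.span_minimal[OF sub subspace_kernel_pow]])
    show "kernel_pow p \<subseteq> vs1.span (w ` {..<?m})"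
      using card_image[OF ind(1)] by (intro vs1.spans_if_card_ge_dim[OF B(2,1) sub ind(2)]) simp
  qed
qed

text \<open>Extending the chain means solving N x = r with r in \<open>kernel_pow n\<close>. Were
  this impossible, the kernels would stop growing at n with dimension at most n, contradicting that
  more than n vectors are still to fit into \<open>kernel_pow p\<close>.\<close>

lemma triangular_chain_exists:
  assumes k1: "vs1.dim (kernel_pow (Suc 0)) = 1" and a: "\<And>i. a (Suc i) i \<noteq> 0"
    and n: "n \<le> vs1.dim (kernel_pow p)"
  shows "\<exists>w. triangular_chain a n w"
  using n
proof (induction n)
  case 0
  then show ?case by (auto simp: triangular_chain_def)
next
  case (Suc n)
  obtain v where v: "v \<in> kernel_pow (Suc 0)" "v \<noteq> 0" "kernel_pow (Suc 0) \<subseteq> vs1.span {v}"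
    by (rule dim_1_span_single[OF k1])
  obtain w where w: "triangular_chain a n w" using Suc by auto
  show ?case
  proof (cases "n = 0")
    case True
    have "N v = 0" using v(1) by (simp add: kernel_pow_Suc kernel_pow_0)
    then show ?thesis using True v(2) by (intro exI[of _ "\<lambda>_. v"]) (auto simp: triangular_chain_def)
  next
    case False
    note ind = triangular_chain_independent[OF a w]
    define r where "r = (\<Sum>l<n. scale (a n l) (w l))"
    have r: "r \<in> kernel_pow n"
      unfolding r_def using ind(3)
      by (intro vs1.subspace_sum[OF subspace_kernel_pow] vs1.subspace_scale[OF subspace_kernel_pow]) auto
    obtain B where B: "finite B" "kernel_pow (Suc n) \<subseteq> vs1.span B"
      using kernel_pow_finite[OF v(3), of "Suc n"] by blast
    have "r \<in> N ` kernel_pow (Suc n)"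
    proof (rule ccontr)
      assume "r \<notin> N ` kernel_pow (Suc n)"
      then have "vs1.dim (kernel_pow (Suc n)) \<le> vs1.dim (kernel_pow n)"
        by (rule dim_kernel_pow_Suc_le[OF v(3) r])
      also have "\<dots> \<le> n" by (rule dim_kernel_pow_le[OF v(3)])
      finally have dimn: "vs1.dim (kernel_pow (Suc n)) \<le> n" .
      have sub: "w ` {..<n} \<subseteq> kernel_pow (Suc n)" using ind(3) kernel_pow_Suc_mono by blast
      \<comment> \<open>The n chain vectors already exhaust the dimension, so
        \<open>kernel_pow (Suc n)\<close> collapses to \<open>kernel_pow n\<close>.\<close>
      have "kernel_pow (Suc n) \<subseteq> vs1.span (w ` {..<n})"
        using card_image[OF ind(1)] dimn by (intro vs1.spans_if_card_ge_dim[OF B(2,1) sub ind(2)]) simp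
      also have "\<dots> \<subseteq> kernel_pow n" by (rule vs1.span_minimal[OF ind(3) subspace_kernel_pow])
      finally have eq: "kernel_pow (Suc n) = kernel_pow n" using kernel_pow_Suc_mono by blast
      have "kernel_pow p \<subseteq> kernel_pow (n + (p - n))" by (rule kernel_pow_mono) simp
      also have "\<dots> = kernel_pow n" by (rule kernel_pow_stable[OF eq])
      also have "\<dots> = kernel_pow (Suc n)" using eq by simp
      finally have "vs1.dim (kernel_pow p) \<le> vs1.dim (kernel_pow (Suc n))"
        by (rule vs1.dim_mono_finite[OF _ B(2,1)])
      then have "vs1.dim (kernel_pow p) \<le> n" using dimn by simp
      then show False using Suc.prems by simp
    qed
    then obtain x where x: "x \<in> kernel_pow (Suc n)" "r = N x" by blast
    have "triangular_chain a (Suc n) (w(n := x))"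
      unfolding triangular_chain_def
    proof (intro conjI allI impI)
      show "(w(n := x)) 0 \<noteq> 0" using w False by (simp add: triangular_chain_def)
      fix i assume i: "i < Suc n"
      have "(\<Sum>l<i. scale (a i l) ((w(n := x)) l)) = (\<Sum>l<i. scale (a i l) (w l))"
        using i by (intro sum.cong) auto
      then show "N ((w(n := x)) i) = (\<Sum>l<i. scale (a i l) ((w(n := x)) l))"
        using i w x(2) unfolding r_def triangular_chain_def by (cases "i = n") auto
    qed
    then show ?thesis by blast
  qed
qed

end

lemma (in vector_space) dim_le_of_injective_image:
  assumes A: "Vector_Spaces.linear scale scale A" and X: "subspace X" and inj: "inj_on A X"
    and Y: "A ` X \<subseteq> Y" "Y \<subseteq> span B" "finite B"
  shows "dim X \<le> dim Y" "\<exists>B'. finite B' \<and> X \<subseteq> span B'"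
proof -
  interpret vector_space_pair scale scale by unfold_locales
  obtain C where C: "C \<subseteq> X" "independent C" "X \<subseteq> span C" "card C = dim X" using basis_exists .
  have "span C \<subseteq> X" using C(1) X by (rule span_minimal)
  then have "inj_on A (span C)" using inj inj_on_subset by blast
  then have "independent (A ` C)" by (rule linear_independent_injective_image[OF A C(2)])
  then have *: "finite (A ` C)" "card (A ` C) \<le> dim Y"
    using independent_card_le_dim_finite[OF Y(2,3), of "A ` C"] C(1) Y(1) by blast+
  moreover have i: "inj_on A C" using inj C(1) inj_on_subset by blast
  ultimately show "dim X \<le> dim Y" using C(4) by (simp add: card_image)
  have "finite C" using * i finite_imageD by blast
  then show "\<exists>B'. finite B' \<and> X \<subseteq> span B'" using C(3) by blast
qed


section \<open>Commuting the factors of a product\<close>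

text \<open>B intertwines mu I - A B with mu I - B A. It is injective on the kernel: B z = 0 gives
  (mu I - A B) z = mu z, so no power annihilates z unless z = 0. This yields one inequality;
  exchanging the roles of A and B yields the other.\<close>

lemma (in vector_space) kernel_pow_swap:
  assumes A: "Vector_Spaces.linear scale scale A" and B: "Vector_Spaces.linear scale scale B"
    and \<mu>: "\<mu> \<noteq> 0"
    and fin: "endomorphism.kernel_pow (\<lambda>x. scale \<mu> x - B (A x)) j \<subseteq> span C" "finite C"
  shows "dim (endomorphism.kernel_pow (\<lambda>x. scale \<mu> x - A (B x)) j) \<le>
    dim (endomorphism.kernel_pow (\<lambda>x. scale \<mu> x - B (A x)) j)"
    "\<exists>C'. finite C' \<and> endomorphism.kernel_pow (\<lambda>x. scale \<mu> x - A (B x)) j \<subseteq> span C'"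
proof -
  interpret A: Vector_Spaces.linear scale scale A by fact
  interpret B: Vector_Spaces.linear scale scale B by fact
  let ?N1 = "\<lambda>x. scale \<mu> x - B (A x)"
  let ?N2 = "\<lambda>x. scale \<mu> x - A (B x)"
  have lin: "Vector_Spaces.linear scale scale ?N1" "Vector_Spaces.linear scale scale ?N2"
    by (auto simp: Vector_Spaces.linear_iff vector_space_axioms A.add A.scale B.add B.scale scale_right_distrib
      scale_right_diff_distrib scale_left_commute)
  interpret N1: endomorphism scale ?N1 using lin(1) by (simp add: endomorphism_def)
  interpret N2: endomorphism scale ?N2 using lin(2) by (simp add: endomorphism_def)
  have inter: "B ((?N2 ^^ i) x) = (?N1 ^^ i) (B x)" for i x
    by (induction i) (simp_all add: B.diff B.scale)
  have maps: "B ` N2.kernel_pow j \<subseteq> N1.kernel_pow j"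
    by (auto simp: N2.kernel_pow_def N1.kernel_pow_def inter[symmetric] B.zero)
  have inj: "inj_on B (N2.kernel_pow j)"
  proof (rule inj_onI)
    fix x y assume xy: "x \<in> N2.kernel_pow j" "y \<in> N2.kernel_pow j" "B x = B y"
    define z where "z = x - y"
    have z: "z \<in> N2.kernel_pow j" "B z = 0"
      unfolding z_def using xy by (auto simp: B.diff intro: subspace_diff[OF N2.subspace_kernel_pow])
    have "(?N2 ^^ i) z = scale (\<mu> ^ i) z \<and> B ((?N2 ^^ i) z) = 0" for i
    proof (induction i)
      case (Suc i)
      then show ?case by (simp add: A.zero B.scale z(2))
    qed (simp add: z)
    then have "scale (\<mu> ^ j) z = 0" using z(1) by (simp add: N2.kernel_pow_def)
    then show "x = y" using \<mu> by (simp add: z_def)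
  qed
  show "dim (N2.kernel_pow j) \<le> dim (N1.kernel_pow j)"
    by (rule dim_le_of_injective_image(1)[OF B N2.subspace_kernel_pow inj maps fin])
  show "\<exists>C'. finite C' \<and> N2.kernel_pow j \<subseteq> span C'"
    by (rule dim_le_of_injective_image(2)[OF B N2.subspace_kernel_pow inj maps fin])
qed

lemma (in vector_space) dim_kernel_pow_swap:
  assumes A: "Vector_Spaces.linear scale scale A" and B: "Vector_Spaces.linear scale scale B"
    and \<mu>: "\<mu> \<noteq> 0"
    and fin: "endomorphism.kernel_pow (\<lambda>x. scale \<mu> x - B (A x)) j \<subseteq> span C" "finite C"
  shows "dim (endomorphism.kernel_pow (\<lambda>x. scale \<mu> x - A (B x)) j) =
    dim (endomorphism.kernel_pow (\<lambda>x. scale \<mu> x - B (A x)) j)"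
proof -
  obtain C' where C': "finite C'" "endomorphism.kernel_pow (\<lambda>x. scale \<mu> x - A (B x)) j \<subseteq> span C'"
    using kernel_pow_swap(2)[OF A B \<mu> fin] by blast
  show ?thesis
    by (rule antisym[OF kernel_pow_swap(1)[OF A B \<mu> fin] kernel_pow_swap(1)[OF B A \<mu> C'(2,1)]])
qed

section \<open>Resolvents and their poles under exchange of the factors\<close>

definition bounded_clinear :: "((real \<Rightarrow>\<^sub>C (complex^'n)) \<Rightarrow> (real \<Rightarrow>\<^sub>C (complex^'n))) \<Rightarrow> bool" where
  "bounded_clinear A \<longleftrightarrow> (\<forall>c \<phi> \<psi>. A (c *\<^sub>C \<phi> + \<psi>) = c *\<^sub>C A \<phi> + A \<psi>) \<and> (\<exists>a. \<forall>\<phi>. norm (A \<phi>) \<le> a * norm \<phi>)"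

lemma bounded_clinear_linear:
  assumes "bounded_clinear A"
  shows "Vector_Spaces.linear scaleC_bcf scaleC_bcf A"
proof -
  have c: "A (c *\<^sub>C \<phi> + \<psi>) = c *\<^sub>C A \<phi> + A \<psi>" for c \<phi> \<psi> using assms by (simp add: bounded_clinear_def)
  have z: "A 0 = 0" using c[of 1 0 0] by simp
  show ?thesis
    unfolding Vector_Spaces.linear_iff using c[of 1] c[of _ _ 0] z by (simp add: bcf.vector_space_axioms)
qed

lemma bounded_clinear_bound:
  assumes "bounded_clinear A"
  obtains a where "0 \<le> a" "\<And>\<phi>. norm (A \<phi>) \<le> a * norm \<phi>"
proof -
  obtain a where a: "\<And>\<phi>. norm (A \<phi>) \<le> a * norm \<phi>" using assms unfolding bounded_clinear_def by blast
  have "norm (A \<phi>) \<le> max a 0 * norm \<phi>" for \<phi>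
    using a[of \<phi>] mult_right_mono[of a "max a 0" "norm \<phi>"] by simp
  then show ?thesis using that[of "max a 0"] by simp
qed

lemma bounded_clinear_bounded_linear:
  assumes "bounded_clinear A"
  shows "bounded_linear A"
proof -
  interpret Vector_Spaces.linear scaleC_bcf scaleC_bcf A by (rule bounded_clinear_linear[OF assms])
  obtain a where a: "0 \<le> a" "\<And>\<phi>. norm (A \<phi>) \<le> a * norm \<phi>" using bounded_clinear_bound[OF assms] by blast
  show ?thesis
    by (rule bounded_linear_intro[of _ a])
      (auto simp: add scale a(2) mult.commute[of "norm _"] scaleC_of_real[symmetric])
qed

lemma in_resolvent_setD:
  assumes "in_resolvent_set V S \<mu>"
  shows "\<psi> \<in> V \<Longrightarrow> resolvent V S \<mu> \<psi> \<in> V"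
    "\<psi> \<in> V \<Longrightarrow> \<mu> *\<^sub>C resolvent V S \<mu> \<psi> - S (resolvent V S \<mu> \<psi>) = \<psi>"
    "\<phi> \<in> V \<Longrightarrow> resolvent V S \<mu> (\<mu> *\<^sub>C \<phi> - S \<phi>) = \<phi>"
    "\<phi> \<in> V \<Longrightarrow> \<mu> *\<^sub>C \<phi> - S \<phi> \<in> V"
    "\<exists>C\<ge>0. \<forall>\<psi>\<in>V. norm (resolvent V S \<mu> \<psi>) \<le> C * norm \<psi>"
proof -
  let ?f = "\<lambda>\<phi>. \<mu> *\<^sub>C \<phi> - S \<phi>"
  have bij: "bij_betw ?f V V" and "\<exists>C. \<forall>\<phi>\<in>V. norm \<phi> \<le> C * norm (?f \<phi>)"
    using assms by (auto simp: in_resolvent_set_def)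
  then obtain C where C: "\<And>\<phi>. \<phi> \<in> V \<Longrightarrow> norm \<phi> \<le> C * norm (?f \<phi>)" by blast
  have img: "?f ` V = V" and inj: "inj_on ?f V" using bij by (auto simp: bij_betw_def)
  show in_V: "resolvent V S \<mu> \<psi> \<in> V" if "\<psi> \<in> V" for \<psi>
    unfolding resolvent_def using that img by (intro inv_into_into) simp
  show eq: "?f (resolvent V S \<mu> \<psi>) = \<psi>" if "\<psi> \<in> V" for \<psi>
    unfolding resolvent_def using f_inv_into_f[of \<psi> ?f V] that img by simp
  show "resolvent V S \<mu> (?f \<phi>) = \<phi>" if "\<phi> \<in> V" for \<phi>
    unfolding resolvent_def by (rule inv_into_f_f[OF inj that])
  show "?f \<phi> \<in> V" if "\<phi> \<in> V" for \<phi> using img that by blast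
  have "norm (resolvent V S \<mu> \<psi>) \<le> max C 0 * norm \<psi>" if "\<psi> \<in> V" for \<psi>
    using C[OF in_V[OF that]] mult_right_mono[of C "max C 0" "norm \<psi>"] by (simp add: eq[OF that])
  then show "\<exists>C\<ge>0. \<forall>\<psi>\<in>V. norm (resolvent V S \<mu> \<psi>) \<le> C * norm \<psi>"
    by (intro exI[of _ "max C 0"]) simp
qed

text \<open>With R the resolvent of B A one has B A R = mu R - I, and multiplying out (mu I - A B)(I
  + A R B) then leaves mu I.\<close>

lemma resolvent_swap:
  assumes A: "bounded_clinear A" and B: "bounded_clinear B" and V: "bcf.subspace V"
    and AV: "\<And>\<phi>. A \<phi> \<in> V" and BV: "\<And>\<phi>. B \<phi> \<in> V" and \<mu>: "\<mu> \<noteq> 0"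
    and r: "in_resolvent_set V (\<lambda>\<phi>. B (A \<phi>)) \<mu>"
  shows "in_resolvent_set V (\<lambda>\<phi>. A (B \<phi>)) \<mu>"
    and "\<psi> \<in> V \<Longrightarrow> resolvent V (\<lambda>\<phi>. A (B \<phi>)) \<mu> \<psi> =
       inverse \<mu> *\<^sub>C (\<psi> + A (resolvent V (\<lambda>\<phi>. B (A \<phi>)) \<mu> (B \<psi>)))"
proof -
  interpret A: Vector_Spaces.linear scaleC_bcf scaleC_bcf A by (rule bounded_clinear_linear[OF A])
  interpret B: Vector_Spaces.linear scaleC_bcf scaleC_bcf B by (rule bounded_clinear_linear[OF B])
  define R where "R = resolvent V (\<lambda>\<phi>. B (A \<phi>)) \<mu>"
  note R = in_resolvent_setD[OF r, folded R_def]
  define R2 where "R2 \<psi> = inverse \<mu> *\<^sub>C (\<psi> + A (R (B \<psi>)))" for \<psi>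
  let ?f = "\<lambda>\<phi>. \<mu> *\<^sub>C \<phi> - A (B \<phi>)"
  have R2V: "R2 \<psi> \<in> V" if "\<psi> \<in> V" for \<psi>
    unfolding R2_def using that V AV by (intro bcf.subspace_scale bcf.subspace_add) auto
  have fV: "?f \<phi> \<in> V" if "\<phi> \<in> V" for \<phi>
    using that V AV by (intro bcf.subspace_diff bcf.subspace_scale) auto
  have right: "?f (R2 \<psi>) = \<psi>" if "\<psi> \<in> V" for \<psi>
  proof -
    have BA: "B (A (R (B \<psi>))) = \<mu> *\<^sub>C R (B \<psi>) - B \<psi>" using R(2)[OF BV[of \<psi>]] by (simp add: algebra_simps)
    have "\<mu> *\<^sub>C R2 \<psi> = \<psi> + A (R (B \<psi>))" unfolding R2_def using \<mu> by simp
    moreover have "A (B (R2 \<psi>)) = A (R (B \<psi>))"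
      unfolding R2_def B.scale B.add A.scale A.add BA A.diff using \<mu> by simp
    ultimately show ?thesis by simp
  qed
  have left: "R2 (?f \<phi>) = \<phi>" if "\<phi> \<in> V" for \<phi>
  proof -
    have "B (?f \<phi>) = \<mu> *\<^sub>C B \<phi> - B (A (B \<phi>))" by (simp add: B.diff B.scale)
    then have "R (B (?f \<phi>)) = B \<phi>" using R(3)[OF BV[of \<phi>]] by simp
    then show ?thesis unfolding R2_def using \<mu> by simp
  qed
  have bij: "bij_betw ?f V V" by (rule bij_betw_byWitness[where f' = R2]) (use left right R2V fV in auto)
  obtain C where C: "C \<ge> 0" "\<And>\<psi>. \<psi> \<in> V \<Longrightarrow> norm (R \<psi>) \<le> C * norm \<psi>" using R(5) by blast
  obtain a where a: "0 \<le> a" "\<And>\<phi>. norm (A \<phi>) \<le> a * norm \<phi>" using bounded_clinear_bound[OF A] by blast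
  obtain b where b: "0 \<le> b" "\<And>\<phi>. norm (B \<phi>) \<le> b * norm \<phi>" using bounded_clinear_bound[OF B] by blast
  have R2b: "norm (R2 \<psi>) \<le> (cmod (inverse \<mu>) * (1 + a * (C * b))) * norm \<psi>" for \<psi>
  proof -
    have "norm (A (R (B \<psi>))) \<le> a * (C * (b * norm \<psi>))"
      by (intro order_trans[OF a(2)] mult_left_mono order_trans[OF C(2)] BV b a C)
    then have "norm (\<psi> + A (R (B \<psi>))) \<le> norm \<psi> + a * (C * (b * norm \<psi>))"
      using norm_triangle_ineq[of \<psi> "A (R (B \<psi>))"] by simp
    then have "norm (R2 \<psi>) \<le> cmod (inverse \<mu>) * (norm \<psi> + a * (C * (b * norm \<psi>)))"
      unfolding R2_def norm_scaleC_bcf by (intro mult_left_mono) auto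
    then show ?thesis by (simp add: algebra_simps)
  qed
  show *: "in_resolvent_set V (\<lambda>\<phi>. A (B \<phi>)) \<mu>"
    unfolding in_resolvent_set_def
  proof (intro conjI exI ballI)
    fix \<phi> assume "\<phi> \<in> V"
    then show "norm \<phi> \<le> (cmod (inverse \<mu>) * (1 + a * (C * b))) * norm (?f \<phi>)"
      using R2b[of "?f \<phi>"] by (simp only: left)
  qed (rule bij)
  show "resolvent V (\<lambda>\<phi>. A (B \<phi>)) \<mu> \<psi> = inverse \<mu> *\<^sub>C (\<psi> + A (resolvent V (\<lambda>\<phi>. B (A \<phi>)) \<mu> (B \<psi>)))"
    if "\<psi> \<in> V"
    using in_resolvent_setD(3)[OF * R2V[OF that]] right[OF that] unfolding R2_def R_def by simp
qed

text \<open>The exchange formula times (mu - lam)^p tends to A Q B / lam, as the summand without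
  resolvent dies for p >= 1. The limit is nonzero: if A Q B = 0, then A Q B A = lam A Q gives A Q =
  0, and B A Q = lam Q gives Q = 0.\<close>

lemma has_resolvent_pole_swap:
  assumes A: "bounded_clinear A" and B: "bounded_clinear B" and V: "bcf.subspace V"
    and AV: "\<And>\<phi>. A \<phi> \<in> V" and BV: "\<And>\<phi>. B \<phi> \<in> V" and lam: "lam \<noteq> 0"
    and pole: "has_resolvent_pole V (\<lambda>\<phi>. B (A \<phi>)) lam p"
  shows "has_resolvent_pole V (\<lambda>\<phi>. A (B \<phi>)) lam p"
proof -
  interpret A: Vector_Spaces.linear scaleC_bcf scaleC_bcf A by (rule bounded_clinear_linear[OF A])
  interpret B: Vector_Spaces.linear scaleC_bcf scaleC_bcf B by (rule bounded_clinear_linear[OF B])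
  let ?S = "\<lambda>\<phi>. B (A \<phi>)"
  let ?R = "resolvent V ?S"
  let ?R2 = "resolvent V (\<lambda>\<phi>. A (B \<phi>))"
  obtain a where a: "0 \<le> a" "\<And>\<phi>. norm (A \<phi>) \<le> a * norm \<phi>" using bounded_clinear_bound[OF A] by blast
  obtain b where b: "0 \<le> b" "\<And>\<phi>. norm (B \<phi>) \<le> b * norm \<phi>" using bounded_clinear_bound[OF B] by blast
  have p: "p \<ge> 1" and ev: "\<forall>\<^sub>F \<mu> in at lam. in_resolvent_set V ?S \<mu>" using pole by (auto simp: has_resolvent_pole_def)
  obtain Q where Q: "\<exists>\<psi>\<in>V. Q \<psi> \<noteq> 0" "\<And>\<epsilon>. \<epsilon> > 0 \<Longrightarrow> \<forall>\<^sub>F \<mu> in at lam. \<forall>\<psi>\<in>V.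
           norm ((\<mu> - lam) ^ p *\<^sub>C ?R \<mu> \<psi> - Q \<psi>) \<le> \<epsilon> * norm \<psi>"
    using pole unfolding has_resolvent_pole_def by blast
  have ev0: "\<forall>\<^sub>F \<mu> in at lam. \<mu> \<noteq> 0"
    using tendsto_imp_eventually_ne[OF tendsto_ident_at lam] .
  have "\<forall>\<^sub>F \<mu> in at lam. in_resolvent_set V ?S \<mu> \<and> (\<forall>\<psi>\<in>V. norm ((\<mu> - lam) ^ p *\<^sub>C ?R \<mu> \<psi> - Q \<psi>) \<le> 1 * norm \<psi>)"
    using ev Q(2)[OF zero_less_one] by eventually_elim simp
  \<comment> \<open>\<open>has_resolvent_pole\<close> states no bound for the limit Q; it is
    obtained by comparison with the resolvent at one fixed \<open>\<mu>0\<close>.\<close>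
  then obtain \<mu>0 where \<mu>0: "in_resolvent_set V ?S \<mu>0" "\<And>\<psi>. \<psi> \<in> V \<Longrightarrow> norm ((\<mu>0 - lam) ^ p *\<^sub>C ?R \<mu>0 \<psi> - Q \<psi>) \<le> norm \<psi>"
    using eventually_happens'[OF at_neq_bot] by fastforce
  obtain C where C: "C \<ge> 0" "\<And>\<psi>. \<psi> \<in> V \<Longrightarrow> norm (?R \<mu>0 \<psi>) \<le> C * norm \<psi>" using in_resolvent_setD(5)[OF \<mu>0(1)] by blast
  define q where "q = cmod ((\<mu>0 - lam) ^ p) * C + 1"
  have q0: "q \<ge> 0" unfolding q_def using C(1) by simp
  have q: "norm (Q \<psi>) \<le> q * norm \<psi>" if "\<psi> \<in> V" for \<psi>
  proof -
    let ?x = "(\<mu>0 - lam) ^ p *\<^sub>C ?R \<mu>0 \<psi>"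
    have "norm (Q \<psi>) \<le> norm ?x + norm (?x - Q \<psi>)"
      using norm_triangle_ineq4[of ?x "?x - Q \<psi>"] by simp
    also have "\<dots> \<le> cmod ((\<mu>0 - lam) ^ p) * (C * norm \<psi>) + norm \<psi>"
      unfolding norm_scaleC_bcf by (intro add_mono mult_left_mono C(2) \<mu>0(2) that) simp
    finally show ?thesis by (simp add: q_def algebra_simps)
  qed
  have lim: "((\<lambda>\<mu>. (\<mu> - lam) ^ p *\<^sub>C ?R \<mu> \<psi>) \<longlongrightarrow> Q \<psi>) (at lam)" if "\<psi> \<in> V" for \<psi>
    unfolding tendsto_iff dist_norm
  proof (intro allI impI)
    fix e :: real assume e: "e > 0"
    define n where "n = norm \<psi> + 1"
    have n: "n > 0" "norm \<psi> < n" unfolding n_def by (auto intro: add_nonneg_pos)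
    have "\<forall>\<^sub>F \<mu> in at lam. \<forall>\<psi>\<in>V. norm ((\<mu> - lam) ^ p *\<^sub>C ?R \<mu> \<psi> - Q \<psi>) \<le> (e / n) * norm \<psi>"
      using e n by (intro Q(2)) simp
    then show "\<forall>\<^sub>F \<mu> in at lam. norm ((\<mu> - lam) ^ p *\<^sub>C ?R \<mu> \<psi> - Q \<psi>) < e"
    proof eventually_elim
      case (elim \<mu>)
      then have "norm ((\<mu> - lam) ^ p *\<^sub>C ?R \<mu> \<psi> - Q \<psi>) \<le> (e / n) * norm \<psi>" using that by blast
      also have "\<dots> < (e / n) * n" using e n by (intro mult_strict_left_mono) auto
      finally show ?case using n by simp
    qed
  qed
  have pow0: "((\<lambda>\<mu>. (\<mu> - lam) ^ p) \<longlongrightarrow> 0) (at lam)"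
  proof -
    have "((\<lambda>\<mu>. (\<mu> - lam) ^ p) \<longlongrightarrow> (lam - lam) ^ p) (at lam)" by (intro tendsto_intros)
    then show ?thesis using p by (simp add: power_0_left)
  qed
  have small: "((\<lambda>\<mu>. (\<mu> - lam) ^ p *\<^sub>C \<psi>) \<longlongrightarrow> 0) (at lam)" for \<psi>
    by (rule tendsto_norm_zero_cancel) (use tendsto_mult_left_zero[OF tendsto_norm_zero[OF pow0], of "norm \<psi>"] in \<open>simp add: norm_scaleC_bcf\<close>)
  have scale_lim: "((\<lambda>\<mu>. \<mu> *\<^sub>C f \<mu>) \<longlongrightarrow> lam *\<^sub>C l) (at lam)"
    if f: "(f \<longlongrightarrow> l) (at lam)" for f :: "complex \<Rightarrow> (real \<Rightarrow>\<^sub>C (complex^'n))" and l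
  proof -
    have "((\<lambda>\<mu>. (\<mu> - lam) *\<^sub>C f \<mu>) \<longlongrightarrow> 0) (at lam)"
    proof (rule tendsto_norm_zero_cancel)
      have "((\<lambda>\<mu>. cmod (\<mu> - lam) * norm (f \<mu>)) \<longlongrightarrow> cmod (lam - lam) * norm l) (at lam)"
        by (intro tendsto_intros f)
      then show "((\<lambda>\<mu>. norm ((\<mu> - lam) *\<^sub>C f \<mu>)) \<longlongrightarrow> 0) (at lam)" by (simp add: norm_scaleC_bcf)
    qed
    moreover have "((\<lambda>\<mu>. lam *\<^sub>C f \<mu>) \<longlongrightarrow> lam *\<^sub>C l) (at lam)"
      by (rule bounded_linear.tendsto[OF bounded_linear_scaleC f])
    ultimately have "((\<lambda>\<mu>. (\<mu> - lam) *\<^sub>C f \<mu> + lam *\<^sub>C f \<mu>) \<longlongrightarrow> 0 + lam *\<^sub>C l) (at lam)" by (rule tendsto_add)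
    then show ?thesis by (simp add: bcf.scale_left_distrib[symmetric])
  qed
  have comm: "(\<mu> - lam) ^ p *\<^sub>C (\<mu> *\<^sub>C \<phi>) = \<mu> *\<^sub>C ((\<mu> - lam) ^ p *\<^sub>C \<phi>)" for \<mu> \<phi> by (simp add: mult.commute)
  \<comment> \<open>Needed for \<open>A Q B\<close>, the leading coefficient of the swapped resolvent up to a factor, to be nonzero.\<close>
  have SQ: "?S (Q \<psi>) = lam *\<^sub>C Q \<psi>" if \<psi>: "\<psi> \<in> V" for \<psi>
  proof -
    let ?x = "\<lambda>\<mu>. (\<mu> - lam) ^ p *\<^sub>C ?R \<mu> \<psi>"
    have "((\<lambda>\<mu>. \<mu> *\<^sub>C ?x \<mu> - ?S (?x \<mu>)) \<longlongrightarrow> lam *\<^sub>C Q \<psi> - ?S (Q \<psi>)) (at lam)"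
      by (intro tendsto_diff scale_lim lim[OF \<psi>] bounded_linear.tendsto[OF bounded_clinear_bounded_linear[OF A]]
        bounded_linear.tendsto[OF bounded_clinear_bounded_linear[OF B]])
    moreover have "\<forall>\<^sub>F \<mu> in at lam. \<mu> *\<^sub>C ?x \<mu> - ?S (?x \<mu>) = (\<mu> - lam) ^ p *\<^sub>C \<psi>"
      using ev
    proof eventually_elim
      case (elim \<mu>)
      have "\<mu> *\<^sub>C ?x \<mu> - ?S (?x \<mu>) = (\<mu> - lam) ^ p *\<^sub>C (\<mu> *\<^sub>C ?R \<mu> \<psi> - ?S (?R \<mu> \<psi>))"
        unfolding A.scale B.scale bcf.scale_right_diff_distrib comm ..
      then show ?case using in_resolvent_setD(2)[OF elim \<psi>] by simp
    qed
    ultimately have "((\<lambda>\<mu>. (\<mu> - lam) ^ p *\<^sub>C \<psi>) \<longlongrightarrow> lam *\<^sub>C Q \<psi> - ?S (Q \<psi>)) (at lam)"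
      by (rule Lim_transform_eventually)
    from tendsto_unique[OF _ this small] show ?thesis by simp
  qed
  \<comment> \<open>The left inverse gives R S psi = mu R psi - psi; multiply by the power and let
    mu tend to \<open>lam\<close>.\<close>
  have QS: "Q (?S \<psi>) = lam *\<^sub>C Q \<psi>" if \<psi>: "\<psi> \<in> V" for \<psi>
  proof -
    have "((\<lambda>\<mu>. \<mu> *\<^sub>C ((\<mu> - lam) ^ p *\<^sub>C ?R \<mu> \<psi>) - (\<mu> - lam) ^ p *\<^sub>C ?R \<mu> (?S \<psi>)) \<longlongrightarrow> lam *\<^sub>C Q \<psi> - Q (?S \<psi>)) (at lam)"
      by (intro tendsto_diff scale_lim lim \<psi> BV)
    moreover have "\<forall>\<^sub>F \<mu> in at lam. \<mu> *\<^sub>C ((\<mu> - lam) ^ p *\<^sub>C ?R \<mu> \<psi>) - (\<mu> - lam) ^ p *\<^sub>C ?R \<mu> (?S \<psi>) = (\<mu> - lam) ^ p *\<^sub>C \<psi>"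
      using ev
    proof eventually_elim
      case (elim \<mu>)
      note R = in_resolvent_setD[OF elim]
      have x: "\<mu> *\<^sub>C ?R \<mu> \<psi> - ?R \<mu> (?S \<psi>) \<in> V"
        using V R(1) \<psi> BV by (intro bcf.subspace_diff bcf.subspace_scale) auto
      have "\<mu> *\<^sub>C (\<mu> *\<^sub>C ?R \<mu> \<psi> - ?R \<mu> (?S \<psi>)) - ?S (\<mu> *\<^sub>C ?R \<mu> \<psi> - ?R \<mu> (?S \<psi>))
         = \<mu> *\<^sub>C (\<mu> *\<^sub>C ?R \<mu> \<psi> - ?S (?R \<mu> \<psi>)) - (\<mu> *\<^sub>C ?R \<mu> (?S \<psi>) - ?S (?R \<mu> (?S \<psi>)))"
        unfolding A.diff B.diff A.scale B.scale bcf.scale_right_diff_distrib by (simp add: algebra_simps)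
      also have "\<dots> = \<mu> *\<^sub>C \<psi> - ?S \<psi>" using R(2)[OF \<psi>] R(2)[OF BV[of "A \<psi>"]] by simp
      finally have "\<mu> *\<^sub>C ?R \<mu> \<psi> - ?R \<mu> (?S \<psi>) = \<psi>" using R(3)[OF x] R(3)[OF \<psi>] by simp
      then have "(\<mu> - lam) ^ p *\<^sub>C (\<mu> *\<^sub>C ?R \<mu> \<psi> - ?R \<mu> (?S \<psi>)) = (\<mu> - lam) ^ p *\<^sub>C \<psi>" by simp
      then show ?case unfolding bcf.scale_right_diff_distrib comm .
    qed
    ultimately have "((\<lambda>\<mu>. (\<mu> - lam) ^ p *\<^sub>C \<psi>) \<longlongrightarrow> lam *\<^sub>C Q \<psi> - Q (?S \<psi>)) (at lam)"
      by (rule Lim_transform_eventually)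
    from tendsto_unique[OF _ this small] show ?thesis by simp
  qed
  define Q2 where "Q2 \<psi> = inverse lam *\<^sub>C A (Q (B \<psi>))" for \<psi>
  have "\<exists>\<psi>\<in>V. Q2 \<psi> \<noteq> 0"
  proof (rule ccontr)
    assume "\<not> (\<exists>\<psi>\<in>V. Q2 \<psi> \<noteq> 0)"
    then have 0: "A (Q (B \<psi>)) = 0" if "\<psi> \<in> V" for \<psi> using that lam by (auto simp: Q2_def)
    have "Q \<psi> = 0" if \<psi>: "\<psi> \<in> V" for \<psi>
    proof -
      have "lam *\<^sub>C A (Q \<psi>) = 0" using 0[OF AV[of \<psi>]] unfolding QS[OF \<psi>] A.scale .
      then have "A (Q \<psi>) = 0" using lam by simp
      then have "lam *\<^sub>C Q \<psi> = 0" using SQ[OF \<psi>] B.zero by simp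
      then show ?thesis using lam by simp
    qed
    then show False using Q(1) by blast
  qed
  moreover have "\<forall>\<^sub>F \<mu> in at lam. in_resolvent_set V (\<lambda>\<phi>. A (B \<phi>)) \<mu>"
    using ev ev0 by eventually_elim (rule resolvent_swap(1)[OF A B V AV BV])
  moreover have "\<forall>\<^sub>F \<mu> in at lam. \<forall>\<psi>\<in>V. norm ((\<mu> - lam) ^ p *\<^sub>C ?R2 \<mu> \<psi> - Q2 \<psi>) \<le> \<epsilon> * norm \<psi>"
    if \<epsilon>: "\<epsilon> > 0" for \<epsilon>
  proof -
    \<comment> \<open>Chosen so that the middle summand of \<open>?g\<close> tends to less than half
      of \<epsilon>.\<close>
    define \<epsilon>1 where "\<epsilon>1 = \<epsilon> * cmod lam / (2 * (a * b + 1))"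
    have ab: "a * b \<ge> 0" using a b by simp
    have \<epsilon>1: "\<epsilon>1 > 0" unfolding \<epsilon>1_def using \<epsilon> lam ab by (intro divide_pos_pos mult_pos_pos) auto
    \<comment> \<open>The three error sources: the vanishing summand without resolvent, the
      replacement of the scaled resolvent by Q, and that of 1/mu by 1/lam.\<close>
    let ?g = "\<lambda>\<mu>. cmod (inverse \<mu>) * cmod ((\<mu> - lam) ^ p) + cmod (inverse \<mu>) * (a * (\<epsilon>1 * b))
       + cmod (inverse \<mu> - inverse lam) * (a * (q * b))"
    have "(?g \<longlongrightarrow> cmod (inverse lam) * cmod 0 + cmod (inverse lam) * (a * (\<epsilon>1 * b))
       + cmod (inverse lam - inverse lam) * (a * (q * b))) (at lam)"
      by (intro tendsto_intros pow0 lam)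
    moreover have "cmod (inverse lam) * (a * (\<epsilon>1 * b)) < \<epsilon>"
    proof -
      have "cmod (inverse lam) * (a * (\<epsilon>1 * b)) = \<epsilon> * ((a * b) / (2 * (a * b + 1)))"
        unfolding \<epsilon>1_def using lam by (simp add: norm_inverse)
      also have "\<dots> < \<epsilon> * 1" using ab \<epsilon> by (intro mult_strict_left_mono) (auto simp: pos_divide_less_eq)
      finally show ?thesis by simp
    qed
    ultimately have "\<forall>\<^sub>F \<mu> in at lam. ?g \<mu> < \<epsilon>" by (intro order_tendstoD(2)) simp_all
    with ev ev0 Q(2)[OF \<epsilon>1] show ?thesis
    proof eventually_elim
      case (elim \<mu>)
      show ?case
      proof
        fix \<psi> assume \<psi>: "\<psi> \<in> V"
        let ?x = "(\<mu> - lam) ^ p *\<^sub>C ?R \<mu> (B \<psi>)"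
        have "(\<mu> - lam) ^ p *\<^sub>C ?R2 \<mu> \<psi> = inverse \<mu> *\<^sub>C ((\<mu> - lam) ^ p *\<^sub>C \<psi>) + inverse \<mu> *\<^sub>C A ?x"
          unfolding resolvent_swap(2)[OF A B V AV BV elim(2,1) \<psi>] A.scale
          by (simp add: bcf.scale_right_distrib mult.commute)
        then have "(\<mu> - lam) ^ p *\<^sub>C ?R2 \<mu> \<psi> - Q2 \<psi> = inverse \<mu> *\<^sub>C ((\<mu> - lam) ^ p *\<^sub>C \<psi>)
            + inverse \<mu> *\<^sub>C A (?x - Q (B \<psi>)) + (inverse \<mu> - inverse lam) *\<^sub>C A (Q (B \<psi>))"
          unfolding Q2_def A.diff bcf.scale_right_diff_distrib bcf.scale_left_diff_distrib by simp
        then have "norm ((\<mu> - lam) ^ p *\<^sub>C ?R2 \<mu> \<psi> - Q2 \<psi>) \<le> norm (inverse \<mu> *\<^sub>C ((\<mu> - lam) ^ p *\<^sub>C \<psi>))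
            + norm (inverse \<mu> *\<^sub>C A (?x - Q (B \<psi>))) + norm ((inverse \<mu> - inverse lam) *\<^sub>C A (Q (B \<psi>)))"
          by (metis norm_triangle_ineq norm_triangle_mono order_refl)
        also have "\<dots> \<le> cmod (inverse \<mu>) * (cmod ((\<mu> - lam) ^ p) * norm \<psi>)
            + cmod (inverse \<mu>) * (a * (\<epsilon>1 * (b * norm \<psi>)))
            + cmod (inverse \<mu> - inverse lam) * (a * (q * (b * norm \<psi>)))"
        proof -
          have "norm (?x - Q (B \<psi>)) \<le> \<epsilon>1 * norm (B \<psi>)" using elim(3) BV by blast
          also have "\<dots> \<le> \<epsilon>1 * (b * norm \<psi>)" using \<epsilon>1 b(2) by (intro mult_left_mono) auto
          finally have 1: "norm (?x - Q (B \<psi>)) \<le> \<epsilon>1 * (b * norm \<psi>)" .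
          have 2: "norm (Q (B \<psi>)) \<le> q * (b * norm \<psi>)"
            by (intro order_trans[OF q[OF BV]] mult_left_mono b q0)
          show ?thesis
            unfolding norm_scaleC_bcf
            by (intro add_mono mult_left_mono order_trans[OF a(2)] 1 2 a(1) norm_ge_zero order_refl)
        qed
        also have "\<dots> = ?g \<mu> * norm \<psi>" by (simp add: algebra_simps)
        also have "\<dots> \<le> \<epsilon> * norm \<psi>" using elim(4) by (intro mult_right_mono) auto
        finally show "norm ((\<mu> - lam) ^ p *\<^sub>C ?R2 \<mu> \<psi> - Q2 \<psi>) \<le> \<epsilon> * norm \<psi>" .
      qed
    qed
  qed
  ultimately show ?thesis unfolding has_resolvent_pole_def using p by blast
qed


section \<open>Monodromy operators at different times\<close>

context periodic_DDE
begin

abbreviation "M \<equiv> monodromy h L T"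
abbreviation "kern \<mu> \<tau> \<equiv> endomorphism.kernel_pow (\<lambda>\<phi>. \<mu> *\<^sub>C \<phi> - M \<tau> \<phi>)"

lemma bounded_clinear_evolution: "s \<le> t \<Longrightarrow> bounded_clinear (U t s)"
  unfolding bounded_clinear_def using evolution_combine evolution_bound by blast

lemma bounded_clinear_monodromy: "bounded_clinear (M \<tau>)"
  unfolding monodromy_def using T_pos by (intro bounded_clinear_evolution) simp

lemma monodromy_in_state_space: "M \<tau> \<phi> \<in> state_space h"
  unfolding monodromy_def using T_pos by (intro evolution_in_state_space) simp

lemma endomorphism_monodromy: "endomorphism scaleC_bcf (\<lambda>\<phi>. \<mu> *\<^sub>C \<phi> - M \<tau> \<phi>)"
proof -
  interpret Vector_Spaces.linear scaleC_bcf scaleC_bcf "M \<tau>"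
    by (rule bounded_clinear_linear[OF bounded_clinear_monodromy])
  show ?thesis
    unfolding endomorphism_def Vector_Spaces.linear_iff
    by (auto simp: add scale bcf.vector_space_axioms bcf.scale_right_distrib bcf.scale_right_diff_distrib mult.commute)
qed

text \<open>Cut the period starting at s at the time \<tau>. By periodicity, going from
  \<open>s + T\<close> to \<open>\<tau> + T\<close> is the same as going from s to \<tau>, so the
  two monodromy operators differ by the order of the factors.\<close>

lemma monodromy_factor:
  assumes "s \<le> \<tau>" "\<tau> \<le> s + T"
  shows "M s = (\<lambda>\<phi>. U (s + T) \<tau> (U \<tau> s \<phi>))" "M \<tau> = (\<lambda>\<phi>. U \<tau> s (U (s + T) \<tau> \<phi>))"
proof -
  show "M s = (\<lambda>\<phi>. U (s + T) \<tau> (U \<tau> s \<phi>))"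
    unfolding monodromy_def by (simp add: fun_eq_iff evolution_semigroup assms)
  have "U (\<tau> + T) (s + T) (U (s + T) \<tau> \<phi>) = U (\<tau> + T) \<tau> \<phi>" for \<phi>
    using assms by (intro evolution_semigroup) auto
  then show "M \<tau> = (\<lambda>\<phi>. U \<tau> s (U (s + T) \<tau> \<phi>))"
    unfolding monodromy_def using evolution_periodic[OF assms(1)] by (simp add: fun_eq_iff)
qed

lemma monodromy_shift: "M (\<tau> + of_int n * T) = M \<tau>"
proof -
  have step: "M (r + T) = M r" for r
    unfolding monodromy_def using evolution_periodic[of r "r + T"] T_pos by (simp add: fun_eq_iff)
  show ?thesis
  proof (induction n rule: int_induct[where k = 0])
    case (step1 i)
    then show ?case using step[of "\<tau> + of_int i * T"] by (simp add: algebra_simps)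
  next
    case (step2 i)
    then show ?case using step[of "\<tau> + of_int (i - 1) * T"] by (simp add: algebra_simps)
  qed simp
qed

lemma monodromy_factors:
  obtains A B where "bounded_clinear A" "bounded_clinear B" "\<And>\<phi>. A \<phi> \<in> state_space h"
    "\<And>\<phi>. B \<phi> \<in> state_space h" "M s = (\<lambda>\<phi>. B (A \<phi>))" "M \<tau> = (\<lambda>\<phi>. A (B \<phi>))"
proof -
  let ?n = "\<lfloor>(\<tau> - s) / T\<rfloor>"
  define r where "r = \<tau> + of_int (- ?n) * T"
  have "of_int ?n * T \<le> \<tau> - s" "\<tau> - s \<le> (of_int ?n + 1) * T"
    using T_pos by (simp_all add: pos_le_divide_eq[symmetric] pos_divide_le_eq[symmetric])
  then have r: "s \<le> r" "r \<le> s + T" by (simp_all add: r_def algebra_simps)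
  have "M \<tau> = M r" unfolding r_def by (rule monodromy_shift[symmetric])
  then show ?thesis
    using r monodromy_factor[OF r]
    by (intro that[of "U r s" "U (s + T) r"] bounded_clinear_evolution evolution_in_state_space) auto
qed

text \<open>The pole predicates at the two times agree for each p, which makes their definite
  descriptions agree whether or not a pole exists.\<close>

lemma resolvent_pole_order_monodromy:
  assumes "\<mu> \<noteq> 0"
  shows "resolvent_pole_order (state_space h) (M \<tau>) \<mu> = resolvent_pole_order (state_space h) (M s) \<mu>"
proof -
  obtain A B where AB: "bounded_clinear A" "bounded_clinear B" "\<And>\<phi>. A \<phi> \<in> state_space h"
    "\<And>\<phi>. B \<phi> \<in> state_space h" "M s = (\<lambda>\<phi>. B (A \<phi>))" "M \<tau> = (\<lambda>\<phi>. A (B \<phi>))"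
    using monodromy_factors[of s \<tau>] by blast
  have "has_resolvent_pole (state_space h) (M \<tau>) \<mu> p \<longleftrightarrow> has_resolvent_pole (state_space h) (M s) \<mu> p" for p
    unfolding AB(5,6)
    using has_resolvent_pole_swap[OF AB(1,2) bcf_subspace_state_space AB(3,4) assms]
      has_resolvent_pole_swap[OF AB(2,1) bcf_subspace_state_space AB(4,3) assms] by blast
  then show ?thesis unfolding resolvent_pole_order_def by presburger
qed

text \<open>With N = mu I - M, mu phi = N phi + M phi, and M always lands in the state space.
  Kernels may therefore be formed in the ambient type.\<close>

lemma kern_in_state_space:
  assumes "\<mu> \<noteq> 0" "\<phi> \<in> kern \<mu> \<tau> j"
  shows "\<phi> \<in> state_space h"
  using assms(2)
proof (induction j arbitrary: \<phi>)
  interpret N: endomorphism scaleC_bcf "\<lambda>\<phi>. \<mu> *\<^sub>C \<phi> - M \<tau> \<phi>" by (rule endomorphism_monodromy)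
  {
    case 0
    then show ?case by (simp add: N.kernel_pow_0 bcf.subspace_0[OF bcf_subspace_state_space])
  next
    case (Suc j)
    then have "\<mu> *\<^sub>C \<phi> - M \<tau> \<phi> \<in> state_space h" by (simp add: N.kernel_pow_Suc)
    then have "inverse \<mu> *\<^sub>C ((\<mu> *\<^sub>C \<phi> - M \<tau> \<phi>) + M \<tau> \<phi>) \<in> state_space h"
      by (intro bcf.subspace_scale bcf.subspace_add bcf_subspace_state_space monodromy_in_state_space)
    then show ?case using assms(1) by simp
  }
qed

text \<open>The exponent is the pole order at the fixed time s, so the generalized eigenspaces at
  all times are kernels of the same power.\<close>

lemma gen_eigenspace_eq_kern:
  assumes "\<mu> \<noteq> 0"
  shows "gen_eigenspace h L T \<tau> \<mu> = kern \<mu> \<tau> (resolvent_pole_order (state_space h) (M s) \<mu>)"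
proof -
  interpret N: endomorphism scaleC_bcf "\<lambda>\<phi>. \<mu> *\<^sub>C \<phi> - M \<tau> \<phi>" by (rule endomorphism_monodromy)
  show ?thesis
    using kern_in_state_space[OF assms, of _ \<tau>]
    unfolding gen_eigenspace_def resolvent_pole_order_monodromy[OF assms, of \<tau> s]
    by (auto simp: N.kernel_pow_def)
qed

lemma eigenspace_eq_kern:
  assumes "\<mu> \<noteq> 0"
  shows "eigenspace h L T \<tau> \<mu> = kern \<mu> \<tau> (Suc 0)"
proof -
  interpret N: endomorphism scaleC_bcf "\<lambda>\<phi>. \<mu> *\<^sub>C \<phi> - M \<tau> \<phi>" by (rule endomorphism_monodromy)
  show ?thesis
    using kern_in_state_space[OF assms, of _ \<tau> "Suc 0"] unfolding eigenspace_def
    by (auto simp: N.kernel_pow_def)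
qed

lemma dim_kern:
  assumes \<mu>: "\<mu> \<noteq> 0" and dim1: "bcf.dim (kern \<mu> s (Suc 0)) = 1"
  shows "bcf.dim (kern \<mu> \<tau> j) = bcf.dim (kern \<mu> s j)"
proof -
  obtain A B where AB: "bounded_clinear A" "bounded_clinear B" "\<And>\<phi>. A \<phi> \<in> state_space h"
    "\<And>\<phi>. B \<phi> \<in> state_space h" "M s = (\<lambda>\<phi>. B (A \<phi>))" "M \<tau> = (\<lambda>\<phi>. A (B \<phi>))"
    using monodromy_factors[of s \<tau>] by blast
  interpret N: endomorphism scaleC_bcf "\<lambda>\<phi>. \<mu> *\<^sub>C \<phi> - M s \<phi>" by (rule endomorphism_monodromy)
  obtain v where "kern \<mu> s (Suc 0) \<subseteq> bcf.span {v}" using N.dim_1_span_single[OF dim1] by blast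
  then obtain C where C: "finite C" "kern \<mu> s j \<subseteq> bcf.span C" using N.kernel_pow_finite by blast
  show ?thesis unfolding AB(5,6)
    by (rule bcf.dim_kernel_pow_swap[OF bounded_clinear_linear[OF AB(1)] bounded_clinear_linear[OF AB(2)] \<mu>
        C(2)[unfolded AB(5)] C(1)])
qed

end

section \<open>Exponentials of the nilpotent shift\<close>

text \<open>Component i of exp(a S) x, where S is the shift sending x_i to x_(i-1).\<close>

definition exp_shift :: "complex \<Rightarrow> (nat \<Rightarrow> complex^'n) \<Rightarrow> nat \<Rightarrow> complex^'n" where
  "exp_shift a x i = (\<Sum>l\<le>i. (a ^ l / fact l) *s x (i - l))"

text \<open>In each coordinate exp(a S) multiplies the generating series by exp(a X), which reduces
  the group law to that of formal exponentials.\<close>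

lemma exp_shift_nth:
  "exp_shift a x i $ c = fps_nth (fps_exp a * Abs_fps (\<lambda>i. x i $ c)) i"
  by (simp add: exp_shift_def fps_mult_nth atLeast0AtMost)

lemma exp_shift_add: "exp_shift a (exp_shift b x) i = exp_shift (a + b) x i"
proof -
  have "exp_shift a (exp_shift b x) i $ c = exp_shift (a + b) x i $ c" for c
  proof -
    have "Abs_fps (\<lambda>i. exp_shift b x i $ c) = fps_exp b * Abs_fps (\<lambda>i. x i $ c)"
      by (rule fps_ext) (simp add: exp_shift_nth)
    then show ?thesis by (simp add: exp_shift_nth fps_exp_add_mult mult.assoc)
  qed
  then show ?thesis by (simp add: vec_eq_iff)
qed

lemma exp_shift_0: "exp_shift 0 x i = x i"
proof -
  have "exp_shift 0 x i = (\<Sum>l\<le>i. if l = 0 then x i else 0)"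
    unfolding exp_shift_def by (intro sum.cong) (auto simp: power_0_left vec_eq_iff)
  then show ?thesis by simp
qed

lemma exp_shift_cong: "(\<And>j. j \<le> i \<Longrightarrow> x j = y j) \<Longrightarrow> exp_shift a x i = exp_shift a y i"
  unfolding exp_shift_def by (intro sum.cong) auto

lemma vector_smult_sum: "c *s (\<Sum>i\<in>I. f i) = (\<Sum>i\<in>I. c *s (f i :: complex^'n))"
  by (induction I rule: infinite_finite_induct) (auto simp: vector_add_ldistrib)

lemma exp_shift_smult: "exp_shift a (\<lambda>j. c *s x j) i = c *s exp_shift a x i"
  unfolding exp_shift_def vector_smult_sum by (simp add: mult.commute)

lemma bounded_bilinear_vector_smult: "bounded_bilinear (\<lambda>c (v::complex^'n). c *s v)"
proof
  fix c d :: complex and u v :: "complex^'n" and r :: real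
  show "(c + d) *s u = c *s u + d *s u" "c *s (u + v) = c *s u + c *s v"
    by (simp_all add: vec_eq_iff algebra_simps)
  show "(r *\<^sub>R c) *s u = r *\<^sub>R (c *s u)" "c *s (r *\<^sub>R u) = r *\<^sub>R (c *s u)"
    by (simp_all add: vec_eq_iff)
  show "\<exists>K. \<forall>a b. norm (a *s (b::complex^'n)) \<le> norm a * norm b * K"
    by (intro exI[of _ 1]) (simp add: norm_vector_smult)
qed

text \<open>The shift S itself, with 0 entering at index 0.\<close>

definition shift_down :: "(nat \<Rightarrow> 'a::zero) \<Rightarrow> nat \<Rightarrow> 'a" where
  "shift_down x i = (if i = 0 then 0 else x (i - 1))"

text \<open>The coefficient of S^l in exp(theta (sigma + S)).\<close>

definition exp_weight :: "complex \<Rightarrow> nat \<Rightarrow> real \<Rightarrow> complex" where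
  "exp_weight \<sigma> l \<theta> = exp (\<sigma> * of_real \<theta>) * (of_real \<theta> ^ l / fact l)"

text \<open>Coefficientwise form of the rule that differentiating exp(theta (sigma + S)) multiplies
  it by sigma + S; for l = 0 there is no lower coefficient.\<close>

lemma exp_weight_derivative:
  "(exp_weight \<sigma> l has_vector_derivative \<sigma> * exp_weight \<sigma> l \<theta> + (if l = 0 then 0 else exp_weight \<sigma> (l - 1) \<theta>)) (at \<theta> within S)"
proof -
  have "((\<lambda>z. exp (\<sigma> * z) * (z ^ l / fact l)) has_field_derivative
    \<sigma> * (exp (\<sigma> * z) * (z ^ l / fact l)) + (if l = 0 then 0 else exp (\<sigma> * z) * (z ^ (l - 1) / fact (l - 1)))) (at z)" for z
  proof -
    have p: "((\<lambda>z. z ^ l / fact l) has_field_derivative (if l = 0 then 0 else z ^ (l - 1) / fact (l - 1))) (at z)"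
    proof (cases l)
      case (Suc n)
      have "((\<lambda>z. z ^ Suc n) has_field_derivative (1 + of_nat n) * (1 * z ^ n)) (at z)"
        by (rule DERIV_power_Suc[OF DERIV_ident])
      moreover have "(1 + of_nat n) * (1 * z ^ n) / fact (Suc n) = z ^ n / fact n"
      proof -
        have "(1 + of_nat n :: complex) \<noteq> 0" by (metis of_nat_Suc of_nat_neq_0)
        moreover have "fact (Suc n) = (1 + of_nat n) * (fact n :: complex)" by simp
        ultimately show ?thesis by (simp only: mult_1 mult_divide_mult_cancel_left_if if_False)
      qed
      ultimately have "((\<lambda>z. z ^ Suc n / fact (Suc n)) has_field_derivative z ^ n / fact n) (at z)"
        using DERIV_cdivide[of "\<lambda>z. z ^ Suc n" "(1 + of_nat n) * (1 * z ^ n)" z UNIV "fact (Suc n)"]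
        by (simp only:)
      then show ?thesis unfolding Suc by (simp only: nat.distinct if_False diff_Suc_1)
    qed simp
    have "((\<lambda>z. exp (\<sigma> * z)) has_field_derivative exp (\<sigma> * z) * \<sigma>) (at z)"
      by (auto intro!: derivative_eq_intros)
    from DERIV_mult[OF this p] show ?thesis by (rule DERIV_cong) (cases l; simp add: algebra_simps)
  qed
  from this[of "of_real \<theta>"] show ?thesis
    unfolding exp_weight_def
    by (auto intro!: has_vector_derivative_real_field simp del: of_real_power)
qed

lemma continuous_exp_weight: "continuous_on S (exp_weight \<sigma> l)"
  unfolding exp_weight_def by (intro continuous_intros) auto

lemma exp_weight_sum:
  "(\<Sum>l\<le>i. exp_weight \<sigma> l \<theta> *s x (i - l)) = exp (\<sigma> * of_real \<theta>) *s exp_shift (of_real \<theta>) x i"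
  unfolding exp_shift_def exp_weight_def vector_smult_sum by simp

text \<open>S commutes with the exponential, so the index shift can be moved from the weights to the
  sequence.\<close>

lemma sum_shift_down:
  fixes x :: "nat \<Rightarrow> complex^'n"
  shows "(\<Sum>l\<le>i. (if l = 0 then 0 else w (l - 1)) *s x (i - l)) = (\<Sum>l\<le>i. w l *s shift_down x (i - l))"
proof (cases i)
  case (Suc n)
  have "(\<Sum>l\<le>i. (if l = 0 then 0 else w (l - 1)) *s x (i - l)) = (\<Sum>l\<le>n. w l *s x (n - l))"
    unfolding Suc sum.atMost_Suc_shift by simp
  also have "\<dots> = (\<Sum>l\<le>n. w l *s shift_down x (i - l))"
    unfolding Suc shift_down_def by (intro sum.cong) auto
  also have "\<dots> = (\<Sum>l\<le>i. w l *s shift_down x (i - l))"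
    unfolding Suc by (simp add: shift_down_def)
  finally show ?thesis .
qed (simp add: shift_down_def)

text \<open>Differentiating \<open>exp (t (\<sigma> + N)) x(t)\<close>, where \<open>N\<close> is the nilpotent shift.\<close>

lemma exp_weight_sum_derivative:
  fixes x :: "nat \<Rightarrow> real \<Rightarrow> complex^'n"
  assumes c: "(g has_vector_derivative of_real c) (at t within S)"
    and x: "\<And>j. j \<le> i \<Longrightarrow> (x j has_vector_derivative x' j) (at t within S)"
  shows "((\<lambda>t. \<Sum>l\<le>i. exp_weight \<sigma> l (g t) *s x (i - l) t) has_vector_derivative
    (\<Sum>l\<le>i. exp_weight \<sigma> l (g t) *s
       (x' (i - l) + of_real c *s (\<sigma> *s x (i - l) t + shift_down (\<lambda>j. x j t) (i - l))))) (at t within S)"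
proof -
  let ?w = "\<lambda>l. exp_weight \<sigma> l (g t)"
  let ?d = "\<lambda>l. \<sigma> * ?w l + (if l = 0 then 0 else ?w (l - 1))"
  have w: "((\<lambda>t. exp_weight \<sigma> l (g t)) has_vector_derivative of_real c * ?d l) (at t within S)" for l
  proof -
    have "((exp_weight \<sigma> l \<circ> g) has_vector_derivative c *\<^sub>R ?d l) (at t within S)"
      using c by (intro vector_diff_chain_within exp_weight_derivative) simp
    then show ?thesis by (simp add: o_def scaleR_conv_of_real)
  qed
  have "((\<lambda>t. \<Sum>l\<le>i. exp_weight \<sigma> l (g t) *s x (i - l) t) has_vector_derivative
    (\<Sum>l\<le>i. ?w l *s x' (i - l) + (of_real c * ?d l) *s x (i - l) t)) (at t within S)"
    by (intro has_vector_derivative_sum bounded_bilinear.has_vector_derivative[OF bounded_bilinear_vector_smult] w x) simp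
  moreover have "(\<Sum>l\<le>i. ?w l *s x' (i - l) + (of_real c * ?d l) *s x (i - l) t)
    = (\<Sum>l\<le>i. ?w l *s (x' (i - l) + of_real c *s (\<sigma> *s x (i - l) t)))
      + of_real c *s (\<Sum>l\<le>i. (if l = 0 then 0 else ?w (l - 1)) *s x (i - l) t)"
    unfolding vector_smult_sum sum.distrib[symmetric]
    by (intro sum.cong) (simp_all add: vec_eq_iff algebra_simps)
  moreover have "\<dots> = (\<Sum>l\<le>i. ?w l *s (x' (i - l) + of_real c *s (\<sigma> *s x (i - l) t + shift_down (\<lambda>j. x j t) (i - l))))"
    unfolding sum_shift_down[of ?w "\<lambda>j. x j t"] vector_smult_sum sum.distrib[symmetric]
    by (intro sum.cong) (simp_all add: vec_eq_iff algebra_simps)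
  ultimately show ?thesis by simp
qed


section \<open>Floquet chains\<close>

definition mult_bcf :: "real \<Rightarrow> (real \<Rightarrow> complex) \<Rightarrow> (real \<Rightarrow>\<^sub>C (complex^'n)) \<Rightarrow> (real \<Rightarrow>\<^sub>C (complex^'n))" where
  "mult_bcf h w \<phi> = Bcontfun (\<lambda>\<theta>. w (clamp (-h) 0 \<theta>) *s \<phi> (clamp (-h) 0 \<theta>))"

lemma apply_mult_bcf:
  assumes "continuous_on {-h..0} w"
  shows "mult_bcf h w \<phi> \<theta> = w (clamp (-h) 0 \<theta>) *s \<phi> (clamp (-h) 0 \<theta>)"
  unfolding mult_bcf_def
  by (rule apply_Bcontfun_clamp[where f = "\<lambda>\<theta>. w \<theta> *s \<phi> \<theta>"])
    (intro bounded_bilinear.continuous_on[OF bounded_bilinear_vector_smult] assms continuous_on_apply_bcontfun)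

lemma mult_bcf_in_state_space:
  assumes "continuous_on {-h..0} w" "h \<ge> 0"
  shows "mult_bcf h w \<phi> \<in> state_space h"
  unfolding state_space_def using assms by (simp add: apply_mult_bcf clamp_clamp)

lemma bounded_linear_mult_bcf:
  assumes w: "continuous_on {-h..0} w" and h: "h \<ge> 0"
  shows "bounded_linear (mult_bcf h w)"
proof -
  have "compact (w ` {-h..0})" by (rule compact_continuous_image[OF w compact_Icc])
  then obtain C where C: "\<And>\<theta>. \<theta> \<in> {-h..0} \<Longrightarrow> cmod (w \<theta>) \<le> C"
    using compact_imp_bounded bounded_iff by (metis imageI)
  show ?thesis
  proof (rule bounded_linear_intro[of _ C])
    show "mult_bcf h w (x + y) = mult_bcf h w x + mult_bcf h w y"
      "mult_bcf h w (r *\<^sub>R x) = r *\<^sub>R mult_bcf h w x" for x y r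
      by (rule bcontfun_eqI; simp add: apply_mult_bcf[OF w] vec_eq_iff algebra_simps)+
    show "norm (mult_bcf h w x) \<le> norm x * C" for x
    proof (rule norm_bound)
      fix \<theta>
      have c: "cmod (w (clamp (-h) 0 \<theta>)) \<le> C" using clamp_bounds[OF h] by (intro C) auto
      then have "0 \<le> C" using norm_ge_zero order_trans by blast
      with c show "norm (mult_bcf h w x \<theta>) \<le> norm x * C"
        by (simp add: apply_mult_bcf[OF w] norm_vector_smult mult.commute[of "norm x"] mult_mono norm_bounded)
    qed
  qed
qed

text \<open>The formula for phi_i as a sum of fixed bounded operators, multiplication by a weight,
  applied to segments of the q_j. Smoothness in \<tau> then reduces to that of segments.\<close>

definition floquet_fun ::
    "real \<Rightarrow> complex \<Rightarrow> (nat \<Rightarrow> real \<Rightarrow> complex^'n) \<Rightarrow> nat \<Rightarrow> real \<Rightarrow> (real \<Rightarrow>\<^sub>C (complex^'n))" where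
  "floquet_fun h \<sigma> q i \<tau> = (\<Sum>l\<le>i. mult_bcf h (exp_weight \<sigma> l) (segment h (q (i - l)) \<tau>))"

lemma apply_sum_bcf:
  fixes f :: "'i \<Rightarrow> (real \<Rightarrow>\<^sub>C (complex^'n))"
  shows "(\<Sum>i\<in>I. f i) \<theta> = (\<Sum>i\<in>I. f i \<theta>)"
  by (induction I rule: infinite_finite_induct) auto

lemma apply_floquet_fun_sum:
  assumes h: "h \<ge> 0" and q: "\<And>j. j \<le> i \<Longrightarrow> continuous_on {\<tau>-h..\<tau>} (q j)"
  shows "floquet_fun h \<sigma> q i \<tau> \<theta> =
    (\<Sum>l\<le>i. exp_weight \<sigma> l (clamp (-h) 0 \<theta>) *s q (i - l) (\<tau> + clamp (-h) 0 \<theta>))"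
  unfolding floquet_fun_def apply_sum_bcf apply_mult_bcf[OF continuous_exp_weight]
  by (intro sum.cong) (simp_all add: apply_segment q clamp_clamp[OF h])

lemma apply_floquet_fun:
  assumes h: "h \<ge> 0" and q: "\<And>j. j \<le> i \<Longrightarrow> continuous_on {\<tau>-h..\<tau>} (q j)"
  shows "floquet_fun h \<sigma> q i \<tau> \<theta> = exp (\<sigma> * of_real (clamp (-h) 0 \<theta>)) *s
     exp_shift (of_real (clamp (-h) 0 \<theta>)) (\<lambda>j. q j (\<tau> + clamp (-h) 0 \<theta>)) i"
  using apply_floquet_fun_sum[OF h, of i \<tau> q \<sigma> \<theta>] q
    exp_weight_sum[of \<sigma> "clamp (-h) 0 \<theta>" "\<lambda>j. q j (\<tau> + clamp (-h) 0 \<theta>)" i] by simp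

lemma floquet_fun_in_state_space: "h \<ge> 0 \<Longrightarrow> floquet_fun h \<sigma> q i \<tau> \<in> state_space h"
  unfolding floquet_fun_def
  by (intro bcf.subspace_sum bcf_subspace_state_space mult_bcf_in_state_space continuous_exp_weight)

lemma Ck_floquet_fun:
  assumes "h \<ge> 0" "\<And>l. l \<le> i \<Longrightarrow> Ck j (q l)"
  shows "Ck j (floquet_fun h \<sigma> q i)"
  unfolding floquet_fun_def[abs_def] using assms
  by (intro Ck_sum Ck_bounded_linear[OF bounded_linear_mult_bcf[OF continuous_exp_weight]] Ck_segment) auto

text \<open>\<open>Ck_segment\<close> provides differentiability without naming the derivative;
  evaluation at each \<theta>, a bounded functional, identifies it.\<close>

lemma segment_has_vector_derivative:
  fixes y :: "real \<Rightarrow> 'e::real_normed_vector"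
  assumes h: "h \<ge> 0" and y: "\<And>t. (y has_vector_derivative y' t) (at t)" and y': "continuous_on UNIV y'"
  shows "(segment h y has_vector_derivative segment h y' t) (at t)"
proof -
  have "Ck (Suc 0) y" using y y' by auto
  then obtain D where D: "\<And>t. (segment h y has_vector_derivative D t) (at t)"
    using Ck_segment[OF h, of "Suc 0" y] by auto
  have c: "continuous_on UNIV y" using \<open>Ck (Suc 0) y\<close> by (rule Ck_continuous)
  have ap: "segment h y t \<theta> = y (t + clamp (-h) 0 \<theta>)" "segment h y' t \<theta> = y' (t + clamp (-h) 0 \<theta>)" for t \<theta>
    by (intro apply_segment continuous_on_subset[OF c] continuous_on_subset[OF y']; auto)+
  have "D t = segment h y' t"
  proof (rule bcontfun_eqI)
    fix \<theta>
    have "bounded_linear (\<lambda>\<phi>::real \<Rightarrow>\<^sub>C 'e. \<phi> \<theta>)"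
      by (rule bounded_linear_intro[of _ 1]) (auto simp: norm_bounded)
    from bounded_linear.has_vector_derivative[OF this D]
    have "((\<lambda>t. y (t + clamp (-h) 0 \<theta>)) has_vector_derivative D t \<theta>) (at t)" by (simp add: ap)
    moreover have "((y \<circ> (\<lambda>t. t + clamp (-h) 0 \<theta>)) has_vector_derivative 1 *\<^sub>R y' (t + clamp (-h) 0 \<theta>)) (at t)"
      by (rule vector_diff_chain_at) (auto intro!: derivative_eq_intros y)
    ultimately show "D t \<theta> = segment h y' t \<theta>"
      by (simp add: ap o_def vector_derivative_unique_at)
  qed
  with D show ?thesis by metis
qed

lemma floquet_fun_has_vector_derivative:
  assumes h: "h \<ge> 0" and q: "\<And>j t. j \<le> i \<Longrightarrow> (q j has_vector_derivative q' j t) (at t)"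
    and q': "\<And>j. j \<le> i \<Longrightarrow> continuous_on UNIV (q' j)"
  shows "(floquet_fun h \<sigma> q i has_vector_derivative floquet_fun h \<sigma> q' i t) (at t)"
  unfolding floquet_fun_def[abs_def]
  by (intro has_vector_derivative_sum
      bounded_linear.has_vector_derivative[OF bounded_linear_mult_bcf[OF continuous_exp_weight h]]
      segment_has_vector_derivative[OF h] q q') auto

lemma has_state_derivative_unique:
  assumes h: "h > 0" and "has_state_derivative h \<phi> \<psi>" "has_state_derivative h \<phi> \<psi>'"
  shows "\<psi> = \<psi>'"
proof (rule state_space_eqI)
  fix \<theta> assume \<theta>: "- h \<le> \<theta>" "\<theta> \<le> 0"
  have "(\<phi> has_vector_derivative \<psi> \<theta>) (at \<theta> within cbox (-h) 0)"
    "(\<phi> has_vector_derivative \<psi>' \<theta>) (at \<theta> within cbox (-h) 0)"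
    using assms(2,3) \<theta> by (auto simp: has_state_derivative_def)
  then show "\<psi> \<theta> = \<psi>' \<theta>"
    using h \<theta> by (intro vector_derivative_unique_within_closed_interval[of "-h" 0 \<theta> \<phi>]) auto
qed (use assms in \<open>auto simp: has_state_derivative_def\<close>)

lemma A_op_eq: "h > 0 \<Longrightarrow> has_state_derivative h \<phi> \<psi> \<Longrightarrow> A_op h \<phi> = \<psi>"
  unfolding A_op_def using has_state_derivative_unique by blast

lemma sum_smult_shift_down:
  fixes x :: "nat \<Rightarrow> complex^'n"
  shows "(\<Sum>l\<le>i. w l *s shift_down x (i - l)) = shift_down (\<lambda>j. \<Sum>l\<le>j. w l *s x (j - l)) i"
proof (cases i)
  case (Suc n)
  have "(\<Sum>l\<le>i. w l *s shift_down x (i - l)) = (\<Sum>l\<le>n. w l *s shift_down x (i - l))"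
    unfolding Suc by (simp add: shift_down_def)
  also have "\<dots> = (\<Sum>l\<le>n. w l *s x (n - l))"
    unfolding Suc shift_down_def by (intro sum.cong) auto
  finally show ?thesis by (simp add: shift_down_def Suc)
qed (simp add: shift_down_def)

text \<open>Differentiating in theta gives a part from q', which is also the derivative in tau, and
  a part from sigma + S. The operator \<open>calA\<close> subtracts the former, leaving sigma phi_i
  + phi_(i-1).\<close>

lemma floquet_fun_state_derivative:
  assumes h: "h > 0" and q: "\<And>j t. j \<le> i \<Longrightarrow> (q j has_vector_derivative q' j t) (at t)"
    and q': "\<And>j. j \<le> i \<Longrightarrow> continuous_on UNIV (q' j)"
  shows "has_state_derivative h (floquet_fun h \<sigma> q i \<tau>)
    (floquet_fun h \<sigma> q' i \<tau> + (\<sigma> *\<^sub>C floquet_fun h \<sigma> q i \<tau> + shift_down (\<lambda>j. floquet_fun h \<sigma> q j \<tau>) i))"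
    (is "has_state_derivative h ?\<phi> ?\<psi>")
  unfolding has_state_derivative_def
proof (intro conjI ballI)
  have qc: "continuous_on S (q j)" if "j \<le> i" for j S
    by (intro continuous_at_imp_continuous_on ballI has_vector_derivative_continuous[OF q[OF that]])
  have q'c: "continuous_on S (q' j)" if "j \<le> i" for j S
    using q'[OF that] continuous_on_subset by blast
  have sd: "shift_down (\<lambda>j. floquet_fun h \<sigma> q j \<tau>) i \<in> state_space h"
    using h bcf.subspace_0[OF bcf_subspace_state_space[of h]] by (auto simp: shift_down_def floquet_fun_in_state_space)
  show "?\<psi> \<in> state_space h"
    using h by (intro bcf.subspace_add bcf.subspace_scale bcf_subspace_state_space floquet_fun_in_state_space sd) auto
  fix \<theta> assume \<theta>: "\<theta> \<in> {-h..0}"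
  have ap: "floquet_fun h \<sigma> p j \<tau> r = (\<Sum>l\<le>j. exp_weight \<sigma> l r *s p (j - l) (\<tau> + r))"
    if "r \<in> {-h..0}" "\<And>l. l \<le> j \<Longrightarrow> continuous_on {\<tau>-h..\<tau>} (p l)" for p :: "nat \<Rightarrow> real \<Rightarrow> complex^'n" and j r
    using h that by (simp add: apply_floquet_fun_sum clamp_idem)
  have sda: "(shift_down (\<lambda>j. floquet_fun h \<sigma> q j \<tau>) i) \<theta> = (\<Sum>l\<le>i. exp_weight \<sigma> l \<theta> *s shift_down (\<lambda>j. q j (\<tau> + \<theta>)) (i - l))"
    unfolding sum_smult_shift_down using \<theta> qc by (simp add: shift_down_def ap)
  have "((\<lambda>r. \<Sum>l\<le>i. exp_weight \<sigma> l r *s q (i - l) (\<tau> + r)) has_vector_derivative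
    (\<Sum>l\<le>i. exp_weight \<sigma> l \<theta> *s
       (q' (i - l) (\<tau> + \<theta>) + of_real 1 *s (\<sigma> *s q (i - l) (\<tau> + \<theta>) + shift_down (\<lambda>j. q j (\<tau> + \<theta>)) (i - l)))))
     (at \<theta> within {-h..0})"
  proof (rule exp_weight_sum_derivative[where g = "\<lambda>r. r" and x = "\<lambda>j r. q j (\<tau> + r)" and x' = "\<lambda>j. q' j (\<tau> + \<theta>)"])
    fix j assume j: "j \<le> i"
    have "((q j \<circ> (\<lambda>r. \<tau> + r)) has_vector_derivative 1 *\<^sub>R q' j (\<tau> + \<theta>)) (at \<theta> within {-h..0})"
      by (rule vector_diff_chain_within)
        (auto intro!: derivative_eq_intros has_vector_derivative_at_within[OF q[OF j]])
    then show "((\<lambda>r. q j (\<tau> + r)) has_vector_derivative q' j (\<tau> + \<theta>)) (at \<theta> within {-h..0})"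
      by (simp add: o_def)
  qed (auto intro!: derivative_eq_intros)
  moreover have "(\<Sum>l\<le>i. exp_weight \<sigma> l \<theta> *s
       (q' (i - l) (\<tau> + \<theta>) + of_real 1 *s (\<sigma> *s q (i - l) (\<tau> + \<theta>) + shift_down (\<lambda>j. q j (\<tau> + \<theta>)) (i - l)))) = ?\<psi> \<theta>"
    using \<theta> qc q'c
    by (simp add: ap sda apply_scaleC_bcf vector_smult_sum sum.distrib vector_add_ldistrib)
      (simp add: mult.commute)
  ultimately show "(?\<phi> has_vector_derivative ?\<psi> \<theta>) (at \<theta> within {-h..0})"
    using \<theta> qc by (auto simp: ap intro: has_vector_derivative_transform[rotated 2])
qed

section \<open>Floquet systems and the chains they produce\<close>

context periodic_DDE
begin

text \<open>The periodic system of the theorem solved for the derivative of q_i, with L in place of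
  the Stieltjes integral. Smoothness is not included because the equation itself produces
  it.\<close>

definition floquet_system :: "complex \<Rightarrow> nat \<Rightarrow> (nat \<Rightarrow> real \<Rightarrow> complex^'n) \<Rightarrow> bool" where
  "floquet_system \<sigma> m q \<longleftrightarrow> (\<forall>i<m. (\<forall>t. q i (t + T) = q i t) \<and>
     (\<forall>t. (q i has_vector_derivative Lc t (floquet_fun h \<sigma> q i t) - \<sigma> *s q i t - shift_down (\<lambda>j. q j t) i) (at t)))"

context
  fixes \<sigma> m q
  assumes system: "floquet_system \<sigma> m q"
begin

lemma floquet_system_periodic: "i < m \<Longrightarrow> q i (t + T) = q i t"
  using system by (simp add: floquet_system_def)

definition q_deriv where
  "q_deriv i t = Lc t (floquet_fun h \<sigma> q i t) - \<sigma> *s q i t - shift_down (\<lambda>j. q j t) i"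

lemma q_has_derivative: "i < m \<Longrightarrow> (q i has_vector_derivative q_deriv i t) (at t)"
  using system by (simp add: floquet_system_def q_deriv_def)

text \<open>The right-hand side inherits smoothness from the q_j up to order k, so each pass through
  the equation gains one order, ending at k + 1.\<close>

lemma Ck_q: "j \<le> k + 1 \<Longrightarrow> i < m \<Longrightarrow> Ck j (q i)"
  and Ck_q_deriv: "j \<le> k \<Longrightarrow> i < m \<Longrightarrow> Ck j (q_deriv i)"
proof -
  have step: "Ck j (q_deriv i)" if "j \<le> k" "i < m" and q: "\<And>l. l \<le> i \<Longrightarrow> Ck j (q l)" for i j
  proof -
    have "Ck j (\<lambda>t. Lc t (floquet_fun h \<sigma> q i t))"
      using that h_pos by (intro L_Ck Ck_floquet_fun floquet_fun_in_state_space) auto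
    moreover have "Ck j (\<lambda>t. shift_down (\<lambda>j. q j t) i)"
      using q[of "i - 1"] by (cases i) (auto simp: shift_down_def simp del: Ck.simps intro: Ck_const)
    ultimately show ?thesis
      unfolding q_deriv_def[abs_def]
      by (intro Ck_minus Ck_bounded_linear[OF bounded_linear_vector_smult] q) auto
  qed
  have main: "j \<le> k + 1 \<Longrightarrow> \<forall>i<m. Ck j (q i)" for j
  proof (induction j)
    case 0
    then show ?case
      using q_has_derivative by (auto intro!: continuous_at_imp_continuous_on intro: has_vector_derivative_continuous)
  next
    case (Suc j)
    then show ?case using q_has_derivative step by (auto simp del: Ck.simps intro!: Ck_SucI)
  qed
  then show "j \<le> k + 1 \<Longrightarrow> i < m \<Longrightarrow> Ck j (q i)" by blast
  show "j \<le> k \<Longrightarrow> i < m \<Longrightarrow> Ck j (q_deriv i)" using main[of j] by (intro step) auto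
qed

lemma q_continuous: "i < m \<Longrightarrow> continuous_on S (q i)"
  using Ck_q[of 0 i] continuous_on_subset by auto

lemma q_deriv_continuous: "i < m \<Longrightarrow> continuous_on S (q_deriv i)"
  using Ck_q_deriv[of 0 i] continuous_on_subset by auto

lemma floquet_fun_periodic: "i < m \<Longrightarrow> floquet_fun h \<sigma> q i (\<tau> + T) = floquet_fun h \<sigma> q i \<tau>"
proof -
  assume i: "i < m"
  have "segment h (q j) (\<tau> + T) = segment h (q j) \<tau>" if "j \<le> i" for j
    using segment_shift[of h "q j" T \<tau>] floquet_system_periodic[of j] i that by simp
  then show ?thesis unfolding floquet_fun_def by (intro sum.cong) auto
qed

lemma floquet_fun_in_CT: "i < m \<Longrightarrow> j \<le> k + 1 \<Longrightarrow> floquet_fun h \<sigma> q i \<in> CT T j (state_space h)"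
  unfolding CT_iff using h_pos
  by (auto simp: floquet_fun_in_state_space floquet_fun_periodic simp del: Ck.simps intro!: Ck_floquet_fun Ck_q)

lemma floquet_fun_derivatives:
  assumes i: "i < m"
  shows "(floquet_fun h \<sigma> q i has_vector_derivative floquet_fun h \<sigma> q_deriv i t) (at t)"
    "has_state_derivative h (floquet_fun h \<sigma> q i \<tau>)
      (floquet_fun h \<sigma> q_deriv i \<tau> + (\<sigma> *\<^sub>C floquet_fun h \<sigma> q i \<tau> + shift_down (\<lambda>j. floquet_fun h \<sigma> q j \<tau>) i))"
  using i h_pos
  by (intro floquet_fun_has_vector_derivative floquet_fun_state_derivative q_has_derivative q_deriv_continuous; simp)+

lemma floquet_fun_at_0:
  assumes i: "i < m"
  shows "floquet_fun h \<sigma> q i \<tau> 0 = q i \<tau>" "floquet_fun h \<sigma> q_deriv i \<tau> 0 = q_deriv i \<tau>"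
  using i h_pos by (simp_all add: apply_floquet_fun q_continuous q_deriv_continuous clamp_idem exp_shift_0)

lemma floquet_fun_in_calA_dom:
  assumes i: "i < m"
  shows "floquet_fun h \<sigma> q i \<in> calA_dom h T L"
  unfolding calA_dom_def A_dom_def
proof (intro CollectI conjI allI)
  show "floquet_fun h \<sigma> q i \<in> CT T 1 (state_space h)" using i by (intro floquet_fun_in_CT) auto
  fix \<tau>
  show "floquet_fun h \<sigma> q i \<tau> \<in> state_space h" using h_pos by (intro floquet_fun_in_state_space) simp
  have "(shift_down (\<lambda>j. floquet_fun h \<sigma> q j \<tau>) i) 0 = shift_down (\<lambda>j. q j \<tau>) i"
    using i by (simp add: shift_down_def floquet_fun_at_0)
  \<comment> \<open>The boundary condition at theta = 0 is the equation for q_i: the sigma term and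
    the shifted term cancel against those inside \<open>q_deriv\<close>.\<close>
  then have "(floquet_fun h \<sigma> q_deriv i \<tau> + (\<sigma> *\<^sub>C floquet_fun h \<sigma> q i \<tau> + shift_down (\<lambda>j. floquet_fun h \<sigma> q j \<tau>) i)) 0
      = Lc \<tau> (floquet_fun h \<sigma> q i \<tau>)"
    using i by (simp add: floquet_fun_at_0 apply_scaleC_bcf q_deriv_def)
  with floquet_fun_derivatives(2)[OF i]
  show "\<exists>\<psi>. has_state_derivative h (floquet_fun h \<sigma> q i \<tau>) \<psi> \<and> \<psi> 0 = Lc \<tau> (floquet_fun h \<sigma> q i \<tau>)" by blast
qed

lemma calA_floquet_fun:
  assumes i: "i < m"
  shows "calA h (floquet_fun h \<sigma> q i) \<tau> - \<sigma> *\<^sub>C floquet_fun h \<sigma> q i \<tau> = shift_down (\<lambda>j. floquet_fun h \<sigma> q j \<tau>) i"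
  unfolding calA_def A_op_eq[OF h_pos floquet_fun_derivatives(2)[OF i]]
    vector_derivative_at[OF floquet_fun_derivatives(1)[OF i]]
  by simp

text \<open>Freezing the time in the polynomial factor at \<open>\<tau>\<close> makes the formula for \<open>\<phi>\<^sub>i(\<tau>)\<close> a solution.\<close>

lemma solves_floquet:
  assumes i: "i < m"
  shows "solves \<tau> (floquet_fun h \<sigma> q i \<tau>) (\<lambda>t. \<Sum>l\<le>i. exp_weight \<sigma> l (t - \<tau>) *s q (i - l) t)"
    and "segment h (\<lambda>t. \<Sum>l\<le>i. exp_weight \<sigma> l (t - \<tau>) *s q (i - l) t) t =
      (\<Sum>l\<le>i. exp_weight \<sigma> l (t - \<tau>) *\<^sub>C floquet_fun h \<sigma> q (i - l) t)"
proof -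
  let ?y = "\<lambda>t. \<Sum>l\<le>i. exp_weight \<sigma> l (t - \<tau>) *s q (i - l) t"
  have y_eq: "?y t = exp (\<sigma> * of_real (t - \<tau>)) *s exp_shift (of_real (t - \<tau>)) (\<lambda>j. q j t) i" for t
    by (rule exp_weight_sum[where x = "\<lambda>j. q j t"])
  have deriv: "(?y has_vector_derivative (\<Sum>l\<le>i. exp_weight \<sigma> l (t - \<tau>) *s
       (q_deriv (i - l) t + of_real 1 *s (\<sigma> *s q (i - l) t + shift_down (\<lambda>j. q j t) (i - l))))) (at t)" for t
    using i by (intro exp_weight_sum_derivative[where x' = "\<lambda>j. q_deriv j t"] q_has_derivative)
      (auto intro!: derivative_eq_intros)
  have yc: "continuous_on S ?y" for S
    by (intro continuous_at_imp_continuous_on ballI has_vector_derivative_continuous[OF deriv])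
  \<comment> \<open>Group law: the exponential factor at t - tau times the one at theta inside the
    segment is the factor at t + theta - tau.\<close>
  show seg: "segment h ?y t = (\<Sum>l\<le>i. exp_weight \<sigma> l (t - \<tau>) *\<^sub>C floquet_fun h \<sigma> q (i - l) t)" for t
  proof (rule bcontfun_eqI)
    fix \<theta>
    let ?c = "clamp (-h) 0 \<theta>"
    have "(\<Sum>l\<le>i. exp_weight \<sigma> l (t - \<tau>) *\<^sub>C floquet_fun h \<sigma> q (i - l) t) \<theta> =
      (\<Sum>l\<le>i. exp_weight \<sigma> l (t - \<tau>) *s (exp (\<sigma> * of_real ?c) *s exp_shift (of_real ?c) (\<lambda>j. q j (t + ?c)) (i - l)))"
      using i h_pos by (simp add: apply_sum_bcf apply_scaleC_bcf apply_floquet_fun q_continuous)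
    also have "\<dots> = exp (\<sigma> * of_real (t - \<tau>)) *s (exp (\<sigma> * of_real ?c) *s exp_shift (of_real (t - \<tau>)) (exp_shift (of_real ?c) (\<lambda>j. q j (t + ?c))) i)"
      unfolding exp_weight_sum[where x = "\<lambda>j. exp (\<sigma> * of_real ?c) *s exp_shift (of_real ?c) (\<lambda>j. q j (t + ?c)) j"] exp_shift_smult ..
    also have "\<dots> = (exp (\<sigma> * of_real (t - \<tau>)) * exp (\<sigma> * of_real ?c)) *s exp_shift (of_real (t + ?c - \<tau>)) (\<lambda>j. q j (t + ?c)) i"
      unfolding exp_shift_add by (simp add: algebra_simps)
    also have "exp (\<sigma> * of_real (t - \<tau>)) * exp (\<sigma> * of_real ?c) = exp (\<sigma> * of_real (t + ?c - \<tau>))"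
      by (simp add: exp_add[symmetric] algebra_simps)
    finally have "(\<Sum>l\<le>i. exp_weight \<sigma> l (t - \<tau>) *\<^sub>C floquet_fun h \<sigma> q (i - l) t) \<theta> = ?y (t + ?c)"
      unfolding y_eq .
    from trans[OF apply_segment[OF yc] this[symmetric]]
    show "segment h ?y t \<theta> = (\<Sum>l\<le>i. exp_weight \<sigma> l (t - \<tau>) *\<^sub>C floquet_fun h \<sigma> q (i - l) t) \<theta>" .
  qed
  show "solves \<tau> (floquet_fun h \<sigma> q i \<tau>) ?y"
    unfolding solves_linear_DDE_def
  proof (intro conjI ballI allI impI yc)
    show "?y (\<tau> + \<theta>) = floquet_fun h \<sigma> q i \<tau> \<theta>" if "\<theta> \<in> {-h..0}" for \<theta>
      using that i h_pos by (simp add: apply_floquet_fun_sum q_continuous clamp_idem)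
    fix t
    have "Lc t (segment h ?y t) = (\<Sum>l\<le>i. exp_weight \<sigma> l (t - \<tau>) *s Lc t (floquet_fun h \<sigma> q (i - l) t))"
      unfolding seg Lc_sum Lc_scaleC ..
    also have "\<dots> = (\<Sum>l\<le>i. exp_weight \<sigma> l (t - \<tau>) *s
       (q_deriv (i - l) t + of_real 1 *s (\<sigma> *s q (i - l) t + shift_down (\<lambda>j. q j t) (i - l))))"
      unfolding q_deriv_def by simp
    finally show "(?y has_vector_derivative Lc t (segment h ?y t)) (at t within {\<tau>..})"
      using has_vector_derivative_at_within[OF deriv] by simp
  qed
qed

text \<open>At time \<open>\<tau> + T\<close> the polynomial factors of the explicit solution have
  argument T, while its periodic parts have returned.\<close>

lemma monodromy_floquet_fun:
  assumes i: "i < m"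
  shows "M \<tau> (floquet_fun h \<sigma> q i \<tau>) = (\<Sum>l\<le>i. exp_weight \<sigma> l T *\<^sub>C floquet_fun h \<sigma> q (i - l) \<tau>)"
  unfolding monodromy_def using T_pos i
  by (simp add: evolution_eq[OF solves_floquet(1)[OF i]] solves_floquet(2)[OF i] floquet_fun_periodic)

lemma triangular_chain_floquet_fun:
  assumes q0: "m > 0 \<Longrightarrow> \<exists>t. q 0 t \<noteq> 0"
  shows "endomorphism.triangular_chain scaleC_bcf (\<lambda>\<phi>. exp (\<sigma> * of_real T) *\<^sub>C \<phi> - M \<tau> \<phi>)
    (\<lambda>i l. - exp_weight \<sigma> (i - l) T) m (\<lambda>i. floquet_fun h \<sigma> q i \<tau>)"
proof -
  interpret N: endomorphism scaleC_bcf "\<lambda>\<phi>. exp (\<sigma> * of_real T) *\<^sub>C \<phi> - M \<tau> \<phi>" by (rule endomorphism_monodromy)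
  show ?thesis
    unfolding N.triangular_chain_def
  proof (intro conjI allI impI)
    fix i assume i: "i < m"
    \<comment> \<open>Reversing the sum isolates the diagonal term l = i, whose weight exp(sigma T)
      cancels against the multiplier.\<close>
    have "(\<Sum>l\<le>i. exp_weight \<sigma> l T *\<^sub>C floquet_fun h \<sigma> q (i - l) \<tau>) = (\<Sum>l\<le>i. exp_weight \<sigma> (i - l) T *\<^sub>C floquet_fun h \<sigma> q l \<tau>)"
      by (rule sum.reindex_bij_witness[of _ "\<lambda>l. i - l" "\<lambda>l. i - l"]) auto
    also have "\<dots> = (\<Sum>l<i. exp_weight \<sigma> (i - l) T *\<^sub>C floquet_fun h \<sigma> q l \<tau>) + exp (\<sigma> * of_real T) *\<^sub>C floquet_fun h \<sigma> q i \<tau>"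
      unfolding lessThan_Suc_atMost[symmetric] by (simp add: exp_weight_def)
    finally show "exp (\<sigma> * of_real T) *\<^sub>C floquet_fun h \<sigma> q i \<tau> - M \<tau> (floquet_fun h \<sigma> q i \<tau>)
       = (\<Sum>l<i. (- exp_weight \<sigma> (i - l) T) *\<^sub>C floquet_fun h \<sigma> q l \<tau>)"
      unfolding monodromy_floquet_fun[OF i] by (simp add: sum_negf)
  next
    assume m: "0 < m"
    show "floquet_fun h \<sigma> q 0 \<tau> \<noteq> 0"
    proof
      assume "floquet_fun h \<sigma> q 0 \<tau> = 0"
      \<comment> \<open>Zero history forces the zero solution at all later times; periodicity then
        carries the vanishing of \<open>q 0\<close> back to the whole line.\<close>
      then have "solves \<tau> 0 (\<lambda>t. \<Sum>l\<le>0. exp_weight \<sigma> l (t - \<tau>) *s q (0 - l) t)"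
        using solves_floquet(1)[OF m, of \<tau>] by simp
      from solves_growth[OF this] have z: "exp_weight \<sigma> 0 (t - \<tau>) *s q 0 t = 0" if "\<tau> - h \<le> t" for t
        using that by simp
      have z: "q 0 t = 0" if "\<tau> \<le> t" for t
        using z[of t] that h_pos by (simp add: exp_weight_def)
      have "q 0 t = 0" for t
      proof -
        define n where "n = nat \<lceil>(\<tau> - t) / T\<rceil>"
        have "(\<tau> - t) / T \<le> real n" unfolding n_def by linarith
        then have "\<tau> \<le> t + real n * T" using T_pos by (simp add: field_simps)
        then have "q 0 (t + real n * T) = 0" by (rule z)
        moreover have "q 0 (t + real n * T) = q 0 t" for n
        proof (induction n)
          case (Suc n)
          then show ?case using floquet_system_periodic[OF m, of "t + real n * T"] by (simp add: algebra_simps)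
        qed simp
        ultimately show ?thesis by simp
      qed
      then show False using q0[OF m] by blast
    qed
  qed
qed

end

end


section \<open>From a chain back to periodic coefficients\<close>

text \<open>Coefficients built from forward solutions are known on a half-line; this continues them
  backwards.\<close>

lemma periodic_extension:
  fixes f :: "real \<Rightarrow> 'e"
  assumes T: "T > 0" and f: "\<And>t. a \<le> t \<Longrightarrow> f (t + T) = f t"
  shows "\<exists>g. (\<forall>t. g (t + T) = g t) \<and> (\<forall>t\<ge>a. g t = f t)"
proof -
  have it: "f (t + real n * T) = f t" if "a \<le> t" for t n
  proof (induction n)
    case (Suc n)
    have "a \<le> t + real n * T" using that T by (simp add: add_increasing2)
    then show ?case using f[of "t + real n * T"] Suc by (simp add: algebra_simps)
  qed simp
  \<comment> \<open>Number of periods pushing t beyond a; \<open>nat\<close> makes it 0 if t is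
    already there.\<close>
  define N where "N t = nat \<lceil>(a - t) / T\<rceil>" for t
  have N: "a \<le> t + real (N t) * T" for t
  proof -
    have "(a - t) / T \<le> real (N t)" unfolding N_def by linarith
    then show ?thesis using T by (simp add: field_simps)
  qed
  have indep: "f (t + real n * T) = f (t + real n' * T)" if "n \<le> n'" "a \<le> t + real n * T" for t n n'
  proof -
    have "t + real n' * T = (t + real n * T) + real (n' - n) * T"
      using that(1) by (simp add: of_nat_diff algebra_simps)
    then show ?thesis by (simp only: it[OF that(2)])
  qed
  show ?thesis
  proof (intro exI[of _ "\<lambda>t. f (t + real (N t) * T)"] conjI allI impI)
    fix t
    have "f (t + T + real (N (t + T)) * T) = f (t + real (Suc (N (t + T))) * T)" by (simp add: algebra_simps)
    also have "\<dots> = f (t + real (max (Suc (N (t + T))) (N t)) * T)"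
      using N[of "t + T"] by (intro indep) (auto simp: algebra_simps)
    also have "\<dots> = f (t + real (N t) * T)"
      using N[of t] by (intro indep[symmetric]) auto
    finally show "f (t + T + real (N (t + T)) * T) = f (t + real (N t) * T)" .
    show "f (t + real (N t) * T) = f t" if "a \<le> t" by (rule it[OF that])
  qed
qed

context periodic_DDE
begin

lemma solves_sum:
  assumes "\<And>l. l \<in> I \<Longrightarrow> solves s (\<phi> l) (y l)"
  shows "solves s (\<Sum>l\<in>I. c l *\<^sub>C \<phi> l) (\<lambda>t. \<Sum>l\<in>I. c l *s y l t)"
proof -
  have zero: "solves s 0 (\<lambda>_. 0)"
  proof -
    have "segment h (\<lambda>_. 0 :: complex^'n) t = 0" for t by (rule bcontfun_eqI) (simp add: apply_segment)
    then show ?thesis by (simp add: solves_linear_DDE_def Lc_zero)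
  qed
  show ?thesis using assms
    by (induction I rule: infinite_finite_induct) (simp_all add: zero solves_combine)
qed

text \<open>The chain relation says that the solutions y_i starting at the chain satisfy y(t+T) =
  exp(T (sigma + S)) y(t). Hence exp((s-t) (sigma + S)) y(t) is T-periodic, and these are the
  coefficients.\<close>

lemma floquet_system_of_chain:
  assumes chain: "endomorphism.triangular_chain scaleC_bcf (\<lambda>\<phi>. exp (\<sigma> * of_real T) *\<^sub>C \<phi> - M s \<phi>)
    (\<lambda>i l. - exp_weight \<sigma> (i - l) T) m w"
  shows "\<exists>q. floquet_system \<sigma> m q \<and> (m > 0 \<longrightarrow> (\<exists>t. q 0 t \<noteq> 0))"
proof -
  interpret N: endomorphism scaleC_bcf "\<lambda>\<phi>. exp (\<sigma> * of_real T) *\<^sub>C \<phi> - M s \<phi>" by (rule endomorphism_monodromy)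
  have Mw: "M s (w i) = (\<Sum>l\<le>i. exp_weight \<sigma> l T *\<^sub>C w (i - l))" if i: "i < m" for i
  proof -
    have "(\<Sum>l\<le>i. exp_weight \<sigma> l T *\<^sub>C w (i - l)) = (\<Sum>l\<le>i. exp_weight \<sigma> (i - l) T *\<^sub>C w l)"
      by (rule sum.reindex_bij_witness[of _ "\<lambda>l. i - l" "\<lambda>l. i - l"]) auto
    also have "\<dots> = (\<Sum>l<i. exp_weight \<sigma> (i - l) T *\<^sub>C w l) + exp (\<sigma> * of_real T) *\<^sub>C w i"
      unfolding lessThan_Suc_atMost[symmetric] by (simp add: exp_weight_def)
    moreover have "exp (\<sigma> * of_real T) *\<^sub>C w i - M s (w i) = (\<Sum>l<i. (- exp_weight \<sigma> (i - l) T) *\<^sub>C w l)"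
      using chain i unfolding N.triangular_chain_def by blast
    ultimately show ?thesis by (simp add: sum_negf algebra_simps)
  qed
  have "\<forall>i. \<exists>y. solves s (w i) y" using solves_exists by blast
  then obtain y where y: "\<And>i. solves s (w i) (y i)" by metis
  note yc = solvesD(1)[OF y]
  \<comment> \<open>Start the equation at \<open>s + T\<close> from \<open>M s (w i)\<close>: the
    shifted combination and \<open>y i\<close> itself both solve it, and uniqueness compares
    them.\<close>
  have yT: "y i (t + T) = exp (\<sigma> * of_real T) *s exp_shift (of_real T) (\<lambda>j. y j t) i" if i: "i < m" and t: "s - h \<le> t" for i t
  proof -
    have "solves s (M s (w i)) (\<lambda>t. \<Sum>l\<le>i. exp_weight \<sigma> l T *s y (i - l) t)"
      unfolding Mw[OF i] by (intro solves_sum y)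
    then have "solves (s + T) (M s (w i)) (\<lambda>t. \<Sum>l\<le>i. exp_weight \<sigma> l T *s y (i - l) (t - T))"
      by (rule solves_shift)
    moreover have "solves (s + T) (M s (w i)) (y i)"
      unfolding monodromy_def evolution_eq[OF y less_imp_le[OF less_add_same_cancel1[THEN iffD2, OF T_pos]]]
      using T_pos by (intro solves_restart[OF y]) simp
    ultimately have "(\<Sum>l\<le>i. exp_weight \<sigma> l T *s y (i - l) (t + T - T)) = y i (t + T)"
      using t by (intro solves_unique) auto
    then show ?thesis using exp_weight_sum[of \<sigma> T "\<lambda>j. y j t" i] by simp
  qed
  \<comment> \<open>Undoes the factor exp((t-s) (sigma + S)) of the solution formula, hence the
    argument \<open>s - t\<close>.\<close>
  define p where "p i t = (\<Sum>l\<le>i. exp_weight \<sigma> l (s - t) *s y (i - l) t)" for i t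
  have p_eq: "p i t = exp (\<sigma> * of_real (s - t)) *s exp_shift (of_real (s - t)) (\<lambda>j. y j t) i" for i t
    unfolding p_def by (rule exp_weight_sum[where x = "\<lambda>j. y j t"])
  have pc: "continuous_on {s-h..} (p i)" for i
    unfolding p_def
    by (intro continuous_on_sum bounded_bilinear.continuous_on[OF bounded_bilinear_vector_smult] yc
      continuous_on_compose2[OF continuous_exp_weight[of UNIV]] continuous_intros) auto
  have pT: "p i (t + T) = p i t" if i: "i < m" and t: "s - h \<le> t" for i t
  proof -
    have "p i (t + T) = exp (\<sigma> * of_real (s - (t + T))) *s
        exp_shift (of_real (s - (t + T))) (\<lambda>j. exp (\<sigma> * of_real T) *s exp_shift (of_real T) (\<lambda>j. y j t) j) i"
      unfolding p_eq using i t by (intro arg_cong2[where f = "(*s)"] refl exp_shift_cong yT) auto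
    also have "\<dots> = (exp (\<sigma> * of_real (s - (t + T))) * exp (\<sigma> * of_real T)) *s exp_shift (of_real (s - t)) (\<lambda>j. y j t) i"
      unfolding exp_shift_smult exp_shift_add by simp
    also have "exp (\<sigma> * of_real (s - (t + T))) * exp (\<sigma> * of_real T) = exp (\<sigma> * of_real (s - t))"
      by (simp add: exp_add[symmetric] algebra_simps)
    finally show ?thesis by (simp add: p_eq)
  qed
  have "\<forall>i. \<exists>g. i < m \<longrightarrow> (\<forall>t. g (t + T) = g t) \<and> (\<forall>t\<ge>s-h. g t = p i t)"
  proof (intro allI)
    fix i
    show "\<exists>g. i < m \<longrightarrow> (\<forall>t. g (t + T) = g t) \<and> (\<forall>t\<ge>s-h. g t = p i t)"
    proof (cases "i < m")
      case True
      then show ?thesis using periodic_extension[OF T_pos, of "s - h" "p i"] pT[OF True] by simp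
    qed simp
  qed
  then obtain q where q: "\<And>i t. i < m \<Longrightarrow> q i (t + T) = q i t" "\<And>i t. i < m \<Longrightarrow> s - h \<le> t \<Longrightarrow> q i t = p i t"
    by metis
  have qc: "continuous_on {t-h..t} (q i)" if "i < m" "s \<le> t" for i t
    by (rule continuous_on_eq[OF continuous_on_subset[OF pc]]) (use q that in auto)
  \<comment> \<open>Inside the segment the factors at theta and at s - (t + theta) multiply to one
    free of theta, so weighted segments of y remain and L can be applied termwise.\<close>
  have ff: "floquet_fun h \<sigma> q i t = (\<Sum>l\<le>i. exp_weight \<sigma> l (s - t) *\<^sub>C segment h (y (i - l)) t)"
    if i: "i < m" and t: "s \<le> t" for i t
  proof (rule bcontfun_eqI)
    fix \<theta>
    let ?c = "clamp (-h) 0 \<theta>"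
    have c: "-h \<le> ?c" using clamp_bounds[of h \<theta>] h_pos by simp
    have "floquet_fun h \<sigma> q i t \<theta> = exp (\<sigma> * of_real ?c) *s exp_shift (of_real ?c) (\<lambda>j. q j (t + ?c)) i"
      using h_pos i t qc by (intro apply_floquet_fun) auto
    also have "exp_shift (of_real ?c) (\<lambda>j. q j (t + ?c)) i = exp_shift (of_real ?c)
        (\<lambda>j. exp (\<sigma> * of_real (s - (t + ?c))) *s exp_shift (of_real (s - (t + ?c))) (\<lambda>j. y j (t + ?c)) j) i"
      using i t c by (intro exp_shift_cong) (simp add: q(2) p_eq)
    also have "\<dots> = exp (\<sigma> * of_real (s - (t + ?c))) *s exp_shift (of_real (s - t)) (\<lambda>j. y j (t + ?c)) i"
      unfolding exp_shift_smult exp_shift_add by simp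
    also have "exp (\<sigma> * of_real ?c) *s \<dots> = (exp (\<sigma> * of_real ?c) * exp (\<sigma> * of_real (s - (t + ?c)))) *s exp_shift (of_real (s - t)) (\<lambda>j. y j (t + ?c)) i"
      by simp
    also have "exp (\<sigma> * of_real ?c) * exp (\<sigma> * of_real (s - (t + ?c))) = exp (\<sigma> * of_real (s - t))"
      by (simp add: exp_add[symmetric] algebra_simps)
    also have "exp (\<sigma> * of_real (s - t)) *s exp_shift (of_real (s - t)) (\<lambda>j. y j (t + ?c)) i =
        (\<Sum>l\<le>i. exp_weight \<sigma> l (s - t) *s y (i - l) (t + ?c))"
      by (rule exp_weight_sum[where x = "\<lambda>j. y j (t + ?c)", symmetric])
    also have "\<dots> = (\<Sum>l\<le>i. exp_weight \<sigma> l (s - t) *\<^sub>C segment h (y (i - l)) t) \<theta>"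
      using t by (simp add: apply_sum_bcf apply_scaleC_bcf apply_segment solvesD(4)[OF y])
    finally show "floquet_fun h \<sigma> q i t \<theta> = (\<Sum>l\<le>i. exp_weight \<sigma> l (s - t) *\<^sub>C segment h (y (i - l)) t) \<theta>" .
  qed
  define P where "P i t \<longleftrightarrow> (q i has_vector_derivative Lc t (floquet_fun h \<sigma> q i t) - \<sigma> *s q i t - shift_down (\<lambda>j. q j t) i) (at t)" for i t
  \<comment> \<open>Right of s the derivative of y is two-sided; the inner derivative -1 of
    \<open>s - t\<close> yields minus the sigma term and minus the shifted term.\<close>
  have later: "P i t" if i: "i < m" and t: "s < t" for i t
  proof -
    have "(p i has_vector_derivative (\<Sum>l\<le>i. exp_weight \<sigma> l (s - t) *s
       (Lc t (segment h (y (i - l)) t) + of_real (-1) *s (\<sigma> *s y (i - l) t + shift_down (\<lambda>j. y j t) (i - l))))) (at t)"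
      unfolding p_def
    proof (rule exp_weight_sum_derivative[where x' = "\<lambda>j. Lc t (segment h (y j) t)" and g = "\<lambda>t. s - t"])
      show "(y j has_vector_derivative Lc t (segment h (y j) t)) (at t)" for j
        using solvesD(3)[OF y, of t j] t at_within_atLeast[OF t] by simp
    qed (auto intro!: derivative_eq_intros)
    moreover have "(\<Sum>l\<le>i. exp_weight \<sigma> l (s - t) *s
       (Lc t (segment h (y (i - l)) t) + of_real (-1) *s (\<sigma> *s y (i - l) t + shift_down (\<lambda>j. y j t) (i - l))))
       = Lc t (floquet_fun h \<sigma> q i t) - \<sigma> *s p i t - shift_down (\<lambda>j. p j t) i"
      unfolding ff[OF i less_imp_le[OF t]] Lc_sum Lc_scaleC p_def
        sum_smult_shift_down[of "\<lambda>l. exp_weight \<sigma> l (s - t)" "\<lambda>j. y j t" i, symmetric]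
        vector_smult_sum sum_subtractf[symmetric]
      by (intro sum.cong) (simp_all add: vec_eq_iff algebra_simps)
    moreover have "p i t = q i t" using q(2)[OF i, of t] t h_pos by simp
    moreover have "shift_down (\<lambda>j. p j t) i = shift_down (\<lambda>j. q j t) i"
      using i t h_pos by (auto simp: shift_down_def q(2))
    ultimately have "(p i has_vector_derivative Lc t (floquet_fun h \<sigma> q i t) - \<sigma> *s q i t - shift_down (\<lambda>j. q j t) i) (at t)"
      by simp
    then show ?thesis unfolding P_def
      by (rule has_vector_derivative_transform_within_open[of _ _ _ "{s<..}"])
        (use t i h_pos in \<open>auto simp: q(2)\<close>)
  qed
  \<comment> \<open>Differentiability at \<open>t + T\<close> transfers to t, which removes the
    restriction to times after s.\<close>
  have earlier: "P i t" if i: "i < m" and P: "P i (t + T)" for i t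
  proof -
    have sd: "shift_down (\<lambda>j. q j (t + T)) i = shift_down (\<lambda>j. q j t) i" using i q(1) by (simp add: shift_down_def)
    have "segment h (q j) (t + T) = segment h (q j) t" if "j \<le> i" for j
      using segment_shift[of h "q j" T t] q(1)[of j] i that by simp
    then have f: "floquet_fun h \<sigma> q i (t + T) = floquet_fun h \<sigma> q i t"
      unfolding floquet_fun_def by (intro sum.cong) auto
    have "Lc (t + T) (floquet_fun h \<sigma> q i t) = Lc t (floquet_fun h \<sigma> q i t)"
      using h_pos by (intro L_periodic floquet_fun_in_state_space) simp
    then have "(q i has_vector_derivative Lc t (floquet_fun h \<sigma> q i t) - \<sigma> *s q i t - shift_down (\<lambda>j. q j t) i) (at (t + T))"
      using P unfolding P_def f sd q(1)[OF i] by simp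
    then have "((q i \<circ> (\<lambda>t. t + T)) has_vector_derivative 1 *\<^sub>R (Lc t (floquet_fun h \<sigma> q i t) - \<sigma> *s q i t - shift_down (\<lambda>j. q j t) i)) (at t)"
      by (intro vector_diff_chain_at) (auto intro!: derivative_eq_intros)
    then show ?thesis by (simp add: P_def o_def q(1)[OF i])
  qed
  have "P i t" if i: "i < m" for i t
  proof -
    define n where "n = nat (\<lfloor>(s - t) / T\<rfloor> + 1)"
    have "(s - t) / T < real n" unfolding n_def by linarith
    then have "s < t + real n * T" using T_pos by (simp add: field_simps)
    then have "P i (t + real n * T)" by (rule later[OF i])
    then show ?thesis
    proof (induction n)
      case (Suc n)
      then show ?case using earlier[OF i, of "t + real n * T"] by (simp add: algebra_simps)
    qed simp
  qed
  then have "floquet_system \<sigma> m q" unfolding floquet_system_def using q(1) by (simp add: P_def)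
  moreover have "\<exists>t. q 0 t \<noteq> 0" if m: "m > 0"
  proof (rule ccontr)
    assume "\<not> (\<exists>t. q 0 t \<noteq> 0)"
    then have "p 0 t = 0" if "s - h \<le> t" for t using q(2)[OF m that] by simp
    then have y0: "y 0 t = 0" if "s - h \<le> t" for t using that by (simp add: p_def exp_weight_def)
    \<comment> \<open>Vanishing of \<open>y 0\<close> on the history interval determines
      \<open>w 0\<close> on [-h,0] only; the monodromy image is 0 in the ambient type and equals the
      multiplier times \<open>w 0\<close>.\<close>
    have "M s (w 0) = segment h (y 0) (s + T)" unfolding monodromy_def using T_pos by (intro evolution_eq y) simp
    also have "\<dots> = 0"
      using T_pos h_pos clamp_bounds(1)[of h]
      by (intro bcontfun_eqI) (simp add: apply_segment[OF solvesD(4)[OF y]] y0 add_increasing)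
    finally have "exp (\<sigma> * of_real T) *\<^sub>C w 0 = 0" using Mw[OF m] by (simp add: exp_weight_def)
    then show False using chain m by (simp add: N.triangular_chain_def)
  qed
  ultimately show ?thesis by blast
qed

section \<open>Multiplicities and bases at every time\<close>

context
  fixes s \<sigma> lam m
  assumes lam: "lam = exp (\<sigma> * of_real T)" and geom: "geometric_multiplicity h L T s lam = 1"
    and m: "m = algebraic_multiplicity h L T s lam"
begin

text \<open>Moves the multiplicities from the time s to every \<tau> with one common exponent; the
  exchange of factors applies since an exponential is nonzero.\<close>

lemma multiplicities:
  defines "p \<equiv> resolvent_pole_order (state_space h) (M s) lam"
  shows "bcf.dim (kern lam \<tau> (Suc 0)) = 1" "bcf.dim (kern lam \<tau> p) = m"
    "gen_eigenspace h L T \<tau> lam = kern lam \<tau> p"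
proof -
  have nz: "lam \<noteq> 0" by (simp add: lam)
  have 1: "bcf.dim (kern lam s (Suc 0)) = 1"
    using geom by (simp add: geometric_multiplicity_def eigenspace_eq_kern[OF nz])
  from 1 show "bcf.dim (kern lam \<tau> (Suc 0)) = 1" using dim_kern[OF nz 1, of \<tau> "Suc 0"] by simp
  show "gen_eigenspace h L T \<tau> lam = kern lam \<tau> p" unfolding p_def by (rule gen_eigenspace_eq_kern[OF nz])
  show "bcf.dim (kern lam \<tau> p) = m"
    using dim_kern[OF nz 1, of \<tau> p] unfolding m algebraic_multiplicity_def p_def by (simp add: gen_eigenspace_eq_kern[OF nz, of s s])
qed

text \<open>The value is - exp(sigma T) T; the unsimplified \<open>Suc i - i\<close> matches the
  instance of \<open>a (Suc i) i\<close>.\<close>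

lemma chain_coefficient: "- exp_weight \<sigma> (Suc i - i) T \<noteq> 0"
  using T_pos by (simp add: exp_weight_def)

text \<open>The chain length equals the dimension of the generalized eigenspace at each time, so
  counting applies for every \<tau> separately with one and the same q.\<close>

lemma floquet_basis:
  assumes q: "floquet_system \<sigma> m q" "m > 0 \<Longrightarrow> \<exists>t. q 0 t \<noteq> 0"
  shows "ordered_basis (gen_eigenspace h L T \<tau> lam) m (\<lambda>i. floquet_fun h \<sigma> q i \<tau>)"
proof -
  interpret N: endomorphism scaleC_bcf "\<lambda>\<phi>. lam *\<^sub>C \<phi> - M \<tau> \<phi>" by (rule endomorphism_monodromy)
  have chain: "N.triangular_chain (\<lambda>i l. - exp_weight \<sigma> (i - l) T) m (\<lambda>i. floquet_fun h \<sigma> q i \<tau>)"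
    using triangular_chain_floquet_fun[OF q] by (simp only: lam)
  note ind = N.triangular_chain_independent[OF chain_coefficient chain]
  have "bcf.span ((\<lambda>i. floquet_fun h \<sigma> q i \<tau>) ` {..<m}) = gen_eigenspace h L T \<tau> lam"
    using N.triangular_chain_basis[where a = "\<lambda>i l. - exp_weight \<sigma> (i - l) T"
        and p = "resolvent_pole_order (state_space h) (M s) lam" and w = "\<lambda>i. floquet_fun h \<sigma> q i \<tau>",
        OF multiplicities(1) chain_coefficient] chain
    unfolding multiplicities(2,3) .
  with ind show ?thesis by (simp add: ordered_basis_def)
qed

lemma floquet_system_exists: "\<exists>q. floquet_system \<sigma> m q \<and> (m > 0 \<longrightarrow> (\<exists>t. q 0 t \<noteq> 0))"
proof -
  interpret N: endomorphism scaleC_bcf "\<lambda>\<phi>. lam *\<^sub>C \<phi> - M s \<phi>" by (rule endomorphism_monodromy)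
  obtain w where "N.triangular_chain (\<lambda>i l. - exp_weight \<sigma> (i - l) T) m w"
    using N.triangular_chain_exists[where a = "\<lambda>i l. - exp_weight \<sigma> (i - l) T", OF multiplicities(1)[of s] chain_coefficient eq_refl[OF multiplicities(2)[of s, symmetric]]]
    by blast
  then show ?thesis unfolding lam by (rule floquet_system_of_chain)
qed

end

end


section \<open>The characteristic operator\<close>

text \<open>A constant gauge of radius \<delta>/2 forces every interval to be shorter than \<delta>.
  Existence of such divisions keeps the Stieltjes limit from being vacuous and makes it
  unique.\<close>

lemma tagged_division_small_mesh:
  assumes "\<delta> > 0"
  obtains p where "p tagged_division_of {a..b::real}" "\<forall>(x, K)\<in>p. Sup K - Inf K < \<delta>"
proof -
  have "gauge (\<lambda>x. ball x (\<delta> / 2) :: real set)" using assms by (intro gauge_ball) simp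
  then obtain p where p: "p tagged_division_of {a..b}" "(\<lambda>x. ball x (\<delta> / 2)) fine p"
    using fine_division_exists_real by blast
  have "Sup K - Inf K < \<delta>" if xK: "(x, K) \<in> p" for x K
  proof -
    obtain u v where K: "K = {u..v}" using tagged_division_ofD(4)[OF p(1) xK] by auto
    have "x \<in> K" using tagged_division_ofD(2)[OF p(1) xK] .
    then have "u \<le> v" "u \<in> K" "v \<in> K" using K by auto
    moreover have "K \<subseteq> ball x (\<delta> / 2)" using p(2) xK by (auto simp: fine_def)
    ultimately have "dist x u < \<delta> / 2" "dist x v < \<delta> / 2" by auto
    then have "v - u < \<delta>" unfolding dist_real_def by linarith
    then show ?thesis using K \<open>u \<le> v\<close> by simp
  qed
  then show ?thesis using that[OF p(1)] by blast
qed

lemma has_RS_integral_unique: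
  assumes "has_RS_integral a b G f I" "has_RS_integral a b G f I'"
  shows "I = I'"
proof (rule ccontr)
  assume "I \<noteq> I'"
  then have e: "norm (I - I') / 2 > 0" by simp
  let ?S = "\<lambda>p. \<Sum>(x, K)\<in>p. matrix_act (G (Sup K) - G (Inf K)) (f x)"
  obtain d where d: "d > 0" "\<forall>p. p tagged_division_of {a..b} \<and> (\<forall>(x, K)\<in>p. Sup K - Inf K < d) \<longrightarrow> norm (?S p - I) < norm (I - I') / 2"
    using assms(1) e unfolding has_RS_integral_def by blast
  obtain d' where d': "d' > 0" "\<forall>p. p tagged_division_of {a..b} \<and> (\<forall>(x, K)\<in>p. Sup K - Inf K < d') \<longrightarrow> norm (?S p - I') < norm (I - I') / 2"
    using assms(2) e unfolding has_RS_integral_def by blast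
  obtain p where p: "p tagged_division_of {a..b}" "\<forall>(x, K)\<in>p. Sup K - Inf K < min d d'"
    using tagged_division_small_mesh[of "min d d'" a b] d(1) d'(1) by auto
  have "norm (?S p - I) < norm (I - I') / 2" "norm (?S p - I') < norm (I - I') / 2"
    using p by (intro d(2)[rule_format] d'(2)[rule_format]; fastforce)+
  then show False using norm_triangle_ineq4[of "?S p - I'" "?S p - I"] by simp
qed

lemma RS_integral_eq: "has_RS_integral a b G f I \<Longrightarrow> RS_integral a b G f = I"
  unfolding RS_integral_def using has_RS_integral_unique by blast

lemma has_RS_integral_cong:
  assumes fg: "\<And>x. x \<in> {a..b} \<Longrightarrow> f x = g x" and f: "has_RS_integral a b G f I"
  shows "has_RS_integral a b G g I"
proof -
  have "(\<Sum>(x, K)\<in>p. matrix_act (G (Sup K) - G (Inf K)) (f x)) = (\<Sum>(x, K)\<in>p. matrix_act (G (Sup K) - G (Inf K)) (g x))"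
    if "p tagged_division_of {a..b}" for p
  proof (intro sum.cong refl, clarify)
    fix x K assume "(x, K) \<in> p"
    then have "x \<in> {a..b}" using tagged_division_ofD(2,3)[OF that] by blast
    then show "matrix_act (G (Sup K) - G (Inf K)) (f x) = matrix_act (G (Sup K) - G (Inf K)) (g x)" using fg by simp
  qed
  then show ?thesis using f unfolding has_RS_integral_def by (simp cong: conj_cong)
qed

lemma matrix_act_complex:
  "matrix_act A v = of_real_vec (matrix_act A (Re_vec v)) + \<i> *s of_real_vec (matrix_act A (Im_vec v))"
  by (simp add: matrix_act_def of_real_vec_def Re_vec_def Im_vec_def vec_eq_iff complex_eq_iff Re_sum Im_sum)

text \<open>Stieltjes sums with real matrices act separately on real and imaginary parts, so the
  representation of the real functional passes to its complexification.\<close>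

lemma has_RS_integral_complexify:
  assumes repr: "\<And>\<phi>. \<phi> \<in> state_space h \<Longrightarrow> has_RS_integral a b G (\<lambda>\<theta>. apply_bcontfun \<phi> (- \<theta>)) (R \<phi>)"
    and \<phi>: "\<phi> \<in> state_space h"
  shows "has_RS_integral a b G (\<lambda>\<theta>. apply_bcontfun \<phi> (- \<theta>)) (complexify R \<phi>)"
  unfolding has_RS_integral_def
proof (intro allI impI)
  fix e :: real assume "e > 0"
  then have e: "e / 2 > 0" by simp
  let ?S = "\<lambda>f p. \<Sum>(x, K)\<in>p. matrix_act (G (Sup K) - G (Inf K)) (f x)"
  obtain d where d: "d > 0" "\<forall>p. p tagged_division_of {a..b} \<and> (\<forall>(x, K)\<in>p. Sup K - Inf K < d) \<longrightarrow>
     norm (?S (\<lambda>\<theta>. re_bcf \<phi> (- \<theta>)) p - R (re_bcf \<phi>)) < e / 2"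
    using repr[OF re_bcf_in_state_space[OF \<phi>]] e unfolding has_RS_integral_def by blast
  obtain d' where d': "d' > 0" "\<forall>p. p tagged_division_of {a..b} \<and> (\<forall>(x, K)\<in>p. Sup K - Inf K < d') \<longrightarrow>
     norm (?S (\<lambda>\<theta>. im_bcf \<phi> (- \<theta>)) p - R (im_bcf \<phi>)) < e / 2"
    using repr[OF im_bcf_in_state_space[OF \<phi>]] e unfolding has_RS_integral_def by blast
  show "\<exists>\<delta>>0. \<forall>p. p tagged_division_of {a..b} \<and> (\<forall>(x, K)\<in>p. Sup K - Inf K < \<delta>) \<longrightarrow>
     norm (?S (\<lambda>\<theta>. \<phi> (- \<theta>)) p - complexify R \<phi>) < e"
  proof (intro exI[of _ "min d d'"] conjI allI impI)
    fix p assume p: "p tagged_division_of {a..b} \<and> (\<forall>(x, K)\<in>p. Sup K - Inf K < min d d')"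
    let ?r = "?S (\<lambda>\<theta>. re_bcf \<phi> (- \<theta>)) p - R (re_bcf \<phi>)"
    let ?i = "?S (\<lambda>\<theta>. im_bcf \<phi> (- \<theta>)) p - R (im_bcf \<phi>)"
    have ri: "norm ?r < e / 2" "norm ?i < e / 2"
      using p by (intro d(2)[rule_format] d'(2)[rule_format]; fastforce)+
    interpret o: bounded_linear of_real_vec by (rule bounded_linear_of_real_vec)
    have "?S (\<lambda>\<theta>. \<phi> (- \<theta>)) p = of_real_vec (?S (\<lambda>\<theta>. re_bcf \<phi> (- \<theta>)) p) + \<i> *s of_real_vec (?S (\<lambda>\<theta>. im_bcf \<phi> (- \<theta>)) p)"
      unfolding o.sum vector_smult_sum sum.distrib[symmetric]
      by (intro sum.cong refl) (clarsimp simp: apply_re_bcf apply_im_bcf, rule matrix_act_complex)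
    then have "?S (\<lambda>\<theta>. \<phi> (- \<theta>)) p - complexify R \<phi> = of_real_vec ?r + \<i> *s of_real_vec ?i"
      unfolding complexify_eq o.diff by (simp add: vec_eq_iff algebra_simps)
    then have "norm (?S (\<lambda>\<theta>. \<phi> (- \<theta>)) p - complexify R \<phi>) \<le> norm ?r + norm ?i"
      using norm_triangle_ineq[of "of_real_vec ?r" "\<i> *s of_real_vec ?i"]
      by (simp add: norm_vector_smult norm_of_real_vec)
    then show "norm (?S (\<lambda>\<theta>. \<phi> (- \<theta>)) p - complexify R \<phi>) < e" using ri by linarith
  qed (use d(1) d'(1) in simp)
qed

section \<open>Dependence on the spectral parameter\<close>

text \<open>A quadratic remainder bound is a form of differentiability that survives application of
  a bounded operator with only the constant changing.\<close>

lemma has_field_derivative_of_quadratic_bound: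
  fixes f :: "complex \<Rightarrow> complex"
  assumes "\<And>u. cmod u \<le> 1 \<Longrightarrow> cmod (f (w + u) - f w - u * D) \<le> C * (cmod u)\<^sup>2"
  shows "(f has_field_derivative D) (at w)"
  unfolding has_field_derivative_def has_derivative_at_alt
proof (intro conjI allI impI)
  show "bounded_linear ((*) D)" by (rule bounded_linear_mult_right)
  fix e :: real assume e: "e > 0"
  define d where "d = min 1 (e / (\<bar>C\<bar> + 1))"
  show "\<exists>d>0. \<forall>y. norm (y - w) < d \<longrightarrow> norm (f y - f w - D * (y - w)) \<le> e * norm (y - w)"
  proof (intro exI[of _ d] conjI allI impI)
    show "d > 0" unfolding d_def using e by (simp add: add_nonneg_pos)
    fix y assume y: "norm (y - w) < d"
    have "norm (f y - f w - D * (y - w)) \<le> C * (cmod (y - w))\<^sup>2"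
      using assms[of "y - w"] y unfolding d_def by (simp add: mult.commute)
    also have "\<dots> \<le> (\<bar>C\<bar> * cmod (y - w)) * cmod (y - w)"
      by (simp add: power2_eq_square mult.assoc[symmetric] mult_right_mono)
    also have "\<dots> \<le> e * cmod (y - w)"
    proof (rule mult_right_mono)
      have "\<bar>C\<bar> * cmod (y - w) \<le> (\<bar>C\<bar> + 1) * (e / (\<bar>C\<bar> + 1))"
        using y unfolding d_def by (intro mult_mono) auto
      also have "\<dots> = e" by (simp add: add_nonneg_eq_0_iff)
      finally show "\<bar>C\<bar> * cmod (y - w) \<le> e" .
    qed simp
    finally show "norm (f y - f w - D * (y - w)) \<le> e * norm (y - w)" .
  qed
qed

text \<open>The l-th derivative of exp(w theta) in w. Unlike in \<open>exp_weight\<close> the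
  factorial is left out, so differentiating in w raises l without a constant.\<close>

definition exp_monomial :: "complex \<Rightarrow> nat \<Rightarrow> real \<Rightarrow> complex" where
  "exp_monomial w l \<theta> = exp (w * of_real \<theta>) * of_real \<theta> ^ l"

lemma continuous_exp_monomial: "continuous_on S (exp_monomial w l)"
  unfolding exp_monomial_def by (intro continuous_intros)

text \<open>Second-order Taylor remainder of exp(u theta), where |u theta| is at most h; the first
  two factors of the bound dominate exp(w theta) theta^l. The bound is uniform in theta.\<close>

lemma exp_monomial_remainder:
  assumes \<theta>: "-h \<le> \<theta>" "\<theta> \<le> 0" and u: "cmod u \<le> 1"
  shows "cmod (exp_monomial (w + u) l \<theta> - exp_monomial w l \<theta> - u * exp_monomial w (Suc l) \<theta>)
     \<le> exp (cmod w * h) * h ^ l * (exp h * h\<^sup>2) * (cmod u)\<^sup>2"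
proof -
  let ?z = "u * of_real \<theta>"
  have h: "h \<ge> 0" using \<theta> by simp
  have "exp_monomial (w + u) l \<theta> - exp_monomial w l \<theta> - u * exp_monomial w (Suc l) \<theta>
      = exp (w * of_real \<theta>) * of_real \<theta> ^ l * (exp ?z - (1 + ?z))"
    by (simp add: exp_monomial_def exp_add algebra_simps)
  then have "cmod (exp_monomial (w + u) l \<theta> - exp_monomial w l \<theta> - u * exp_monomial w (Suc l) \<theta>)
     = cmod (exp (w * of_real \<theta>)) * \<bar>\<theta>\<bar> ^ l * cmod (exp ?z - (1 + ?z))"
    by (simp add: norm_mult norm_power)
  also have "\<dots> \<le> exp (cmod w * h) * h ^ l * ((exp h * h\<^sup>2) * (cmod u)\<^sup>2)"
  proof (intro mult_mono)
    have "Re (w * of_real \<theta>) \<le> cmod (w * of_real \<theta>)" by (rule complex_Re_le_cmod)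
    also have "\<dots> \<le> cmod w * h"
      using \<theta> mult_left_mono[of "\<bar>\<theta>\<bar>" h "cmod w"] by (simp add: norm_mult)
    finally show "cmod (exp (w * of_real \<theta>)) \<le> exp (cmod w * h)" by simp
    show "\<bar>\<theta>\<bar> ^ l \<le> h ^ l" using \<theta> by (intro power_mono) auto
    have z: "cmod ?z \<le> cmod u * h"
      using \<theta> mult_left_mono[of "\<bar>\<theta>\<bar>" h "cmod u"] by (simp add: norm_mult)
    also have "\<dots> \<le> 1 * h" using u h by (rule mult_right_mono)
    finally have z': "cmod ?z \<le> h" by simp
    have "cmod (exp ?z - (\<Sum>i\<le>1. ?z ^ i / fact i)) \<le> exp (cmod ?z) * (cmod ?z ^ Suc 1) / fact 1"
      by (rule Taylor_exp_field)
    then have "cmod (exp ?z - (1 + ?z)) \<le> exp (cmod ?z) * (cmod ?z)\<^sup>2"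
      by (simp add: power2_eq_square)
    also have "\<dots> \<le> exp h * (cmod u * h)\<^sup>2"
      using z z' by (intro mult_mono power_mono) auto
    finally show "cmod (exp ?z - (1 + ?z)) \<le> exp h * h\<^sup>2 * (cmod u)\<^sup>2" by (simp add: power_mult_distrib mult_ac)
  qed (use h in auto)
  finally show ?thesis by (simp add: mult_ac)
qed

context periodic_DDE
begin

text \<open>Differentiation under L: the remainder is quadratic in u in the supremum norm, and
  boundedness of L hands the estimate to each component.\<close>

lemma Lc_exp_monomial_derivative:
  "((\<lambda>w. Lc t (mult_bcf h (exp_monomial w l) \<psi>) $ i) has_field_derivative
     Lc t (mult_bcf h (exp_monomial w (Suc l)) \<psi>) $ i) (at w)"
proof (rule has_field_derivative_of_quadratic_bound)
  fix u :: complex assume u: "cmod u \<le> 1"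
  let ?B = "exp (cmod w * h) * h ^ l * (exp h * h\<^sup>2) * (cmod u)\<^sup>2"
  let ?m = "\<lambda>w l. mult_bcf h (exp_monomial w l) \<psi>"
  let ?\<rho> = "?m (w + u) l - ?m w l - u *\<^sub>C ?m w (Suc l)"
  have in_V: "?m w l \<in> state_space h" for w l
    using h_pos by (intro mult_bcf_in_state_space continuous_exp_monomial) simp
  have "norm ?\<rho> \<le> ?B * norm \<psi>"
  proof (rule norm_bound)
    fix \<theta>
    let ?c = "clamp (-h) 0 \<theta>"
    have "?\<rho> \<theta> = (exp_monomial (w + u) l ?c - exp_monomial w l ?c - u * exp_monomial w (Suc l) ?c) *s \<psi> ?c"
      by (simp add: apply_mult_bcf[OF continuous_exp_monomial] apply_scaleC_bcf vec_eq_iff algebra_simps)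
    then have "norm (?\<rho> \<theta>) = cmod (exp_monomial (w + u) l ?c - exp_monomial w l ?c - u * exp_monomial w (Suc l) ?c) * norm (\<psi> ?c)"
      by (simp only: norm_vector_smult)
    also have "\<dots> \<le> ?B * norm \<psi>"
      using clamp_bounds[of h \<theta>] h_pos by (intro mult_mono exp_monomial_remainder norm_bounded u) auto
    finally show "norm (?\<rho> \<theta>) \<le> ?B * norm \<psi>" .
  qed
  moreover have "?\<rho> \<in> state_space h"
    by (intro bcf.subspace_diff bcf.subspace_scale bcf_subspace_state_space in_V)
  then have "norm (Lc t ?\<rho>) \<le> K * norm ?\<rho>" by (rule L_bound)
  moreover have "K * norm ?\<rho> \<le> K * (?B * norm \<psi>)" using calculation(1) K_pos by simp
  moreover have "cmod (Lc t ?\<rho> $ i) \<le> norm (Lc t ?\<rho>)" by (rule Finite_Cartesian_Product.norm_nth_le)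
  ultimately have "cmod (Lc t ?\<rho> $ i) \<le> K * (?B * norm \<psi>)" by linarith
  moreover have "Lc t ?\<rho> $ i = Lc t (?m (w + u) l) $ i - Lc t (?m w l) $ i - u * Lc t (?m w (Suc l)) $ i"
    unfolding Lc_diff Lc_scaleC by simp
  ultimately show "cmod (Lc t (?m (w + u) l) $ i - Lc t (?m w l) $ i - u * Lc t (?m w (Suc l)) $ i)
     \<le> (K * (exp (cmod w * h) * h ^ l * (exp h * h\<^sup>2)) * norm \<psi>) * (cmod u)\<^sup>2"
    by (simp add: mult_ac)
qed

context
  fixes \<zeta> :: "real \<Rightarrow> real \<Rightarrow> real^'n^'n"
  assumes repr: "\<And>t \<phi>. \<phi> \<in> state_space h \<Longrightarrow>
    has_RS_integral 0 h (\<zeta> t) (\<lambda>\<theta>. apply_bcontfun \<phi> (- \<theta>)) (L t \<phi>)"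
begin

text \<open>At the argument -theta the weight exp(w theta) becomes exp(-w theta) and the segment
  yields q(tau - theta), so the integrand is a state read backwards.\<close>

lemma RS_integral_exp:
  assumes q: "continuous_on {\<tau>-h..\<tau>} q"
  shows "RS_integral 0 h (\<zeta> \<tau>) (\<lambda>\<theta>. exp (- w * of_real \<theta>) *s q (\<tau> - \<theta>)) =
    Lc \<tau> (mult_bcf h (exp_monomial w 0) (segment h q \<tau>))"
proof (rule RS_integral_eq, rule has_RS_integral_cong)
  show "has_RS_integral 0 h (\<zeta> \<tau>) (\<lambda>\<theta>. mult_bcf h (exp_monomial w 0) (segment h q \<tau>) (- \<theta>))
    (Lc \<tau> (mult_bcf h (exp_monomial w 0) (segment h q \<tau>)))"
    by (rule has_RS_integral_complexify[OF repr mult_bcf_in_state_space[OF continuous_exp_monomial less_imp_le[OF h_pos]]])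
  show "mult_bcf h (exp_monomial w 0) (segment h q \<tau>) (- \<theta>) = exp (- w * of_real \<theta>) *s q (\<tau> - \<theta>)"
    if "\<theta> \<in> {0..h}" for \<theta>
    using that h_pos
    by (simp add: apply_mult_bcf[OF continuous_exp_monomial] apply_segment[OF q] clamp_idem exp_monomial_def)
qed

text \<open>Outside the integral the characteristic operator is affine in z, which leaves q in the
  first derivative and nothing beyond; the integral part raises its monomial with each
  derivative.\<close>

lemma Delta_deriv_eq:
  assumes q: "continuous_on {\<tau>-h..\<tau>} q"
  shows "Delta_deriv l h \<zeta> z q \<tau> =
    (if l = 0 then vector_derivative q (at \<tau>) + z *s q \<tau> else if l = 1 then q \<tau> else 0)
    - Lc \<tau> (mult_bcf h (exp_monomial z l) (segment h q \<tau>))"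
proof -
  let ?F = "\<lambda>l z. Lc \<tau> (mult_bcf h (exp_monomial z l) (segment h q \<tau>))"
  have "(deriv ^^ l) (\<lambda>w. Delta h \<zeta> w q \<tau> $ i) z =
    ((if l = 0 then vector_derivative q (at \<tau>) + z *s q \<tau> else if l = 1 then q \<tau> else 0) - ?F l z) $ i" for i z
  proof (induction l arbitrary: z)
    case 0
    then show ?case unfolding Delta_def RS_integral_exp[OF q] by simp
  next
    case (Suc l)
    let ?g = "\<lambda>z. ((if l = 0 then vector_derivative q (at \<tau>) + z *s q \<tau> else if l = 1 then q \<tau> else 0) - ?F l z) $ i"
    \<comment> \<open>The induction hypothesis holds at every z, so it rewrites the whole function
      under \<open>deriv\<close>, not only its value.\<close>
    have "(deriv ^^ Suc l) (\<lambda>w. Delta h \<zeta> w q \<tau> $ i) z = deriv ?g z"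
      unfolding funpow.simps o_apply by (rule arg_cong[where f = "\<lambda>f. deriv f z"]) (rule ext, rule Suc)
    also have "\<dots> = (if l = 0 then q \<tau> $ i else 0) - ?F (Suc l) z $ i"
    proof (rule DERIV_imp_deriv)
      have "((\<lambda>z. (if l = 0 then vector_derivative q (at \<tau>) $ i + z * q \<tau> $ i else if l = 1 then q \<tau> $ i else 0)) has_field_derivative
        (if l = 0 then q \<tau> $ i else 0)) (at z)"
        by (cases "l = 0") (auto intro!: derivative_eq_intros)
      then have "((\<lambda>z. (if l = 0 then vector_derivative q (at \<tau>) $ i + z * q \<tau> $ i else if l = 1 then q \<tau> $ i else 0) - ?F l z $ i)
        has_field_derivative (if l = 0 then q \<tau> $ i else 0) - ?F (Suc l) z $ i) (at z)"
        by (intro DERIV_diff Lc_exp_monomial_derivative)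
      moreover have "?g = (\<lambda>z. (if l = 0 then vector_derivative q (at \<tau>) $ i + z * q \<tau> $ i else if l = 1 then q \<tau> $ i else 0) - ?F l z $ i)"
        by (auto simp: fun_eq_iff)
      ultimately show "(?g has_field_derivative (if l = 0 then q \<tau> $ i else 0) - ?F (Suc l) z $ i) (at z)"
        by (simp only:)
    qed
    finally show ?case by simp
  qed
  then show ?thesis by (simp add: Delta_deriv_def vec_eq_iff)
qed

text \<open>The factors 1/l! turn the monomials into the weights of \<open>floquet_fun\<close>, and
  the affine part contributes q_(i-1) through l = 1.\<close>

lemma Delta_sum_eq:
  assumes q: "\<And>j. j \<le> i \<Longrightarrow> continuous_on {\<tau>-h..\<tau>} (q j)"
  shows "(\<Sum>l\<le>i. (1 / fact l) *s Delta_deriv l h \<zeta> \<sigma> (q (i - l)) \<tau>) =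
    vector_derivative (q i) (at \<tau>) + \<sigma> *s q i \<tau> + shift_down (\<lambda>j. q j \<tau>) i - Lc \<tau> (floquet_fun h \<sigma> q i \<tau>)"
proof -
  have w: "(1 / fact l) *\<^sub>C mult_bcf h (exp_monomial \<sigma> l) \<psi> = mult_bcf h (exp_weight \<sigma> l) \<psi>" for l \<psi>
    by (rule bcontfun_eqI) (simp add: apply_scaleC_bcf apply_mult_bcf[OF continuous_exp_monomial]
        apply_mult_bcf[OF continuous_exp_weight] exp_monomial_def exp_weight_def)
  let ?h = "\<lambda>l. if l = 0 then vector_derivative (q i) (at \<tau>) + \<sigma> *s q i \<tau> else if l = 1 then q (i - 1) \<tau> else 0"
  have "(\<Sum>l\<le>i. (1 / fact l) *s Delta_deriv l h \<zeta> \<sigma> (q (i - l)) \<tau>) =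
    (\<Sum>l\<le>i. ?h l - Lc \<tau> (mult_bcf h (exp_weight \<sigma> l) (segment h (q (i - l)) \<tau>)))"
    by (intro sum.cong refl, subst Delta_deriv_eq)
      (auto simp: q w[symmetric] Lc_scaleC vec_eq_iff algebra_simps)
  also have "\<dots> = (\<Sum>l\<le>i. ?h l) - Lc \<tau> (floquet_fun h \<sigma> q i \<tau>)"
    unfolding floquet_fun_def Lc_sum sum_subtractf ..
  also have "(\<Sum>l\<le>i. ?h l) = vector_derivative (q i) (at \<tau>) + \<sigma> *s q i \<tau> + shift_down (\<lambda>j. q j \<tau>) i"
  proof (cases i)
    case (Suc n)
    have "(\<Sum>l\<le>n. ?h (Suc l)) = (\<Sum>l\<le>n. if l = 0 then q (i - 1) \<tau> else 0)"
      by (intro sum.cong) auto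
    then show ?thesis unfolding Suc sum.atMost_Suc_shift by (simp add: shift_down_def)
  qed (simp add: shift_down_def)
  finally show ?thesis .
qed

lemma floquet_system_of_Delta:
  assumes q: "\<And>i. i < m \<Longrightarrow> q i \<in> CT T (k + 1) UNIV"
    and Delta: "\<And>i \<tau>. i < m \<Longrightarrow> (\<Sum>l\<le>i. (1 / fact l) *s Delta_deriv l h \<zeta> \<sigma> (q (i - l)) \<tau>) = 0"
  shows "floquet_system \<sigma> m q"
  unfolding floquet_system_def
proof (intro allI impI conjI)
  fix i t assume i: "i < m"
  show "q i (t + T) = q i t" using q[OF i] by (simp add: CT_iff)
  have "Ck (Suc k) (q i)" using q[OF i] by (simp add: CT_iff del: Ck.simps)
  then obtain d where d: "(q i has_vector_derivative d) (at t)" by auto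
  have "continuous_on {t-h..t} (q j)" if "j \<le> i" for j
    using q[of j] i that Ck_continuous[of "k + 1" "q j"] continuous_on_subset by (auto simp: CT_iff simp del: Ck.simps)
  from Delta_sum_eq[of i t q \<sigma>, OF this] Delta[OF i, of t]
  have "d = Lc t (floquet_fun h \<sigma> q i t) - \<sigma> *s q i t - shift_down (\<lambda>j. q j t) i"
    unfolding vector_derivative_at[OF d] by (simp add: algebra_simps eq_diff_eq add_eq_0_iff)
  with d show "(q i has_vector_derivative Lc t (floquet_fun h \<sigma> q i t) - \<sigma> *s q i t - shift_down (\<lambda>j. q j t) i) (at t)"
    by simp
qed

end

end

text \<open>The periodic system is homogeneous, so q = 0 solves it. The basis claim for a given q is
  therefore tied to \<open>q 0\<close> not vanishing identically, which makes phi_0 nonzero at every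
  time.\<close>

theorem theorem3p3:
  fixes h T s :: real and k m :: nat
    and F :: "(real \<Rightarrow>\<^sub>C (real^'n)) \<Rightarrow> real^'n"
    and \<gamma> :: "real \<Rightarrow> real^'n"
    and L :: "real \<Rightarrow> (real \<Rightarrow>\<^sub>C (real^'n)) \<Rightarrow> real^'n"
    and \<zeta> :: "real \<Rightarrow> real \<Rightarrow> real^'n^'n"
    and lam \<sigma> :: complex
  assumes h: "0 < h" and k: "1 \<le> k"
    and F: "smooth_map_on (k + 1) (state_space h) F"
    and T: "0 < T" and \<gamma>_periodic: "\<And>t. \<gamma> (t + T) = \<gamma> t"
    and \<gamma>_solution: "\<And>t. (\<gamma> has_vector_derivative F (segment h \<gamma> t)) (at t)"
    and L: "\<And>t. (F has_derivative L t) (at (segment h \<gamma> t) within state_space h)"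
    and nonhyp: "nonhyperbolic h L T s"
    and \<zeta>_periodic: "\<And>t \<theta>. \<theta> \<in> {0..h} \<Longrightarrow> \<zeta> (t + T) \<theta> = \<zeta> t \<theta>"
    and \<zeta>_bv: "\<And>t. bounded_variation_on 0 h (\<zeta> t)"
    and \<zeta>_right_cont: "\<And>t \<theta>. \<theta> \<in> {0<..<h} \<Longrightarrow> continuous (at_right \<theta>) (\<zeta> t)"
    and \<zeta>_zero: "\<And>t. \<zeta> t 0 = 0"
    and \<zeta>_repr: "\<And>t \<phi>. \<phi> \<in> state_space h \<Longrightarrow>
           has_RS_integral 0 h (\<zeta> t) (\<lambda>\<theta>. apply_bcontfun \<phi> (- \<theta>)) (L t \<phi>)"
    and lam_multiplier: "floquet_multiplier h L T s lam"
    and lam_not_neg: "lam \<notin> of_real ` {..<0}"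
    and lam_geometric: "geometric_multiplicity h L T s lam = 1"
    and m: "m = algebraic_multiplicity h L T s lam"
    and \<sigma>: "lam = exp (\<sigma> * of_real T)"
  shows
    "(\<exists>\<phi> :: nat \<Rightarrow> real \<Rightarrow> (real \<Rightarrow>\<^sub>C (complex^'n)).
        (\<forall>i<m. \<phi> i \<in> CT T (k + 1) (state_space h) \<and> \<phi> i \<in> calA_dom h T L \<and>
           (\<forall>\<tau>. calA h (\<phi> i) \<tau> - \<sigma> *\<^sub>C \<phi> i \<tau> = (if i = 0 then 0 else \<phi> (i - 1) \<tau>))) \<and>
        (\<forall>\<tau>. ordered_basis (gen_eigenspace h L T \<tau> lam) m (\<lambda>i. \<phi> i \<tau>)))
     \<and>
     (\<forall>q :: nat \<Rightarrow> real \<Rightarrow> complex^'n.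
        (\<forall>i<m. q i \<in> CT T (k + 1) UNIV \<and>
           (\<forall>\<tau>. (\<Sum>l\<le>i. (1 / fact l) *s Delta_deriv l h \<zeta> \<sigma> (q (i - l)) \<tau>) = 0)) \<longrightarrow>
        (\<exists>\<phi> :: nat \<Rightarrow> real \<Rightarrow> (real \<Rightarrow>\<^sub>C (complex^'n)).
           (\<forall>i<m. \<forall>\<tau>. \<forall>\<theta>\<in>{-h..0}.
              apply_bcontfun (\<phi> i \<tau>) \<theta> = exp (\<sigma> * of_real \<theta>) *s
                (\<Sum>l\<le>i. (of_real \<theta> ^ l / fact l) *s q (i - l) (\<tau> + \<theta>))) \<and>
           (\<forall>i<m. \<phi> i \<in> CT T (k + 1) (state_space h) \<and> \<phi> i \<in> calA_dom h T L \<and>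
              (\<forall>\<tau>. calA h (\<phi> i) \<tau> - \<sigma> *\<^sub>C \<phi> i \<tau> = (if i = 0 then 0 else \<phi> (i - 1) \<tau>))) \<and>
           ((\<exists>\<tau>. q 0 \<tau> \<noteq> 0) \<longrightarrow>
              (\<forall>\<tau>. ordered_basis (gen_eigenspace h L T \<tau> lam) m (\<lambda>i. \<phi> i \<tau>)))))"
proof -
  note lin = linearization_along_solution[OF h F T \<gamma>_periodic \<gamma>_solution L]
  obtain K where K: "0 < K" "\<And>t \<phi>. \<phi> \<in> state_space h \<Longrightarrow> norm (L t \<phi>) \<le> K * norm \<phi>"
    using lin(3) by blast
  \<comment> \<open>The factor 2 is the cost of complexifying the bound on L.\<close>
  interpret periodic_DDE h T "2 * K" k L
  proof (rule periodic_DDE.intro)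
    show "linear (L t)" for t by (rule has_derivative_linear[OF L])
    show "norm (complexify (L t) \<phi>) \<le> 2 * K * norm \<phi>" if "\<phi> \<in> state_space h" for t \<phi>
      by (rule norm_complexify_le[OF K(2) less_imp_le[OF K(1)] that])
    show "complexify (L (t + T)) \<phi> = complexify (L t) \<phi>" if "\<phi> \<in> state_space h" for t \<phi>
      unfolding complexify_eq using that by (simp add: lin(1) re_bcf_in_state_space im_bcf_in_state_space)
    show "Ck j (\<lambda>t. complexify (L t) (x t))"
      if "j \<le> k" "Ck j x" "\<And>t. x t \<in> state_space h" for j and x :: "real \<Rightarrow> (real \<Rightarrow>\<^sub>C (complex^'n))"
      unfolding complexify_eq using that
      by (intro Ck_add Ck_bounded_linear[OF bounded_linear_of_real_vec] Ck_bounded_linear[OF bounded_linear_vector_smult]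
        lin(2) Ck_bounded_linear[OF bounded_linear_re_bcf] Ck_bounded_linear[OF bounded_linear_im_bcf]
        re_bcf_in_state_space im_bcf_in_state_space)
  qed (use h T K(1) in auto)
  have props: "(\<forall>i<m. floquet_fun h \<sigma> q i \<in> CT T (k + 1) (state_space h) \<and> floquet_fun h \<sigma> q i \<in> calA_dom h T L \<and>
      (\<forall>\<tau>. calA h (floquet_fun h \<sigma> q i) \<tau> - \<sigma> *\<^sub>C floquet_fun h \<sigma> q i \<tau> =
        (if i = 0 then 0 else floquet_fun h \<sigma> q (i - 1) \<tau>)))"
    if "floquet_system \<sigma> m q" for q
    using floquet_fun_in_CT[OF that] floquet_fun_in_calA_dom[OF that] calA_floquet_fun[OF that]
    by (simp add: shift_down_def)
  note basis = floquet_basis[OF \<sigma> lam_geometric m]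
  show ?thesis (is "?basis \<and> (\<forall>q. _ q \<longrightarrow> ?formula q)")
  proof (intro conjI allI impI)
    obtain q where q: "floquet_system \<sigma> m q" "m > 0 \<longrightarrow> (\<exists>t. q 0 t \<noteq> 0)"
      using floquet_system_exists[OF \<sigma> lam_geometric m] by blast
    show ?basis using props[OF q(1)] basis[OF q(1)] q(2) by blast
  next
    fix q :: "nat \<Rightarrow> real \<Rightarrow> complex^'n"
    assume q: "\<forall>i<m. q i \<in> CT T (k + 1) UNIV \<and>
           (\<forall>\<tau>. (\<Sum>l\<le>i. (1 / fact l) *s Delta_deriv l h \<zeta> \<sigma> (q (i - l)) \<tau>) = 0)"
    then have sys: "floquet_system \<sigma> m q" by (intro floquet_system_of_Delta[OF \<zeta>_repr]) auto
    show "?formula q"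
    proof (intro exI[of _ "floquet_fun h \<sigma> q"] conjI allI impI ballI)
      show "floquet_fun h \<sigma> q i \<tau> \<theta> = exp (\<sigma> * of_real \<theta>) *s
                (\<Sum>l\<le>i. (of_real \<theta> ^ l / fact l) *s q (i - l) (\<tau> + \<theta>))"
        if "i < m" "\<theta> \<in> {-h..0}" for i \<tau> \<theta>
        using that h by (simp add: apply_floquet_fun q_continuous[OF sys] clamp_idem exp_shift_def)
      show "ordered_basis (gen_eigenspace h L T \<tau> lam) m (\<lambda>i. floquet_fun h \<sigma> q i \<tau>)" if "\<exists>\<tau>. q 0 \<tau> \<noteq> 0" for \<tau>
        using basis[OF sys] that by blast
    qed (use props[OF sys] in auto)
  qed
qed

end
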